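(* Let $K=B_3=\{x\in\mathbb{R}^3:|x|\le1\}$ and let $\gamma$ be a constant with $0<\gamma<1$. Then the operator $G$ has no eigenvalues, i.e. $\sigma_p(G)=\emptyset$.
   Context: Let $\Omega=\{x\in\mathbb{R}^3:|x|>1\}$, $\Gamma=\{|x|=1\}$, and let $\nu=x/|x|$ be the unit normal on $\Gamma$ pointing into $\Omega$. Let $\mathcal{H}=H^1(\Omega)\times L^2(\Omega)$. The operator $G=\begin{pmatrix}0&1\\ \Delta&0\end{pmatrix}$ has domain $\mathcal{D}\subset\mathcal{H}$ equal to the closure, in the graph norm $(\|f\|_{\mathcal H}^2+\|Gf\|_{\mathcal H}^2)^{1/2}$, of the set of pairs $f=(f_1,f_2)$ of compactly supported smooth functions on $\mathbb{R}^3$ (restricted to $\Omega$) satisfying $\partial_\nu f_1-\gamma f_2=0$ on $\Gamma$. $G$ is the generator of the contraction semigroup $e^{tG}$, $t\ge0$, of the dissipative wave problem $u_{tt}-\Delta u=0$ in $\mathbb{R}^+_t\times\Omega$, $\partial_\nu u-\gamma\partial_tu=0$ on $\mathbb{R}^+_t\times\Gamma$. An eigenvalue is $\lambda\in\mathbb{C}$ with $Gf=\lambda f$ for some $0\ne f\in\mathcal{D}$. *)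

theory Defs
  imports "HOL-Analysis.Analysis"
begin

type_synonym R3 = "real ^ 3"

text \<open>Elements of function spaces are represented by functions on all of \<open>R3\<close>. Only their values
  on the open set \<open>U\<close> matter, and functions that agree almost everywhere on \<open>U\<close> are identified.\<close>

definition pderiv_dir :: "3 \<Rightarrow> (R3 \<Rightarrow> complex) \<Rightarrow> R3 \<Rightarrow> complex" where
  "pderiv_dir i u x = frechet_derivative u (at x) (axis i 1)"

definition laplacian :: "(R3 \<Rightarrow> complex) \<Rightarrow> R3 \<Rightarrow> complex" where
  "laplacian u x = (\<Sum>i\<in>UNIV. pderiv_dir i (pderiv_dir i u) x)"

text \<open>Differentiability of all iterated partial derivatives (the empty list gives \<open>u\<close> itself)
  makes them all continuous, so this is \<open>C\<^sup>\<infinity>\<close>.\<close>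

definition smooth :: "(R3 \<Rightarrow> complex) \<Rightarrow> bool" where
  "smooth u \<longleftrightarrow> (\<forall>is :: 3 list. \<forall>x. fold pderiv_dir is u differentiable (at x))"

definition Cc_infty :: "R3 set \<Rightarrow> (R3 \<Rightarrow> complex) set" where
  "Cc_infty U = {\<phi>. smooth \<phi> \<and> compact (closure {x. \<phi> x \<noteq> 0}) \<and> closure {x. \<phi> x \<noteq> 0} \<subseteq> U}"

definition L2 :: "R3 set \<Rightarrow> (R3 \<Rightarrow> complex) set" where
  "L2 U = {u \<in> borel_measurable (lebesgue_on U). integrable (lebesgue_on U) (\<lambda>x. (norm (u x))\<^sup>2)}"

definition L2_norm :: "R3 set \<Rightarrow> (R3 \<Rightarrow> complex) \<Rightarrow> real" where
  "L2_norm U u = sqrt (LINT x|lebesgue_on U. (norm (u x))\<^sup>2)"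

definition has_weak_pderiv :: "R3 set \<Rightarrow> 3 \<Rightarrow> (R3 \<Rightarrow> complex) \<Rightarrow> (R3 \<Rightarrow> complex) \<Rightarrow> bool" where
  "has_weak_pderiv U i u w \<longleftrightarrow>
     (\<forall>\<phi>\<in>Cc_infty U. (LINT x|lebesgue_on U. u x * pderiv_dir i \<phi> x)
                      = - (LINT x|lebesgue_on U. w x * \<phi> x))"

definition has_weak_laplacian :: "R3 set \<Rightarrow> (R3 \<Rightarrow> complex) \<Rightarrow> (R3 \<Rightarrow> complex) \<Rightarrow> bool" where
  "has_weak_laplacian U u w \<longleftrightarrow>
     (\<forall>\<phi>\<in>Cc_infty U. (LINT x|lebesgue_on U. u x * laplacian \<phi> x)
                      = (LINT x|lebesgue_on U. w x * \<phi> x))"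

text \<open>Square-integrable distributional derivatives are unique up to null sets, so the choices below
  only select a representative. They are arbitrary when no such derivative exists.\<close>

definition weak_pderiv :: "R3 set \<Rightarrow> 3 \<Rightarrow> (R3 \<Rightarrow> complex) \<Rightarrow> R3 \<Rightarrow> complex" where
  "weak_pderiv U i u = (SOME w. w \<in> L2 U \<and> has_weak_pderiv U i u w)"

definition weak_laplacian :: "R3 set \<Rightarrow> (R3 \<Rightarrow> complex) \<Rightarrow> R3 \<Rightarrow> complex" where
  "weak_laplacian U u = (SOME w. w \<in> L2 U \<and> has_weak_laplacian U u w)"

definition H1 :: "R3 set \<Rightarrow> (R3 \<Rightarrow> complex) set" where
  "H1 U = {u \<in> L2 U. \<forall>i. \<exists>w\<in>L2 U. has_weak_pderiv U i u w}"

definition H1_norm :: "R3 set \<Rightarrow> (R3 \<Rightarrow> complex) \<Rightarrow> real" where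
  "H1_norm U u = sqrt ((L2_norm U u)\<^sup>2 + (\<Sum>i\<in>UNIV. (L2_norm U (weak_pderiv U i u))\<^sup>2))"

type_synonym state = "(R3 \<Rightarrow> complex) \<times> (R3 \<Rightarrow> complex)"

definition obstacle :: "R3 set" where
  "obstacle = cball 0 1"

definition Omega :: "R3 set" where
  "Omega = - obstacle"

definition Gamma :: "R3 set" where
  "Gamma = sphere 0 1"

definition normal_deriv :: "(R3 \<Rightarrow> complex) \<Rightarrow> R3 \<Rightarrow> complex" where
  "normal_deriv u x = frechet_derivative u (at x) (x /\<^sub>R norm x)"

definition energy_space :: "state set" where
  "energy_space = H1 Omega \<times> L2 Omega"

definition energy_norm :: "state \<Rightarrow> real" where
  "energy_norm f = sqrt ((H1_norm Omega (fst f))\<^sup>2 + (L2_norm Omega (snd f))\<^sup>2)"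

definition state_diff :: "state \<Rightarrow> state \<Rightarrow> state" where
  "state_diff f h = ((\<lambda>x. fst f x - fst h x), (\<lambda>x. snd f x - snd h x))"

definition state_scale :: "complex \<Rightarrow> state \<Rightarrow> state" where
  "state_scale c f = ((\<lambda>x. c * fst f x), (\<lambda>x. c * snd f x))"

definition zero_state :: state where
  "zero_state = ((\<lambda>x. 0), (\<lambda>x. 0))"

definition state_eq :: "state \<Rightarrow> state \<Rightarrow> bool" where
  "state_eq f h \<longleftrightarrow> (AE x in lebesgue_on Omega. fst f x = fst h x \<and> snd f x = snd h x)"

definition G :: "state \<Rightarrow> state" where
  "G f = (snd f, weak_laplacian Omega (fst f))"

definition graph_norm :: "state \<Rightarrow> real" where
  "graph_norm f = sqrt ((energy_norm f)\<^sup>2 + (energy_norm (G f))\<^sup>2)"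

text \<open>The states \<open>f\<close> of the energy space for which \<open>G f\<close>, taken in the sense of distributions,
  lies in the energy space again. This set of states is complete for the graph norm, so closures taken
  in it are the closures in the graph norm.\<close>

definition maximal_domain :: "state set" where
  "maximal_domain = {f \<in> energy_space. snd f \<in> H1 Omega \<and>
     (\<exists>w\<in>L2 Omega. has_weak_laplacian Omega (fst f) w)}"

definition G_core :: "real \<Rightarrow> state set" where
  "G_core \<gamma> = {h. fst h \<in> Cc_infty UNIV \<and> snd h \<in> Cc_infty UNIV \<and>
     (\<forall>x\<in>Gamma. normal_deriv (fst h) x - of_real \<gamma> * snd h x = 0)}"

definition G_domain :: "real \<Rightarrow> state set" where
  "G_domain \<gamma> = {f \<in> maximal_domain. \<forall>\<epsilon>>0. \<exists>h\<in>G_core \<gamma>. graph_norm (state_diff f h) < \<epsilon>}"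

definition point_spectrum :: "real \<Rightarrow> complex set" where
  "point_spectrum \<gamma> = {\<mu>. \<exists>f\<in>G_domain \<gamma>. \<not> state_eq f zero_state \<and> state_eq (G f) (state_scale \<mu> f)}"

end

theory Submission
  imports Defs "HOL-Complex_Analysis.Conformal_Mappings"
begin

text \<open>
  An eigenstate \<open>f\<close> with eigenvalue \<open>\<mu>\<close> has \<open>f\<^sub>2 = \<mu> f\<^sub>1\<close>, and \<open>u = f\<^sub>1\<close> is a square-integrable solution of
  \<open>\<Delta>u = \<mu>\<^sup>2 u\<close> outside the unit ball with \<open>\<partial>\<^sub>r u = \<gamma> \<mu> u\<close> on the sphere. Separation of variables would
  reduce the claim to a fact about modified spherical Bessel functions: with \<open>Re s \<ge> 0\<close> and
  \<open>s = \<mu>\<close> or \<open>s = - \<mu>\<close>, the decaying radial solution of each degree \<open>n\<close> must violate the boundary condition. The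
  proof keeps this fact but dualises the rest, so that traces, surface measure, regularity of
  \<open>u\<close> and spherical harmonics never enter.

  \<^bold>\<open>Duality.\<close> If \<open>\<phi>\<close> is twice continuously differentiable with bounded support and satisfies
  \<open>\<partial>\<^sub>r \<phi> = \<gamma> \<mu> \<phi>\<close> on the sphere, then \<open>u\<close> is orthogonal to \<open>\<Delta>\<phi> - \<mu>\<^sup>2 \<phi>\<close> (\<open>eigenstate_orthogonal\<close>).
  For a core state \<open>h\<close> near \<open>f\<close> the vector field
  \<open>\<phi> \<nabla>h\<^sub>1 - h\<^sub>1 \<nabla>\<phi> - \<gamma> (h\<^sub>2 - \<mu> h\<^sub>1) \<phi> x\<close> has no flux through the sphere, so its divergence
  has integral zero; the last term has been extended into the volume, where it is small because
  \<open>h\<^sub>2 - \<mu> h\<^sub>1\<close> is small in \<open>H\<^sup>1\<close>.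

  \<^bold>\<open>Induction on the degree.\<close> Let \<open>P\<close> be a monomial of degree \<open>n\<close>. For \<open>\<phi> = c(r) P\<close> the expression
  \<open>\<Delta>\<phi> - \<mu>\<^sup>2 \<phi>\<close> is a radial function times \<open>P\<close>, plus \<open>c \<Delta>P\<close>, whose monomials have degree \<open>n - 2\<close>. If \<open>u\<close> is already
  orthogonal to all radial multiples of monomials of smaller degree, only the radial equation
  for \<open>c\<close> remains (\<open>radial_monomial_orthogonal\<close>). It is solved with an arbitrary source term and
  the right boundary condition by adding a multiple of the decaying homogeneous solution,
  truncated at radius \<open>N\<close>. The multiple exists because this solution violates the boundary condition
  (\<open>boundary_value_nonzero\<close>), and the truncation error tends to \<open>0\<close> in \<open>L\<^sup>2\<close> even if \<open>Re s = 0\<close>.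
  Radial multiples of polynomials are dense, hence \<open>u = 0\<close>.

  \<^bold>\<open>The boundary values.\<close> With \<open>z = 1 / s\<close>, the ratio \<open>W\<^sub>n\<close> of consecutive radial solutions obeys
  \<open>W\<^sub>0 = 1 + z\<close> and \<open>W\<^sub>n\<^sub>+\<^sub>1 = 1 / W\<^sub>n + (2 n + 3) z\<close>, and the boundary condition would mean \<open>W\<^sub>n - n z = \<gamma>\<close> (if
  \<open>s = - \<mu>\<close>) or \<open>W\<^sub>n - n z = - \<gamma>\<close> (if \<open>s = \<mu>\<close>). The latter is impossible because the left side has positive
  real part. For the former, \<open>W\<^sub>n - n z\<close> is at least \<open>1\<close> on the positive real axis, and it is not real
  elsewhere: \<open>Im (W\<^sub>n - (n + 1) z) \<ge> 0\<close> in the first quadrant by the maximum principle, the inequality on the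
  imaginary axis being the positivity of the coefficients of the squared modulus of a
  Bessel polynomial.
\<close>

section \<open>Continuously differentiable functions and the divergence theorem\<close>

text \<open>The partial derivatives are carried along explicitly because the vector fields below are
  integrated through their formulas.\<close>

definition C1_on :: "R3 set \<Rightarrow> (R3 \<Rightarrow> complex) \<Rightarrow> (3 \<Rightarrow> R3 \<Rightarrow> complex) \<Rightarrow> bool" where
  "C1_on S F D \<longleftrightarrow>
    (\<forall>x\<in>S. (F has_derivative (\<lambda>v. \<Sum>i\<in>UNIV. of_real (v $ i) * D i x)) (at x)) \<and> (\<forall>i. continuous_on S (D i))"

lemma C1_on_has_derivative:
  "C1_on S F D \<Longrightarrow> x \<in> S \<Longrightarrow> (F has_derivative (\<lambda>v. \<Sum>i\<in>UNIV. of_real (v $ i) * D i x)) (at x)"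
  by (simp add: C1_on_def)

lemma C1_on_continuous_derivative: "C1_on S F D \<Longrightarrow> continuous_on S (D i)"
  by (simp add: C1_on_def)

lemma C1_on_continuous: "C1_on S F D \<Longrightarrow> continuous_on S F"
  by (meson C1_on_has_derivative continuous_at_imp_continuous_on has_derivative_continuous)

lemma C1_on_const: "C1_on S (\<lambda>x. c) (\<lambda>i x. 0)"
  by (simp add: C1_on_def)

lemma C1_on_add: "C1_on S F D \<Longrightarrow> C1_on S H E \<Longrightarrow> C1_on S (\<lambda>x. F x + H x) (\<lambda>i x. D i x + E i x)"
  unfolding C1_on_def
  by (auto intro!: continuous_intros derivative_eq_intros simp: sum.distrib algebra_simps)

lemma C1_on_diff: "C1_on S F D \<Longrightarrow> C1_on S H E \<Longrightarrow> C1_on S (\<lambda>x. F x - H x) (\<lambda>i x. D i x - E i x)"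
  unfolding C1_on_def
  by (auto intro!: continuous_intros derivative_eq_intros simp: sum_subtractf algebra_simps)

lemma C1_on_mult:
  assumes "C1_on S F D" "C1_on S H E"
  shows "C1_on S (\<lambda>x. F x * H x) (\<lambda>i x. D i x * H x + F x * E i x)"
proof -
  have "((\<lambda>x. F x * H x) has_derivative (\<lambda>v. \<Sum>i\<in>UNIV. of_real (v $ i) * (D i x * H x + F x * E i x))) (at x)"
    if "x \<in> S" for x
    by (rule has_derivative_eq_rhs[OF has_derivative_mult[OF C1_on_has_derivative[OF assms(1) that] C1_on_has_derivative[OF assms(2) that]]])
      (simp add: sum_distrib_left sum_distrib_right sum.distrib algebra_simps)
  moreover have "continuous_on S (\<lambda>x. D i x * H x + F x * E i x)" for i
    using assms by (intro continuous_intros C1_on_continuous_derivative C1_on_continuous)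
  ultimately show ?thesis by (simp add: C1_on_def)
qed

lemma C1_on_cmult: "C1_on S F D \<Longrightarrow> C1_on S (\<lambda>x. c * F x) (\<lambda>i x. c * D i x)"
  using C1_on_mult[OF C1_on_const[of S c]] by simp

lemma C1_on_sum:
  assumes "\<And>k. k \<in> A \<Longrightarrow> C1_on S (F k) (D k)"
  shows "C1_on S (\<lambda>x. \<Sum>k\<in>A. F k x) (\<lambda>i x. \<Sum>k\<in>A. D k i x)"
  using assms
proof (induction A rule: infinite_finite_induct)
  case (insert k A)
  then show ?case using C1_on_add[of S "F k" "D k"] by simp
qed (auto intro: C1_on_const)

lemma C1_on_coord: "C1_on S (\<lambda>x. of_real (x $ k)) (\<lambda>i x. if i = k then 1 else 0)"
proof -
  have "((\<lambda>x::R3. complex_of_real (x $ k)) has_derivative (\<lambda>v. of_real (v $ k))) (at x)" for x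
    by (intro bounded_linear_imp_has_derivative bounded_linear_compose[OF bounded_linear_of_real bounded_linear_vec_nth])
  moreover have "(\<Sum>i\<in>UNIV. complex_of_real (v $ i) * (if i = k then 1 else 0)) = of_real (v $ k)" for v :: R3
    by (simp add: if_distrib cong: if_cong)
  ultimately show ?thesis by (simp add: C1_on_def)
qed

text \<open>Radial functions are differentiated by \<open>(1/r) d/dr\<close> throughout: this operator keeps gradients free
  of divisions by the norm.\<close>

lemma C1_on_radial:
  fixes p q :: "real \<Rightarrow> complex"
  assumes d: "\<And>r. r > 0 \<Longrightarrow> (p has_vector_derivative (of_real r * q r)) (at r)" and c: "continuous_on {0<..} q"
  shows "C1_on (- {0}) (\<lambda>x. p (norm x)) (\<lambda>i x. q (norm x) * of_real (x $ i))"
proof -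
  have "((\<lambda>x. p (norm x)) has_derivative (\<lambda>v. \<Sum>i\<in>UNIV. of_real (v $ i) * (q (norm x) * of_real (x $ i)))) (at x)"
    if x: "x \<noteq> 0" for x :: R3
  proof -
    have n: "(norm has_derivative (\<lambda>v. v \<bullet> sgn x)) (at x)"
      using has_derivative_norm[of x] x by (simp add: inner_commute)
    have "(p has_derivative (\<lambda>t. t *\<^sub>R (of_real (norm x) * q (norm x)))) (at (norm x))"
      using d[of "norm x"] x by (simp add: has_vector_derivative_def)
    from has_derivative_compose[OF n this]
    have "((\<lambda>x. p (norm x)) has_derivative (\<lambda>v. (v \<bullet> sgn x) *\<^sub>R (of_real (norm x) * q (norm x)))) (at x)" .
    moreover have "(v \<bullet> sgn x) *\<^sub>R (of_real (norm x) * q (norm x)) = (\<Sum>i\<in>UNIV. of_real (v $ i) * (q (norm x) * of_real (x $ i)))" for v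
    proof -
      have "(v \<bullet> sgn x) * norm x = v \<bullet> x" using x by (simp add: sgn_div_norm)
      then have "(v \<bullet> sgn x) *\<^sub>R (of_real (norm x) * q (norm x)) = of_real (v \<bullet> x) * q (norm x)"
        by (metis mult.assoc of_real_mult scaleR_conv_of_real)
      also have "\<dots> = (\<Sum>i\<in>UNIV. of_real (v $ i) * (q (norm x) * of_real (x $ i)))"
        by (simp add: inner_vec_def sum_distrib_right sum_distrib_left algebra_simps)
      finally show ?thesis .
    qed
    ultimately show ?thesis by simp
  qed
  moreover have "continuous_on (- {0}) (\<lambda>x::R3. q (norm x) * of_real (x $ i))" for i
    by (intro continuous_intros continuous_on_compose2[OF c]) auto
  ultimately show ?thesis by (simp add: C1_on_def)
qed

lemma smooth_pderiv_dir: "smooth u \<Longrightarrow> smooth (pderiv_dir i u)"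
  unfolding smooth_def by (metis fold_simps(2))

lemma smooth_differentiable: "smooth u \<Longrightarrow> u differentiable (at x)"
  unfolding smooth_def by (metis fold_simps(1))

lemma smooth_C1_on:
  assumes "smooth u" shows "C1_on S u (\<lambda>i. pderiv_dir i u)"
proof -
  have "(u has_derivative (\<lambda>v. \<Sum>i\<in>UNIV. of_real (v $ i) * pderiv_dir i u x)) (at x)" for x
  proof -
    have d: "(u has_derivative frechet_derivative u (at x)) (at x)"
      using smooth_differentiable[OF assms] frechet_derivative_works by blast
    interpret linear "frechet_derivative u (at x)" using d by (rule has_derivative_linear)
    have "frechet_derivative u (at x) v = (\<Sum>i\<in>UNIV. of_real (v $ i) * pderiv_dir i u x)" for v
    proof -
      have "frechet_derivative u (at x) v = frechet_derivative u (at x) (\<Sum>i\<in>UNIV. v $ i *\<^sub>R axis i 1)"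
        by (simp add: basis_expansion scalar_mult_eq_scaleR[symmetric])
      also have "\<dots> = (\<Sum>i\<in>UNIV. of_real (v $ i) * pderiv_dir i u x)"
        unfolding sum scale by (simp add: pderiv_dir_def scaleR_conv_of_real)
      finally show ?thesis .
    qed
    with d show ?thesis by (metis (no_types, lifting) ext)
  qed
  moreover have "continuous_on S (pderiv_dir i u)" for i
    using smooth_differentiable[OF smooth_pderiv_dir[OF assms]]
    by (meson continuous_at_imp_continuous_on differentiable_imp_continuous_within)
  ultimately show ?thesis by (simp add: C1_on_def)
qed

lemma smooth_continuous: "smooth u \<Longrightarrow> continuous_on S u"
  using C1_on_continuous smooth_C1_on by blast

lemma bounded_support_integrable:
  fixes f :: "R3 \<Rightarrow> 'a::{banach, second_countable_topology}"
  assumes "f \<in> borel_measurable lborel" "\<And>x. norm (f x) \<le> B" "\<And>x. norm x > R \<Longrightarrow> f x = 0"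
  shows "integrable lborel f"
proof (rule Bochner_Integration.integrable_bound[where f = "\<lambda>x. B * indicator (cball 0 R) x"])
  have "emeasure lborel (cball (0::R3) R) < \<infinity>"
    by (rule emeasure_bounded_finite) auto
  then show "integrable lborel (\<lambda>x. B * indicator (cball (0::R3) R) x)" by simp
  show "AE x in lborel. norm (f x) \<le> norm (B * indicator (cball 0 R) x)"
  proof (rule AE_I2)
    fix x :: R3
    show "norm (f x) \<le> norm (B * indicator (cball 0 R) x)"
      using assms(2)[of x] assms(3)[of x] by (cases "norm x \<le> R") auto
  qed
qed (use assms in simp)

lemma integral_translation:
  fixes f :: "R3 \<Rightarrow> complex"
  assumes "f \<in> borel_measurable lborel"
  shows "(LINT x|lborel. f (e + x)) = integral\<^sup>L lborel f"
    and "integrable lborel f \<Longrightarrow> integrable lborel (\<lambda>x. f (e + x))"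
proof -
  have d: "distr lborel borel ((+) e) = (lborel :: R3 measure)" by (rule lborel_distr_plus)
  have m: "(+) e \<in> borel_measurable (lborel :: R3 measure)" by simp
  show "(LINT x|lborel. f (e + x)) = integral\<^sup>L lborel f"
    using integral_distr[OF m, of f] assms d by simp
  show "integrable lborel (\<lambda>x. f (e + x))" if "integrable lborel f"
    using integrable_distr_eq[OF m, of f] assms d that by simp
qed

text \<open>The integral of a difference quotient is zero by translation invariance; dominated convergence
  passes to the derivative. Only boundedness of the one derivative is needed, which suits fields that
  are glued from two pieces.\<close>

lemma integral_partial_derivative:
  fixes F :: "R3 \<Rightarrow> complex"
  assumes d: "\<And>x. (F has_derivative (\<lambda>v. \<Sum>j\<in>UNIV. of_real (v $ j) * D j x)) (at x)"
    and B: "\<And>x. cmod (D i x) \<le> B" and R: "\<And>x. norm x > R \<Longrightarrow> F x = 0"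
  shows "integral\<^sup>L lborel (D i) = 0" "integrable lborel (D i)"
proof -
  define e :: R3 where "e = axis i 1"
  have e: "norm e = 1" by (simp add: e_def)
  have cont: "continuous_on UNIV F"
    using d has_derivative_continuous continuous_at_imp_continuous_on by blast
  have meas [measurable]: "F \<in> borel_measurable lborel"
    using borel_measurable_continuous_onI[OF cont] by simp
  obtain M where M: "\<And>x. cmod (F x) \<le> M"
  proof -
    have "compact (F ` cball 0 R)"
      using cont by (intro compact_continuous_image) (auto intro: continuous_on_subset)
    then obtain M where "\<forall>y\<in>F ` cball 0 R. norm y \<le> M" using compact_imp_bounded bounded_iff by blast
    then have "cmod (F x) \<le> max M 0" for x
      using R[of x] by (cases "norm x \<le> R") (auto simp: le_max_iff_disj)
    then show thesis using that by blast
  qed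
  have int: "integrable lborel F" by (rule bounded_support_integrable[OF meas M R])
  have line: "((\<lambda>t. F (x + t *\<^sub>R e)) has_vector_derivative D i (x + t *\<^sub>R e)) (at t within T)" for x t T
  proof -
    have "((\<lambda>t. x + t *\<^sub>R e) has_derivative (\<lambda>s. s *\<^sub>R e)) (at t within T)"
      by (auto intro!: derivative_eq_intros)
    from has_derivative_compose[OF this d]
    have "((\<lambda>t. F (x + t *\<^sub>R e)) has_derivative (\<lambda>s. \<Sum>j\<in>UNIV. of_real ((s *\<^sub>R e) $ j) * D j (x + t *\<^sub>R e))) (at t within T)" .
    moreover have "(\<Sum>j\<in>UNIV. of_real ((s *\<^sub>R e) $ j) * D j y) = s *\<^sub>R D i y" for s y
    proof -
      have "(\<Sum>j\<in>UNIV. of_real ((s *\<^sub>R e) $ j) * D j y) = (\<Sum>j\<in>UNIV. if j = i then of_real s * D j y else 0)"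
        by (intro sum.cong) (auto simp: e_def axis_def)
      then show ?thesis by (simp add: scaleR_conv_of_real)
    qed
    ultimately show ?thesis by (simp add: has_vector_derivative_def)
  qed
  define f where "f k x = real (Suc k) *\<^sub>R (F (e /\<^sub>R real (Suc k) + x) - F x)" for k x
  have lim: "(\<lambda>k. f k x) \<longlonglongrightarrow> D i x" for x
  proof -
    have "((\<lambda>t. (F (x + t *\<^sub>R e) - F x) /\<^sub>R t) \<longlongrightarrow> D i x) (at 0)"
    proof (rule LIM_zero_cancel, rule tendsto_norm_zero_cancel, rule Lim_transform_eventually)
      show "((\<lambda>t. cmod (F (x + t *\<^sub>R e) - F x - t *\<^sub>R D i x) / \<bar>t\<bar>) \<longlongrightarrow> 0) (at 0)"
        using line[of x 0 UNIV] by (simp add: has_vector_derivative_def has_derivative_iff_norm)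
      have "cmod (F (x + t *\<^sub>R e) - F x - t *\<^sub>R D i x) / \<bar>t\<bar> = cmod ((F (x + t *\<^sub>R e) - F x) /\<^sub>R t - D i x)"
        if "t \<noteq> 0" for t
      proof -
        have "(F (x + t *\<^sub>R e) - F x) /\<^sub>R t - D i x = (F (x + t *\<^sub>R e) - F x - t *\<^sub>R D i x) /\<^sub>R t"
          using that by (simp add: scaleR_diff_right)
        then show ?thesis by (simp add: divide_inverse mult.commute)
      qed
      then show "\<forall>\<^sub>F t in at 0. cmod (F (x + t *\<^sub>R e) - F x - t *\<^sub>R D i x) / \<bar>t\<bar> = cmod ((F (x + t *\<^sub>R e) - F x) /\<^sub>R t - D i x)"
        by (auto simp: eventually_at_filter)
    qed
    moreover have "filterlim (\<lambda>k. inverse (real (Suc k))) (at 0) sequentially"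
      by (rule filterlim_atI[OF LIMSEQ_inverse_real_of_nat]) auto
    ultimately have "(\<lambda>k. (F (x + inverse (real (Suc k)) *\<^sub>R e) - F x) /\<^sub>R inverse (real (Suc k))) \<longlonglongrightarrow> D i x"
      by (rule filterlim_compose)
    then show ?thesis by (simp add: f_def add.commute)
  qed
  have fm [measurable]: "f k \<in> borel_measurable lborel" for k
    unfolding f_def by measurable
  have Dm: "D i \<in> borel_measurable lborel" by (rule borel_measurable_LIMSEQ_metric[OF fm lim])
  have ae: "AE x in lborel. (\<lambda>k. f k x) \<longlonglongrightarrow> D i x" using lim by simp
  have dom: "integrable lborel (\<lambda>x. B * indicator (cball (0::R3) (R + 1)) x)"
  proof -
    have "emeasure lborel (cball (0::R3) (R + 1)) < \<infinity>"
      by (rule emeasure_bounded_finite) auto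
    then show ?thesis by simp
  qed
  have bd: "AE x in lborel. norm (f k x) \<le> B * indicator (cball 0 (R + 1)) x" for k
  proof (rule AE_I2)
    fix x :: R3
    let ?t = "inverse (real (Suc k))"
    have t: "0 < ?t" "?t \<le> 1" by (auto simp: field_simps)
    show "norm (f k x) \<le> B * indicator (cball 0 (R + 1)) x"
    proof (cases "norm x \<le> R + 1")
      case True
      have "norm (F (x + ?t *\<^sub>R e) - F (x + 0 *\<^sub>R e)) \<le> B * norm (?t - 0)"
      proof (rule differentiable_bound[of "{0..?t}" "\<lambda>t. F (x + t *\<^sub>R e)" "\<lambda>t s. s *\<^sub>R D i (x + t *\<^sub>R e)"])
        fix t assume "t \<in> {0..?t}"
        show "((\<lambda>t. F (x + t *\<^sub>R e)) has_derivative (\<lambda>s. s *\<^sub>R D i (x + t *\<^sub>R e))) (at t within {0..?t})"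
          using line by (simp add: has_vector_derivative_def)
        show "onorm (\<lambda>s. s *\<^sub>R D i (x + t *\<^sub>R e)) \<le> B"
          using B[of "x + t *\<^sub>R e"] by (intro onorm_le) (simp add: mult.commute[of B] mult_left_mono)
      qed (use t in auto)
      then have "norm (f k x) \<le> real (Suc k) * (B * ?t)"
        using t by (simp add: f_def add.commute mult_left_mono)
      also have "real (Suc k) * (B * ?t) = B"
      proof -
        have "real (Suc k) * ?t = 1" by (rule right_inverse) simp
        then have "B * (real (Suc k) * ?t) = B" by (simp only: mult_1_right)
        then show ?thesis by (simp only: mult.left_commute)
      qed
      finally show ?thesis using True by simp
    next
      case False
      have "norm x \<le> norm (?t *\<^sub>R e + x) + norm (?t *\<^sub>R e)"
        using norm_triangle_ineq4[of "?t *\<^sub>R e + x" "?t *\<^sub>R e"] by simp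
      then have "norm (?t *\<^sub>R e + x) > R" "norm x > R" using False t e by auto
      then show ?thesis using False R by (simp add: f_def)
    qed
  qed
  have "(\<lambda>k. integral\<^sup>L lborel (f k)) \<longlonglongrightarrow> integral\<^sup>L lborel (D i)"
  proof (rule integral_dominated_convergence[where s = f and w = "\<lambda>x. B * indicator (cball (0::R3) (R + 1)) x"])
    show "D i \<in> borel_measurable lborel" by (rule Dm)
    show "f k \<in> borel_measurable lborel" for k by (rule fm)
    show "integrable lborel (\<lambda>x. B * indicator (cball (0::R3) (R + 1)) x)" by (rule dom)
    show "AE x in lborel. (\<lambda>k. f k x) \<longlonglongrightarrow> D i x" by (rule ae)
    show "AE x in lborel. norm (f k x) \<le> B * indicator (cball 0 (R + 1)) x" for k by (rule bd)
  qed
  moreover have "integral\<^sup>L lborel (f k) = 0" for k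
  proof -
    have "integral\<^sup>L lborel (f k) = real (Suc k) *\<^sub>R ((LINT x|lborel. F (e /\<^sub>R real (Suc k) + x)) - integral\<^sup>L lborel F)"
      unfolding f_def
      by (subst Bochner_Integration.integral_scaleR_right) (simp add: Bochner_Integration.integral_diff[OF integral_translation(2)[OF meas int] int])
    then show ?thesis by (simp add: integral_translation(1)[OF meas])
  qed
  ultimately have "(\<lambda>k::nat. 0) \<longlonglongrightarrow> integral\<^sup>L lborel (D i)" by (simp only:)
  then show "integral\<^sup>L lborel (D i) = 0" by (simp add: LIMSEQ_const_iff)
  show "integrable lborel (D i)"
  proof (rule integrable_dominated_convergence[where s = f and w = "\<lambda>x. B * indicator (cball (0::R3) (R + 1)) x"])
    show "D i \<in> borel_measurable lborel" by (rule Dm)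
    show "f k \<in> borel_measurable lborel" for k by (rule fm)
    show "integrable lborel (\<lambda>x. B * indicator (cball (0::R3) (R + 1)) x)" by (rule dom)
    show "AE x in lborel. (\<lambda>k. f k x) \<longlonglongrightarrow> D i x" by (rule ae)
    show "AE x in lborel. norm (f k x) \<le> B * indicator (cball 0 (R + 1)) x" for k by (rule bd)
  qed
qed

lemma pos_part_power_derivative:
  "((\<lambda>t. max 0 t ^ Suc (Suc n)) has_real_derivative real (Suc (Suc n)) * max 0 t ^ Suc n) (at t)"
proof -
  consider "t > 0" | "t < 0" | "t = 0" by linarith
  then show ?thesis
  proof cases
    case 1
    have "((\<lambda>t. t ^ Suc (Suc n)) has_real_derivative real (Suc (Suc n)) * t ^ Suc n) (at t)"
      using DERIV_pow[of "Suc (Suc n)" t] by simp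
    moreover have "\<forall>\<^sub>F s in nhds t. s ^ Suc (Suc n) = max 0 s ^ Suc (Suc n)"
      using 1 eventually_nhds_in_open[of "{0<..}" t] by (auto elim!: eventually_mono)
    ultimately show ?thesis using 1 by (subst (asm) DERIV_cong_ev[OF refl _ refl]) auto
  next
    case 2
    have "((\<lambda>t. 0) has_real_derivative real (Suc (Suc n)) * max 0 t ^ Suc n) (at t)" using 2 by simp
    moreover have "\<forall>\<^sub>F s in nhds t. 0 = max 0 s ^ Suc (Suc n)"
      using 2 eventually_nhds_in_open[of "{..<0}" t] by (auto elim!: eventually_mono)
    ultimately show ?thesis using 2 by (subst (asm) DERIV_cong_ev[OF refl _ refl]) auto
  next
    case 3
    have "((\<lambda>h::real. max 0 h ^ Suc n) \<longlongrightarrow> max 0 0 ^ Suc n) (at 0)" by (intro tendsto_intros)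
    then have "((\<lambda>h::real. max 0 h ^ Suc n) \<longlongrightarrow> 0) (at 0)" by simp
    moreover have "\<forall>\<^sub>F h in at 0. max 0 h ^ Suc n = max 0 (h::real) ^ Suc (Suc n) / h"
      by (auto simp: eventually_at_filter max_def)
    ultimately have "((\<lambda>h::real. max 0 h ^ Suc (Suc n) / h) \<longlongrightarrow> 0) (at 0)" by (rule Lim_transform_eventually)
    then show ?thesis using 3 by (simp add: DERIV_def)
  qed
qed

text \<open>A cutoff which vanishes up to \<open>1\<close> and equals \<open>1\<close> from \<open>2\<close> on. Positive parts are raised to the third power
  so that it is twice continuously differentiable.\<close>

definition ramp :: "real \<Rightarrow> real" where
  "ramp t = 1 - max 0 (1 - max 0 (t - 1) ^ 3) ^ 3"

definition ramp' :: "real \<Rightarrow> real" where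
  "ramp' t = 9 * max 0 (1 - max 0 (t - 1) ^ 3) ^ 2 * max 0 (t - 1) ^ 2"

definition ramp'' :: "real \<Rightarrow> real" where
  "ramp'' t = 18 * max 0 (1 - max 0 (t - 1) ^ 3) ^ 2 * max 0 (t - 1)
    - 54 * max 0 (1 - max 0 (t - 1) ^ 3) * max 0 (t - 1) ^ 4"

lemma ramp_derivative: "(ramp has_real_derivative ramp' t) (at t)"
proof -
  have p: "((\<lambda>t. max 0 t ^ 3) has_real_derivative 3 * max 0 s ^ 2) (at s)" for s :: real
    using pos_part_power_derivative[of 1 s] by (simp add: numeral_3_eq_3 numeral_2_eq_2)
  have lin: "((\<lambda>t. t - 1) has_real_derivative 1) (at t)" by (auto intro!: derivative_eq_intros)
  have q: "((\<lambda>t. max 0 (t - 1) ^ 3) has_real_derivative 3 * max 0 (t - 1) ^ 2) (at t)"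
    using DERIV_chain'[OF lin p] by simp
  have "((\<lambda>t. 1 - max 0 (t - 1) ^ 3) has_real_derivative - (3 * max 0 (t - 1) ^ 2)) (at t)"
    using DERIV_diff[OF DERIV_const q] by simp
  from DERIV_chain'[OF this p]
  have "((\<lambda>t. max 0 (1 - max 0 (t - 1) ^ 3) ^ 3) has_real_derivative - ramp' t) (at t)"
    by (simp add: ramp'_def algebra_simps)
  from DERIV_diff[OF DERIV_const[of 1] this] show ?thesis by (simp add: ramp_def[abs_def])
qed

lemma ramp'_derivative: "(ramp' has_real_derivative ramp'' t) (at t)"
proof -
  have p: "((\<lambda>t. max 0 t ^ 3) has_real_derivative 3 * max 0 s ^ 2) (at s)" for s :: real
    using pos_part_power_derivative[of 1 s] by (simp add: numeral_3_eq_3 numeral_2_eq_2)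
  have p2: "((\<lambda>t. max 0 t ^ 2) has_real_derivative 2 * max 0 s) (at s)" for s :: real
    using pos_part_power_derivative[of 0 s] by (simp add: numeral_2_eq_2)
  have lin: "((\<lambda>t. t - 1) has_real_derivative 1) (at t)" by (auto intro!: derivative_eq_intros)
  have q: "((\<lambda>t. max 0 (t - 1) ^ 3) has_real_derivative 3 * max 0 (t - 1) ^ 2) (at t)"
    using DERIV_chain'[OF lin p] by simp
  have q2: "((\<lambda>t. max 0 (t - 1) ^ 2) has_real_derivative 2 * max 0 (t - 1)) (at t)"
    using DERIV_chain'[OF lin p2] by simp
  have "((\<lambda>t. 1 - max 0 (t - 1) ^ 3) has_real_derivative - (3 * max 0 (t - 1) ^ 2)) (at t)"
    using DERIV_diff[OF DERIV_const q] by simp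
  from DERIV_mult[OF DERIV_cmult[OF DERIV_chain'[OF this p2], of 9] q2]
  show ?thesis
    by (simp add: ramp'_def[abs_def] ramp''_def) (simp add: algebra_simps power2_eq_square power4_eq_xxxx)
qed

lemma ramp_0: "t \<le> 1 \<Longrightarrow> ramp t = 0" "t \<le> 1 \<Longrightarrow> ramp' t = 0" "t \<le> 1 \<Longrightarrow> ramp'' t = 0"
  by (auto simp: ramp_def ramp'_def ramp''_def)

lemma ramp_1:
  assumes "t \<ge> 2" shows "ramp t = 1" "ramp' t = 0" "ramp'' t = 0"
proof -
  have "1 ^ 3 \<le> (t - 1) ^ 3" using assms by (intro power_mono) auto
  then have "max 0 (1 - max 0 (t - 1) ^ 3) = 0" using assms by auto
  then show "ramp t = 1" "ramp' t = 0" "ramp'' t = 0"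
    unfolding ramp_def ramp'_def ramp''_def by (simp_all only:) auto
qed

lemma ramp_bounds: "\<bar>ramp t\<bar> \<le> 1" "\<bar>ramp' t\<bar> \<le> 9" "\<bar>ramp'' t\<bar> \<le> 72"
proof -
  consider "t \<le> 1" | "t \<ge> 2" | "1 < t" "t < 2" by linarith
  then have "\<bar>ramp t\<bar> \<le> 1 \<and> \<bar>ramp' t\<bar> \<le> 9 \<and> \<bar>ramp'' t\<bar> \<le> 72"
  proof cases
    case 3
    define a where "a = t - 1"
    define b where "b = 1 - a ^ 3"
    have a: "0 \<le> a" "a \<le> 1" "0 \<le> b" "b \<le> 1" using 3 by (auto simp: a_def b_def power_le_one)
    have m: "max 0 (t - 1) = a" "max 0 (1 - a ^ 3) = b" using a by (auto simp: a_def b_def)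
    have e: "ramp t = 1 - b ^ 3" "ramp' t = 9 * b ^ 2 * a ^ 2" "ramp'' t = 18 * b ^ 2 * a - 54 * b * a ^ 4"
      unfolding ramp_def ramp'_def ramp''_def m by simp_all
    have pw: "0 \<le> b ^ 3" "b ^ 3 \<le> 1" "0 \<le> b ^ 2 * a ^ 2" "b ^ 2 * a ^ 2 \<le> 1" "0 \<le> b ^ 2 * a" "b ^ 2 * a \<le> 1"
      "0 \<le> b * a ^ 4" "b * a ^ 4 \<le> 1"
      using a by (auto intro!: mult_le_one power_le_one)
    show ?thesis unfolding e abs_le_iff mult.assoc using pw by linarith
  qed (auto simp: ramp_0 ramp_1)
  then show "\<bar>ramp t\<bar> \<le> 1" "\<bar>ramp' t\<bar> \<le> 9" "\<bar>ramp'' t\<bar> \<le> 72" by auto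
qed

lemma sets_Omega [measurable]: "Omega \<in> sets borel" "Omega \<in> sets lebesgue"
  by (auto simp: Omega_def obstacle_def)

lemma open_Omega: "open Omega"
  by (auto simp: Omega_def obstacle_def)

lemma in_Omega: "x \<in> Omega \<longleftrightarrow> norm x > 1"
  by (auto simp: Omega_def obstacle_def)

lemma lebesgue_on_Omega_continuous:
  fixes f :: "R3 \<Rightarrow> 'a::{real_normed_vector, second_countable_topology}"
  assumes "continuous_on (- {0}) f"
  shows "f \<in> borel_measurable (lebesgue_on Omega)" "(\<lambda>x. indicator Omega x *\<^sub>R f x) \<in> borel_measurable lborel"
proof -
  have c: "continuous_on Omega f" using assms by (rule continuous_on_subset) (auto simp: in_Omega)
  show "f \<in> borel_measurable (lebesgue_on Omega)"
    by (rule continuous_imp_measurable_on_sets_lebesgue[OF c sets_Omega(2)])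
  show "(\<lambda>x. indicator Omega x *\<^sub>R f x) \<in> borel_measurable lborel"
    using borel_measurable_continuous_on_indicator[OF sets_Omega(1) c] by simp
qed

lemma integral_Omega:
  fixes f :: "R3 \<Rightarrow> complex"
  assumes "(\<lambda>x. indicator Omega x *\<^sub>R f x) \<in> borel_measurable lborel"
  shows "(LINT x|lebesgue_on Omega. f x) = (LINT x|lborel. indicator Omega x *\<^sub>R f x)"
  using integral_restrict_space[of Omega lebesgue f] integral_completion[OF assms] by simp

lemma shell_bounded:
  fixes f :: "R3 \<Rightarrow> 'a::real_normed_vector"
  assumes "continuous_on (- {0}) f" "\<And>x. norm x \<ge> R \<Longrightarrow> f x = 0"
  obtains B where "B \<ge> 0" "\<And>x. norm x \<ge> 1 \<Longrightarrow> norm (f x) \<le> B"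
proof -
  let ?K = "cball 0 R - ball (0::R3) 1"
  have "compact ?K" by (intro compact_diff) auto
  moreover have "continuous_on ?K f" using assms(1) by (rule continuous_on_subset) auto
  ultimately have "bounded (f ` ?K)" by (intro compact_imp_bounded compact_continuous_image)
  then obtain B where B: "\<And>x. x \<in> ?K \<Longrightarrow> norm (f x) \<le> B" unfolding bounded_iff by blast
  show thesis
  proof (rule that[of "max B 0"])
    show "norm (f x) \<le> max B 0" if "norm x \<ge> 1" for x
      using B[of x] assms(2)[of x] that by (cases "norm x \<le> R") (auto simp: le_max_iff_disj)
  qed auto
qed

lemma lebesgue_on_bounded_integrable:
  fixes f :: "R3 \<Rightarrow> 'a::{banach, second_countable_topology}"
  assumes "f \<in> borel_measurable (lebesgue_on Omega)" "\<And>x. x \<in> Omega \<Longrightarrow> norm (f x) \<le> B"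
    "\<And>x. norm x \<ge> R \<Longrightarrow> f x = 0"
  shows "integrable (lebesgue_on Omega) f"
proof (rule Bochner_Integration.integrable_bound[where f = "\<lambda>x. B * indicator (cball 0 R) x"])
  show "integrable (lebesgue_on Omega) (\<lambda>x. B * indicator (cball (0::R3) R) x)"
  proof -
    have "integrable lebesgue (\<lambda>x. indicator Omega x *\<^sub>R (B * indicator (cball (0::R3) R) x))"
    proof -
      have "integrable lebesgue (\<lambda>x. B * indicator (Omega \<inter> cball (0::R3) R) x)"
      proof -
        have "Omega \<inter> cball 0 R \<in> lmeasurable"
          by (intro bounded_set_imp_lmeasurable bounded_Int sets.Int sets_Omega) auto
        then show ?thesis by (intro integrable_mult_right) (simp add: fmeasurable_def)
      qed
      moreover have "(\<lambda>x. indicator Omega x *\<^sub>R (B * indicator (cball (0::R3) R) x)) = (\<lambda>x. B * indicator (Omega \<inter> cball (0::R3) R) x)"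
        by (auto simp: indicator_def fun_eq_iff)
      ultimately show ?thesis by (simp only:)
    qed
    moreover have "Omega \<inter> space lebesgue \<in> sets lebesgue" by simp
    ultimately show ?thesis by (simp only: integrable_restrict_space)
  qed
  show "AE x in lebesgue_on Omega. norm (f x) \<le> norm (B * indicator (cball 0 R) x)"
  proof (rule AE_I2)
    fix x assume "x \<in> space (lebesgue_on Omega)"
    then show "norm (f x) \<le> norm (B * indicator (cball 0 R) x)"
      using assms(2)[of x] assms(3)[of x] by (cases "norm x \<le> R") auto
  qed
qed (use assms in simp)

lemma compact_support_integrable:
  fixes f :: "R3 \<Rightarrow> 'a::{banach, second_countable_topology}"
  assumes "continuous_on (- {0}) f" "\<And>x. norm x \<ge> R \<Longrightarrow> f x = 0"
  shows "integrable (lebesgue_on Omega) f"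
proof -
  obtain B where "\<And>x. norm x \<ge> 1 \<Longrightarrow> norm (f x) \<le> B" using shell_bounded[OF assms] by blast
  then show ?thesis
    using assms by (intro lebesgue_on_bounded_integrable[where B = B and R = R] lebesgue_on_Omega_continuous) (auto simp: in_Omega)
qed

lemma compact_support_L2:
  assumes "continuous_on (- {0}) f" "\<And>x. norm x \<ge> R \<Longrightarrow> f x = 0"
  shows "f \<in> L2 Omega"
  unfolding L2_def using assms
  by (auto intro!: lebesgue_on_Omega_continuous compact_support_integrable[where R = R] continuous_intros)

lemma C1_on_ramp_norm:
  "C1_on S (\<lambda>x. of_real (ramp (k * (x \<bullet> x - 1)))) (\<lambda>j x. of_real (ramp' (k * (x \<bullet> x - 1)) * (2 * k * x $ j)))"
proof -
  have "((\<lambda>x::R3. ramp (k * (x \<bullet> x - 1))) has_derivative (\<lambda>v. k * (x \<bullet> v + v \<bullet> x) * ramp' (k * (x \<bullet> x - 1)))) (at x)" for x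
  proof -
    have 1: "((\<lambda>x::R3. k * (x \<bullet> x - 1)) has_derivative (\<lambda>v. k * (x \<bullet> v + v \<bullet> x))) (at x)"
      by (auto intro!: derivative_eq_intros)
    have "(ramp has_derivative (\<lambda>h. h * ramp' (k * (x \<bullet> x - 1)))) (at (k * (x \<bullet> x - 1)))"
      by (rule has_derivative_eq_rhs[OF ramp_derivative[unfolded has_field_derivative_def]]) (rule ext, rule mult.commute)
    from has_derivative_compose[OF 1 this] show ?thesis .
  qed
  from has_derivative_of_real[OF this]
  have "((\<lambda>x::R3. complex_of_real (ramp (k * (x \<bullet> x - 1)))) has_derivative (\<lambda>v. of_real (k * (x \<bullet> v + v \<bullet> x) * ramp' (k * (x \<bullet> x - 1))))) (at x)" for x .
  moreover have "complex_of_real (k * (x \<bullet> v + v \<bullet> x) * ramp' (k * (x \<bullet> x - 1)))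
     = (\<Sum>i\<in>UNIV. of_real (v $ i) * of_real (ramp' (k * (x \<bullet> x - 1)) * (2 * k * x $ i)))" for x v :: R3
  proof -
    have "k * (x \<bullet> v + v \<bullet> x) * ramp' (k * (x \<bullet> x - 1)) = (\<Sum>i\<in>UNIV. v $ i * (ramp' (k * (x \<bullet> x - 1)) * (2 * k * x $ i)))"
      by (simp add: inner_vec_def inner_commute[of v x] sum_distrib_left sum_distrib_right algebra_simps)
    then show ?thesis by (metis (no_types, lifting) of_real_mult of_real_sum sum.cong)
  qed
  moreover have "continuous_on S (\<lambda>x::R3. complex_of_real (ramp' (k * (x \<bullet> x - 1)) * (2 * k * x $ j)))" for j
    unfolding ramp'_def by (intro continuous_intros)
  ultimately show ?thesis by (simp add: C1_on_def)
qed

text \<open>A function that vanishes on the unit sphere is Lipschitz along rays, so it grows at most linearly in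
  the distance to the sphere.\<close>

lemma vanishing_flux_bound:
  fixes F :: "R3 \<Rightarrow> complex"
  assumes F: "C1_on (- {0}) F E" and R: "\<And>j x. norm x \<ge> R \<Longrightarrow> E j x = 0" and 0: "\<And>x. norm x = 1 \<Longrightarrow> F x = 0"
  obtains C where "C \<ge> 0" "\<And>x. norm x \<ge> 1 \<Longrightarrow> cmod (F x) \<le> C * (x \<bullet> x - 1)"
proof -
  have "\<exists>B\<ge>0. \<forall>x. norm x \<ge> 1 \<longrightarrow> norm (E j x) \<le> B" for j
    using shell_bounded[OF C1_on_continuous_derivative[OF F] R] by metis
  then obtain B where B: "\<And>j. B j \<ge> 0" "\<And>j x. norm x \<ge> 1 \<Longrightarrow> norm (E j x) \<le> B j" by metis
  define C where "C = (\<Sum>j\<in>UNIV. B j)"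
  have C0: "C \<ge> 0" by (simp add: C_def B sum_nonneg)
  have on: "onorm (\<lambda>v. \<Sum>i\<in>UNIV. of_real (v $ i) * E i x) \<le> C" if "norm x \<ge> 1" for x
  proof (rule onorm_le)
    fix v :: R3
    have "norm (\<Sum>i\<in>UNIV. of_real (v $ i) * E i x) \<le> (\<Sum>i\<in>UNIV. norm v * B i)"
    proof (rule sum_norm_le)
      fix i :: 3
      show "norm (of_real (v $ i) * E i x) \<le> norm v * B i"
        using B(2)[OF that, of i] component_le_norm_cart[of v i] by (simp add: norm_mult mult_mono)
    qed
    also have "(\<Sum>i\<in>UNIV. norm v * B i) = C * norm v" by (simp add: C_def sum_distrib_left mult.commute)
    finally show "norm (\<Sum>i\<in>UNIV. of_real (v $ i) * E i x) \<le> C * norm v" .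
  qed
  have "cmod (F x) \<le> C * (x \<bullet> x - 1)" if x: "norm x \<ge> 1" for x
  proof -
    define y where "y = x /\<^sub>R norm x"
    have "norm x \<noteq> 0" using x by auto
    then have ny: "norm y = 1" by (simp add: y_def)
    have seg: "norm z \<ge> 1" if z: "z \<in> closed_segment y x" for z
    proof -
      obtain t where t: "0 \<le> t" "t \<le> 1" "z = (1 - t) *\<^sub>R y + t *\<^sub>R x" using z by (auto simp: closed_segment_def)
      have "z = ((1 - t) + t * norm x) *\<^sub>R y"
        using \<open>norm x \<noteq> 0\<close> by (simp add: t y_def scaleR_add_left algebra_simps)
      then have "norm z = \<bar>(1 - t) + t * norm x\<bar>" using ny by simp
      moreover have "t * norm x \<ge> t * 1" using t x by (intro mult_left_mono) auto
      ultimately show ?thesis by linarith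
    qed
    have "norm (F x - F y) \<le> C * norm (x - y)"
    proof (rule differentiable_bound[of "closed_segment y x" F "\<lambda>x v. \<Sum>i\<in>UNIV. of_real (v $ i) * E i x"])
      fix z assume z: "z \<in> closed_segment y x"
      then have "z \<noteq> 0" using seg by fastforce
      then show "(F has_derivative (\<lambda>v. \<Sum>i\<in>UNIV. of_real (v $ i) * E i z)) (at z within closed_segment y x)"
        using C1_on_has_derivative[OF F] has_derivative_at_withinI by blast
      show "onorm (\<lambda>v. \<Sum>i\<in>UNIV. of_real (v $ i) * E i z) \<le> C" using on seg z by blast
    qed auto
    moreover have "norm (x - y) = norm x - 1"
    proof -
      have "x - y = (norm x - 1) *\<^sub>R y" using \<open>norm x \<noteq> 0\<close> by (simp add: y_def scaleR_diff_left algebra_simps)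
      then show ?thesis using x ny by simp
    qed
    moreover have "norm x - 1 \<le> x \<bullet> x - 1"
    proof -
      have "norm x * 1 \<le> norm x * norm x" using x by (intro mult_left_mono) auto
      then show ?thesis by (simp add: power2_norm_eq_inner[symmetric] power2_eq_square)
    qed
    ultimately show ?thesis using 0[OF ny] mult_left_mono[OF _ C0, of "norm x - 1" "x \<bullet> x - 1"] by simp
  qed
  with C0 show thesis by (rule that)
qed

text \<open>The field is multiplied by \<open>ramp (k (\<bar>x\<bar>\<^sup>2 - 1))\<close>, which makes it vanish near the obstacle. The gradient of this
  cutoff has size \<open>k\<close> on a shell of thickness about \<open>1/k\<close>; as the flux is \<open>O(1/k)\<close> there,
  the extra term is bounded, and it tends to \<open>0\<close> pointwise.\<close>

lemma divergence_exterior: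
  fixes X :: "3 \<Rightarrow> R3 \<Rightarrow> complex"
  assumes X: "\<And>i. C1_on (- {0}) (X i) (D i)"
    and RX: "\<And>i x. norm x \<ge> R \<Longrightarrow> X i x = 0" and RD: "\<And>i j x. norm x \<ge> R \<Longrightarrow> D i j x = 0"
    and flux: "\<And>x. norm x = 1 \<Longrightarrow> (\<Sum>i\<in>UNIV. of_real (x $ i) * X i x) = 0"
  shows "(LINT x|lebesgue_on Omega. (\<Sum>i\<in>UNIV. D i i x)) = 0"
proof -
  define F where "F x = (\<Sum>i\<in>UNIV. of_real (x $ i) * X i x)" for x
  define dv where "dv x = (\<Sum>i\<in>UNIV. D i i x)" for x
  have CF: "C1_on (- {0}) F (\<lambda>j x. \<Sum>i\<in>UNIV. (if j = i then 1 else 0) * X i x + of_real (x $ i) * D i j x)"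
    unfolding F_def by (intro C1_on_sum C1_on_mult C1_on_coord X)
  obtain C where C: "C \<ge> 0" "\<And>x. norm x \<ge> 1 \<Longrightarrow> cmod (F x) \<le> C * (x \<bullet> x - 1)"
  proof (rule vanishing_flux_bound[OF CF])
    show "(\<Sum>i\<in>UNIV. (if j = i then 1 else 0) * X i x + of_real (x $ i) * D i j x) = 0" if "norm x \<ge> R" for j x
      using RX[OF that] RD[OF that] by simp
    show "F x = 0" if "norm x = 1" for x using flux[OF that] by (simp add: F_def)
  qed blast
  have cdv: "continuous_on (- {0}) dv"
    unfolding dv_def by (intro continuous_intros C1_on_continuous_derivative[OF X])
  have Rdv: "dv x = 0" "F x = 0" if "norm x \<ge> R" for x using RD RX that by (simp_all add: dv_def F_def)
  obtain Bd where Bd: "Bd \<ge> 0" "\<And>x. norm x \<ge> 1 \<Longrightarrow> cmod (dv x) \<le> Bd"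
    using shell_bounded[OF cdv Rdv(1)] by blast
  define \<theta> where "\<theta> k x = ramp (k * (x \<bullet> x - 1))" for k and x :: R3
  define \<theta>' where "\<theta>' k x = ramp' (k * (x \<bullet> x - 1))" for k and x :: R3
  define DY where "DY k i j x = of_real (\<theta>' k x * (2 * k * x $ j)) * X i x + of_real (\<theta> k x) * D i j x"
    for k i j x
  have inner: "norm x \<le> 1 \<longleftrightarrow> x \<bullet> x \<le> 1" "norm x > 1 \<longleftrightarrow> x \<bullet> x > 1" for x :: R3
    by (simp_all add: power2_norm_eq_inner[symmetric] abs_square_le_1 flip: not_le)
  have th0: "\<theta> k x = 0" "\<theta>' k x = 0" if "norm x \<le> 1" "k > 0" for k x
  proof -
    have "k * (x \<bullet> x - 1) \<le> 0" using that inner by (intro mult_nonneg_nonpos) auto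
    then show "\<theta> k x = 0" "\<theta>' k x = 0" by (auto simp: \<theta>_def \<theta>'_def ramp_0)
  qed
  have Y0: "(LINT x|lborel. (\<Sum>i\<in>UNIV. DY k i i x)) = 0" and YI: "integrable lborel (\<lambda>x. \<Sum>i\<in>UNIV. DY k i i x)"
    if k: "k > 0" for k
  proof -
    have "integral\<^sup>L lborel (DY k i i) = 0 \<and> integrable lborel (DY k i i)" for i
    proof -
      have CY: "C1_on (- {0}) (\<lambda>x. of_real (\<theta> k x) * X i x) (DY k i)"
        unfolding DY_def \<theta>_def \<theta>'_def by (intro C1_on_mult C1_on_ramp_norm X)
      have d: "((\<lambda>x. of_real (\<theta> k x) * X i x) has_derivative (\<lambda>v. \<Sum>j\<in>UNIV. of_real (v $ j) * DY k i j x)) (at x)" for x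
      proof (cases "x = 0")
        case True
        have "((\<lambda>x::R3. 0) has_derivative (\<lambda>v. \<Sum>j\<in>UNIV. of_real (v $ j) * DY k i j x)) (at x)"
          using th0[of x k] k True by (simp add: DY_def)
        then show ?thesis
          by (rule has_derivative_transform_within_open[of _ _ _ UNIV "ball 0 1"]) (use True th0 k in auto)
      next
        case False
        then show ?thesis using C1_on_has_derivative[OF CY, of x] by simp
      qed
      obtain B1 where B1: "B1 \<ge> 0" "\<And>x. norm x \<ge> 1 \<Longrightarrow> cmod (of_real (x $ i) * X i x) \<le> B1"
        by (rule shell_bounded[of "\<lambda>x. of_real (x $ i) * X i x" R]) (use RX in \<open>auto intro!: continuous_intros C1_on_continuous[OF X]\<close>)
      obtain B2 where B2: "B2 \<ge> 0" "\<And>x. norm x \<ge> 1 \<Longrightarrow> cmod (D i i x) \<le> B2"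
        by (rule shell_bounded[of "D i i" R]) (use RD in \<open>auto intro!: continuous_intros C1_on_continuous_derivative[OF X]\<close>)
      have bound: "cmod (DY k i i x) \<le> 9 * (2 * k) * B1 + B2" for x
      proof (cases "norm x \<le> 1")
        case True
        then show ?thesis using th0 k B1 B2 by (simp add: DY_def)
      next
        case False
        have "DY k i i x = of_real (\<theta>' k x * (2 * k)) * (of_real (x $ i) * X i x) + of_real (\<theta> k x) * D i i x"
          by (simp add: DY_def)
        also have "cmod \<dots> \<le> \<bar>\<theta>' k x\<bar> * (2 * k) * cmod (of_real (x $ i) * X i x) + \<bar>\<theta> k x\<bar> * cmod (D i i x)"
          by (rule order_trans[OF norm_triangle_ineq]) (use k in \<open>simp add: norm_mult abs_mult\<close>)
        also have "\<dots> \<le> 9 * (2 * k) * B1 + 1 * B2"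
          using False k B1 B2 ramp_bounds
          by (intro add_mono mult_mono) (auto simp: \<theta>_def \<theta>'_def intro!: mult_nonneg_nonneg)
        finally show ?thesis by simp
      qed
      have "of_real (\<theta> k x) * X i x = 0" if "norm x > R" for x using RX[of x i] that by simp
      from integral_partial_derivative[where D = "DY k i", OF d bound this] show ?thesis by blast
    qed
    then show "(LINT x|lborel. (\<Sum>i\<in>UNIV. DY k i i x)) = 0" "integrable lborel (\<lambda>x. \<Sum>i\<in>UNIV. DY k i i x)"
      by (simp_all add: Bochner_Integration.integral_sum)
  qed
  have sumDY: "(\<Sum>i\<in>UNIV. DY k i i x) = of_real (\<theta>' k x * (2 * k)) * F x + of_real (\<theta> k x) * dv x" for k x
    by (simp add: DY_def F_def dv_def sum.distrib sum_distrib_left algebra_simps)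
  have "(\<lambda>n. LINT x|lborel. (\<Sum>i\<in>UNIV. DY (real (Suc n)) i i x)) \<longlonglongrightarrow> (LINT x|lborel. indicator Omega x *\<^sub>R dv x)"
  proof (rule integral_dominated_convergence[where w = "\<lambda>x. (36 * C + Bd) * indicator (cball 0 R) x"])
    show "(\<lambda>x. indicator Omega x *\<^sub>R dv x) \<in> borel_measurable lborel"
      by (rule lebesgue_on_Omega_continuous[OF cdv])
    show "(\<lambda>x. \<Sum>i\<in>UNIV. DY (real (Suc n)) i i x) \<in> borel_measurable lborel" for n
      using YI[of "real (Suc n)"] by (simp add: borel_measurable_integrable)
    have "emeasure lborel (cball (0::R3) R) < \<infinity>"
      by (rule emeasure_bounded_finite) auto
    then show "integrable lborel (\<lambda>x. (36 * C + Bd) * indicator (cball (0::R3) R) x)" by simp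
    show "AE x in lborel. (\<lambda>n. \<Sum>i\<in>UNIV. DY (real (Suc n)) i i x) \<longlonglongrightarrow> indicator Omega x *\<^sub>R dv x"
    proof (rule AE_I2)
      fix x :: R3
      show "(\<lambda>n. \<Sum>i\<in>UNIV. DY (real (Suc n)) i i x) \<longlonglongrightarrow> indicator Omega x *\<^sub>R dv x"
      proof (cases "norm x \<le> 1")
        case True
        then show ?thesis unfolding sumDY using th0 by (simp add: in_Omega)
      next
        case False
        then have "x \<bullet> x - 1 > 0" using inner by (simp add: not_le)
        then obtain N where N: "2 / (x \<bullet> x - 1) < real N" using reals_Archimedean2 by blast
        have "(\<Sum>i\<in>UNIV. DY (real (Suc n)) i i x) = indicator Omega x *\<^sub>R dv x" if "n \<ge> N" for n
        proof -
          have "2 / (x \<bullet> x - 1) \<le> real (Suc n)" using N that by linarith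
          then have "2 \<le> real (Suc n) * (x \<bullet> x - 1)" using \<open>x \<bullet> x - 1 > 0\<close> by (simp only: pos_divide_le_eq)
          then have "\<theta> (real (Suc n)) x = 1" "\<theta>' (real (Suc n)) x = 0"
            by (simp_all only: \<theta>_def \<theta>'_def ramp_1)
          then show ?thesis unfolding sumDY using False by (simp add: in_Omega)
        qed
        then show ?thesis by (intro tendsto_eventually eventually_sequentiallyI)
      qed
    qed
    show "AE x in lborel. norm (\<Sum>i\<in>UNIV. DY (real (Suc n)) i i x) \<le> (36 * C + Bd) * indicator (cball 0 R) x" for n
    proof (rule AE_I2)
      fix x :: R3
      let ?k = "real (Suc n)"
      consider "norm x > R" | "norm x \<le> R" "norm x \<le> 1" | "norm x \<le> R" "norm x > 1" by linarith
      then show "norm (\<Sum>i\<in>UNIV. DY ?k i i x) \<le> (36 * C + Bd) * indicator (cball 0 R) x"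
      proof cases
        case 1
        then show ?thesis unfolding sumDY using Rdv by simp
      next
        case 2
        then show ?thesis unfolding sumDY using th0 C Bd by simp
      next
        case 3
        have a: "\<bar>\<theta>' ?k x\<bar> * (2 * ?k) * cmod (F x) \<le> 36 * C"
        proof (cases "?k * (x \<bullet> x - 1) \<le> 2")
          case True
          have "\<bar>\<theta>' ?k x\<bar> * (2 * ?k) * cmod (F x) \<le> 9 * (2 * ?k) * (C * (x \<bullet> x - 1))"
            using C(2)[of x] 3 ramp_bounds by (intro mult_mono) (auto simp: \<theta>'_def)
          also have "\<dots> = 18 * C * (?k * (x \<bullet> x - 1))" by simp
          also have "\<dots> \<le> 18 * C * 2" using True C by (intro mult_left_mono) auto
          finally show ?thesis by simp
        next
          case False
          then have "\<theta>' ?k x = 0" by (simp only: \<theta>'_def ramp_1)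
          then show ?thesis using C by simp
        qed
        have "norm (\<Sum>i\<in>UNIV. DY ?k i i x) \<le> \<bar>\<theta>' ?k x\<bar> * (2 * ?k) * cmod (F x) + \<bar>\<theta> ?k x\<bar> * cmod (dv x)"
          unfolding sumDY by (rule order_trans[OF norm_triangle_ineq]) (simp only: norm_mult norm_of_real abs_mult)
        also have "\<dots> \<le> 36 * C + 1 * Bd"
          by (rule add_mono[OF a], rule mult_mono) (use Bd 3 ramp_bounds in \<open>auto simp: \<theta>_def\<close>)
        finally show ?thesis using 3 by simp
      qed
    qed
  qed
  then have "(LINT x|lborel. indicator Omega x *\<^sub>R dv x) = 0" using Y0 by (simp add: LIMSEQ_const_iff)
  then show ?thesis
    using integral_Omega[OF lebesgue_on_Omega_continuous(2)[OF cdv]] by (simp add: dv_def)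
qed

section \<open>Classical and weak derivatives\<close>

lemma Cc_infty_smooth: "\<phi> \<in> Cc_infty U \<Longrightarrow> smooth \<phi>"
  by (simp add: Cc_infty_def)

lemma Cc_infty_vanishes: "\<phi> \<in> Cc_infty U \<Longrightarrow> x \<notin> U \<Longrightarrow> \<phi> x = 0"
  using closure_subset[of "{x. \<phi> x \<noteq> 0}"] by (auto simp: Cc_infty_def)

lemma Cc_infty_bounded_support:
  assumes "\<phi> \<in> Cc_infty U" obtains R where "\<And>x. norm x \<ge> R \<Longrightarrow> \<phi> x = 0"
proof -
  have "bounded {x. \<phi> x \<noteq> 0}"
    using assms bounded_subset[OF compact_imp_bounded closure_subset] by (auto simp: Cc_infty_def)
  then obtain R where "\<And>x. \<phi> x \<noteq> 0 \<Longrightarrow> norm x \<le> R" by (auto simp: bounded_iff)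
  then show thesis by (intro that[of "R + 1"]) fastforce
qed

lemma Cc_infty_pderiv_dir:
  assumes "\<phi> \<in> Cc_infty U" shows "pderiv_dir i \<phi> \<in> Cc_infty U"
proof -
  let ?K = "closure {x. \<phi> x \<noteq> 0}"
  have "pderiv_dir i \<phi> x = 0" if x: "x \<notin> ?K" for x
  proof -
    have "((\<lambda>x. 0) has_derivative (\<lambda>v. 0)) (at x)" by simp
    then have "(\<phi> has_derivative (\<lambda>v. 0)) (at x)"
      by (rule has_derivative_transform_within_open[of _ _ _ UNIV "- ?K"]) (use x closure_subset[of "{x. \<phi> x \<noteq> 0}"] in auto)
    then show ?thesis by (simp add: pderiv_dir_def frechet_derivative_at[symmetric])
  qed
  then have sub: "closure {x. pderiv_dir i \<phi> x \<noteq> 0} \<subseteq> ?K" by (intro closure_minimal) auto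
  have K: "compact ?K" "?K \<subseteq> U" "smooth \<phi>" using assms by (auto simp: Cc_infty_def)
  have "compact (?K \<inter> closure {x. pderiv_dir i \<phi> x \<noteq> 0})" by (intro compact_Int_closed K closed_closure)
  moreover have "?K \<inter> closure {x. pderiv_dir i \<phi> x \<noteq> 0} = closure {x. pderiv_dir i \<phi> x \<noteq> 0}" using sub by blast
  ultimately have "compact (closure {x. pderiv_dir i \<phi> x \<noteq> 0})" by simp
  moreover have "closure {x. pderiv_dir i \<phi> x \<noteq> 0} \<subseteq> U" using sub K(2) by (rule subset_trans)
  ultimately show ?thesis unfolding Cc_infty_def using smooth_pderiv_dir[OF K(3), of i] by (intro CollectI conjI)
qed

lemma integrable_smooth_mult:
  assumes "smooth u" "\<phi> \<in> Cc_infty U"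
  shows "integrable (lebesgue_on Omega) (\<lambda>x. u x * \<phi> x)"
proof -
  obtain R where "\<And>x. norm x \<ge> R \<Longrightarrow> \<phi> x = 0" using Cc_infty_bounded_support[OF assms(2)] by blast
  then show ?thesis
    by (intro compact_support_integrable[where R = R] continuous_intros smooth_continuous assms(1) Cc_infty_smooth[OF assms(2)]) auto
qed

lemma Cc_infty_L2:
  assumes "\<phi> \<in> Cc_infty U" shows "\<phi> \<in> L2 Omega"
proof -
  obtain R where "\<And>x. norm x \<ge> R \<Longrightarrow> \<phi> x = 0" using Cc_infty_bounded_support[OF assms] by blast
  then show ?thesis by (rule compact_support_L2[OF smooth_continuous[OF Cc_infty_smooth[OF assms]]])
qed

lemma smooth_has_weak_pderiv:
  assumes u: "smooth u" shows "has_weak_pderiv Omega i u (pderiv_dir i u)"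
  unfolding has_weak_pderiv_def
proof
  fix \<phi> assume \<phi>: "\<phi> \<in> Cc_infty Omega"
  have s: "smooth \<phi>" using Cc_infty_smooth[OF \<phi>] .
  let ?D = "\<lambda>i x. pderiv_dir i u x * \<phi> x + u x * pderiv_dir i \<phi> x"
  have C: "C1_on UNIV (\<lambda>x. u x * \<phi> x) ?D" by (intro C1_on_mult smooth_C1_on u s)
  obtain R1 where R1: "\<And>x. norm x \<ge> R1 \<Longrightarrow> \<phi> x = 0" using Cc_infty_bounded_support[OF \<phi>] by blast
  obtain R2 where R2: "\<And>x. norm x \<ge> R2 \<Longrightarrow> pderiv_dir i \<phi> x = 0"
    using Cc_infty_bounded_support[OF Cc_infty_pderiv_dir[OF \<phi>]] by blast
  have cD: "continuous_on A (?D i)" for A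
    by (intro continuous_intros smooth_continuous smooth_pderiv_dir u s)
  have z: "?D i x = 0" if "x \<notin> Omega" for x
    using Cc_infty_vanishes[OF \<phi> that] Cc_infty_vanishes[OF Cc_infty_pderiv_dir[OF \<phi>] that] by simp
  obtain B where B: "B \<ge> 0" "\<And>x. norm x \<ge> 1 \<Longrightarrow> norm (?D i x) \<le> B"
    by (rule shell_bounded[of "?D i" "max R1 R2", OF cD]) (use R1 R2 in auto)
  have Bx: "norm (?D i x) \<le> B" for x
    using B z[of x] by (cases "x \<in> Omega") (auto simp: in_Omega)
  have "integral\<^sup>L lborel (?D i) = 0"
    by (rule integral_partial_derivative(1)[where D = ?D, OF C1_on_has_derivative[OF C] Bx, of R1]) (use R1 in auto)
  moreover have "(LINT x|lebesgue_on Omega. ?D i x) = (LINT x|lborel. indicator Omega x *\<^sub>R ?D i x)"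
    by (rule integral_Omega, rule lebesgue_on_Omega_continuous(2), rule cD)
  moreover have "indicator Omega x *\<^sub>R ?D i x = ?D i x" for x using z[of x] by (simp add: indicator_def)
  ultimately have "(LINT x|lebesgue_on Omega. ?D i x) = 0" by simp
  moreover have "(LINT x|lebesgue_on Omega. ?D i x) = (LINT x|lebesgue_on Omega. pderiv_dir i u x * \<phi> x) + (LINT x|lebesgue_on Omega. u x * pderiv_dir i \<phi> x)"
    by (intro Bochner_Integration.integral_add integrable_smooth_mult[where U = Omega] smooth_pderiv_dir u \<phi> Cc_infty_pderiv_dir)
  ultimately show "(LINT x|lebesgue_on Omega. u x * pderiv_dir i \<phi> x) = - (LINT x|lebesgue_on Omega. pderiv_dir i u x * \<phi> x)"
    by (simp add: add_eq_0_iff)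
qed

lemma smooth_has_weak_laplacian:
  assumes u: "smooth u" shows "has_weak_laplacian Omega u (laplacian u)"
  unfolding has_weak_laplacian_def
proof
  fix \<phi> assume \<phi>: "\<phi> \<in> Cc_infty Omega"
  have "(LINT x|lebesgue_on Omega. u x * laplacian \<phi> x) = (LINT x|lebesgue_on Omega. (\<Sum>i\<in>UNIV. u x * pderiv_dir i (pderiv_dir i \<phi>) x))"
    by (simp add: laplacian_def sum_distrib_left)
  also have "\<dots> = (\<Sum>i\<in>UNIV. LINT x|lebesgue_on Omega. u x * pderiv_dir i (pderiv_dir i \<phi>) x)"
    by (intro Bochner_Integration.integral_sum integrable_smooth_mult[where U = Omega] u Cc_infty_pderiv_dir \<phi>)
  also have "\<dots> = (\<Sum>i\<in>UNIV. LINT x|lebesgue_on Omega. pderiv_dir i (pderiv_dir i u) x * \<phi> x)"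
  proof (rule sum.cong[OF refl])
    fix i :: 3
    show "(LINT x|lebesgue_on Omega. u x * pderiv_dir i (pderiv_dir i \<phi>) x) = (LINT x|lebesgue_on Omega. pderiv_dir i (pderiv_dir i u) x * \<phi> x)"
      using smooth_has_weak_pderiv[OF u, of i] smooth_has_weak_pderiv[OF smooth_pderiv_dir[OF u, of i], of i]
        \<phi> Cc_infty_pderiv_dir[OF \<phi>, of i] by (simp add: has_weak_pderiv_def)
  qed
  also have "\<dots> = (LINT x|lebesgue_on Omega. (\<Sum>i\<in>UNIV. pderiv_dir i (pderiv_dir i u) x * \<phi> x))"
    by (intro Bochner_Integration.integral_sum[symmetric] integrable_smooth_mult[where U = Omega] smooth_pderiv_dir u \<phi>)
  also have "\<dots> = (LINT x|lebesgue_on Omega. laplacian u x * \<phi> x)"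
    by (simp add: laplacian_def sum_distrib_right)
  finally show "(LINT x|lebesgue_on Omega. u x * laplacian \<phi> x) = (LINT x|lebesgue_on Omega. laplacian u x * \<phi> x)" .
qed

lemma laplacian_Cc_infty_L2:
  assumes "\<phi> \<in> Cc_infty U" shows "laplacian \<phi> \<in> L2 Omega"
proof -
  have "\<exists>R. \<forall>x. norm x \<ge> R \<longrightarrow> pderiv_dir i (pderiv_dir i \<phi>) x = 0" for i
    by (rule Cc_infty_bounded_support[OF Cc_infty_pderiv_dir[OF Cc_infty_pderiv_dir[OF assms]], of i i]) blast
  then obtain R where R: "\<And>i x. norm x \<ge> R i \<Longrightarrow> pderiv_dir i (pderiv_dir i \<phi>) x = 0" by metis
  show ?thesis
  proof (rule compact_support_L2[where R = "Max (range R)"])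
    show "continuous_on (- {0}) (laplacian \<phi>)"
      unfolding laplacian_def[abs_def]
      by (intro continuous_on_sum smooth_continuous smooth_pderiv_dir Cc_infty_smooth[OF assms])
    show "laplacian \<phi> x = 0" if x: "norm x \<ge> Max (range R)" for x
      unfolding laplacian_def
    proof (rule sum.neutral, rule ballI)
      fix i :: 3
      have "R i \<le> Max (range R)" by (intro Max_ge) auto
      then show "pderiv_dir i (pderiv_dir i \<phi>) x = 0" using x by (intro R) linarith
    qed
  qed
qed

section \<open>Smooth bump functions separate square-integrable functions\<close>

text \<open>With \<open>p = 1\<close> this is the standard flat function \<open>exp (- 1/t)\<close>. The polynomial factor makes the
  family closed under differentiation.\<close>

definition flat :: "real poly \<Rightarrow> real \<Rightarrow> real" where
  "flat p t = (if t > 0 then poly p (1 / t) * exp (- (1 / t)) else 0)"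

definition flat_deriv :: "real poly \<Rightarrow> real poly" where
  "flat_deriv p = [:0, 0, 1:] * (p - pderiv p)"

lemma poly_div_exp_tendsto_0: "((\<lambda>x. poly p x * exp (- x)) \<longlongrightarrow> (0::real)) at_top"
proof -
  have "((\<lambda>x. \<Sum>i\<le>degree p. coeff p i * (x ^ i / exp x)) \<longlongrightarrow> (\<Sum>i\<le>degree p. coeff p i * 0)) at_top"
    by (intro tendsto_intros tendsto_power_div_exp_0)
  then show ?thesis by (simp add: poly_altdef sum_distrib_right exp_minus divide_inverse mult.assoc)
qed

lemma flat_derivative: "(flat p has_real_derivative flat (flat_deriv p) t) (at t)"
proof -
  consider "t > 0" | "t < 0" | "t = 0" by linarith
  then show ?thesis
  proof cases
    case 1
    have "((\<lambda>t. poly p (1 / t) * exp (- (1 / t))) has_real_derivative flat (flat_deriv p) t) (at t)"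
      using 1 by (auto intro!: derivative_eq_intros simp: flat_def flat_deriv_def field_simps power2_eq_square)
    moreover have "\<forall>\<^sub>F s in nhds t. poly p (1 / s) * exp (- (1 / s)) = flat p s"
      using 1 eventually_nhds_in_open[of "{0<..}" t] by (auto elim!: eventually_mono simp: flat_def)
    ultimately show ?thesis by (subst (asm) DERIV_cong_ev[OF refl _ refl])
  next
    case 2
    have "((\<lambda>t. 0) has_real_derivative flat (flat_deriv p) t) (at t)" using 2 by (simp add: flat_def)
    moreover have "\<forall>\<^sub>F s in nhds t. 0 = flat p s"
      using 2 eventually_nhds_in_open[of "{..<0}" t] by (auto elim!: eventually_mono simp: flat_def)
    ultimately show ?thesis by (subst (asm) DERIV_cong_ev[OF refl _ refl])
  next
    case 3
    have "((\<lambda>h. poly (pCons 0 p) (inverse h) * exp (- inverse h)) \<longlongrightarrow> 0) (at_right 0)"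
      by (rule filterlim_compose[OF poly_div_exp_tendsto_0 filterlim_inverse_at_top_right])
    moreover have "\<forall>\<^sub>F h in at_right 0. poly (pCons 0 p) (inverse h) * exp (- inverse h) = flat p h / h"
      by (auto simp: eventually_at_filter flat_def divide_inverse)
    ultimately have "((\<lambda>h. flat p h / h) \<longlongrightarrow> 0) (at_right 0)" by (rule Lim_transform_eventually)
    moreover have "((\<lambda>h. flat p h / h) \<longlongrightarrow> 0) (at_left 0)"
      by (rule Lim_transform_eventually[OF tendsto_const]) (auto simp: eventually_at_filter flat_def)
    ultimately have "((\<lambda>h. flat p h / h) \<longlongrightarrow> 0) (at 0)" by (rule filterlim_split_at[rotated])
    moreover have "flat q 0 = 0" for q by (simp add: flat_def)
    ultimately show ?thesis using 3 by (simp add: DERIV_def)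
  qed
qed

text \<open>An algebra of differentiable functions that is closed under partial derivatives consists of
  smooth functions.\<close>

inductive_set bump_algebra :: "(R3 \<Rightarrow> complex) set" where
  flat: "(\<lambda>x. of_real (flat p (\<sigma> * x $ i + c))) \<in> bump_algebra"
| const: "(\<lambda>x. c) \<in> bump_algebra"
| add: "f \<in> bump_algebra \<Longrightarrow> g \<in> bump_algebra \<Longrightarrow> (\<lambda>x. f x + g x) \<in> bump_algebra"
| mult: "f \<in> bump_algebra \<Longrightarrow> g \<in> bump_algebra \<Longrightarrow> (\<lambda>x. f x * g x) \<in> bump_algebra"

lemma bump_algebra_derivative:
  "f \<in> bump_algebra \<Longrightarrow> \<exists>D. (\<forall>i. D i \<in> bump_algebra) \<and>
     (\<forall>x. (f has_derivative (\<lambda>v. \<Sum>i\<in>UNIV. of_real (v $ i) * D i x)) (at x))"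
proof (induction rule: bump_algebra.induct)
  case (flat p \<sigma> k c)
  define D where "D i x = (if i = k then of_real \<sigma> else 0) * complex_of_real (flat (flat_deriv p) (\<sigma> * x $ k + c))" for i and x :: R3
  have "D i \<in> bump_algebra" for i unfolding D_def by (intro bump_algebra.intros)
  moreover have "((\<lambda>x::R3. complex_of_real (flat p (\<sigma> * x $ k + c))) has_derivative (\<lambda>v. \<Sum>i\<in>UNIV. of_real (v $ i) * D i x)) (at x)" for x
  proof -
    have 1: "((\<lambda>x::R3. \<sigma> * x $ k + c) has_derivative (\<lambda>v. \<sigma> * v $ k)) (at x)"
      by (auto intro!: derivative_eq_intros bounded_linear_imp_has_derivative bounded_linear_vec_nth)
    have 2: "(flat p has_derivative (\<lambda>h. flat (flat_deriv p) (\<sigma> * x $ k + c) * h)) (at (\<sigma> * x $ k + c))"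
      using flat_derivative by (simp add: has_field_derivative_def)
    have "((\<lambda>x::R3. complex_of_real (flat p (\<sigma> * x $ k + c))) has_derivative (\<lambda>v. of_real (flat (flat_deriv p) (\<sigma> * x $ k + c) * (\<sigma> * v $ k)))) (at x)"
      by (rule has_derivative_of_real[OF has_derivative_compose[OF 1 2]])
    moreover have "(\<Sum>i\<in>UNIV. complex_of_real (v $ i) * D i x) = of_real (flat (flat_deriv p) (\<sigma> * x $ k + c) * (\<sigma> * v $ k))" for v :: R3
    proof -
      have "(\<Sum>i\<in>UNIV. complex_of_real (v $ i) * D i x) = (\<Sum>i\<in>UNIV. if i = k then of_real (v $ i) * D k x else 0)"
        by (intro sum.cong) (auto simp: D_def)
      then show ?thesis by (simp add: D_def)
    qed
    ultimately show ?thesis by simp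
  qed
  ultimately show ?case by blast
next
  case (const c)
  show ?case by (rule exI[of _ "\<lambda>i x. 0"]) (auto intro: bump_algebra.const)
next
  case (add f g)
  then obtain D E where D: "\<And>i. D i \<in> bump_algebra" "\<And>x. (f has_derivative (\<lambda>v. \<Sum>i\<in>UNIV. of_real (v $ i) * D i x)) (at x)"
    and E: "\<And>i. E i \<in> bump_algebra" "\<And>x. (g has_derivative (\<lambda>v. \<Sum>i\<in>UNIV. of_real (v $ i) * E i x)) (at x)"
    by blast
  have "((\<lambda>x. f x + g x) has_derivative (\<lambda>v. \<Sum>i\<in>UNIV. of_real (v $ i) * (D i x + E i x))) (at x)" for x
    by (rule has_derivative_eq_rhs[OF has_derivative_add[OF D(2) E(2)]]) (simp add: sum.distrib algebra_simps)
  then show ?case using D(1) E(1) by (intro exI[of _ "\<lambda>i x. D i x + E i x"]) (auto intro: bump_algebra.add)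
next
  case (mult f g)
  then obtain D E where D: "\<And>i. D i \<in> bump_algebra" "\<And>x. (f has_derivative (\<lambda>v. \<Sum>i\<in>UNIV. of_real (v $ i) * D i x)) (at x)"
    and E: "\<And>i. E i \<in> bump_algebra" "\<And>x. (g has_derivative (\<lambda>v. \<Sum>i\<in>UNIV. of_real (v $ i) * E i x)) (at x)"
    by blast
  have "((\<lambda>x. f x * g x) has_derivative (\<lambda>v. \<Sum>i\<in>UNIV. of_real (v $ i) * (D i x * g x + f x * E i x))) (at x)" for x
    by (rule has_derivative_eq_rhs[OF has_derivative_mult[OF D(2) E(2)]])
      (simp add: sum_distrib_left sum_distrib_right sum.distrib algebra_simps)
  then show ?case using D(1) E(1) mult
    by (intro exI[of _ "\<lambda>i x. D i x * g x + f x * E i x"]) (auto intro!: bump_algebra.add bump_algebra.mult)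
qed

lemma bump_algebra_pderiv_dir:
  assumes "f \<in> bump_algebra" shows "pderiv_dir i f \<in> bump_algebra" "f differentiable (at x)"
proof -
  obtain D where D: "\<And>i. D i \<in> bump_algebra"
    "\<And>x. (f has_derivative (\<lambda>v. \<Sum>i\<in>UNIV. of_real (v $ i) * D i x)) (at x)"
    using bump_algebra_derivative[OF assms] by blast
  have "pderiv_dir i f x = D i x" for x
  proof -
    have "pderiv_dir i f x = (\<Sum>j\<in>UNIV. of_real (axis i 1 $ j) * D j x)"
      using frechet_derivative_at[OF D(2)] by (simp add: pderiv_dir_def fun_eq_iff)
    also have "\<dots> = (\<Sum>j\<in>UNIV. if j = i then D j x else 0)"
      by (intro sum.cong) (auto simp: axis_def)
    finally show ?thesis by simp
  qed
  then have "pderiv_dir i f = D i" by (rule ext)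
  then show "pderiv_dir i f \<in> bump_algebra" using D(1) by simp
  show "f differentiable (at x)" using D(2) by (auto simp: differentiable_def)
qed

lemma bump_algebra_smooth:
  assumes "f \<in> bump_algebra" shows "smooth f"
proof -
  have "fold pderiv_dir is f \<in> bump_algebra" for "is"
    using assms by (induction "is" arbitrary: f) (auto intro: bump_algebra_pderiv_dir)
  then show ?thesis unfolding smooth_def by (blast intro: bump_algebra_pderiv_dir(2))
qed

lemma bump_algebra_prod:
  "(\<And>k. k \<in> A \<Longrightarrow> f k \<in> bump_algebra) \<Longrightarrow> (\<lambda>x. \<Prod>k\<in>A. f k x) \<in> bump_algebra"
  by (induction A rule: infinite_finite_induct) (auto intro: bump_algebra.intros)

lemma bump_algebra_power: "f \<in> bump_algebra \<Longrightarrow> (\<lambda>x. f x ^ n) \<in> bump_algebra"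
  by (induction n) (auto intro: bump_algebra.intros)

lemma bump_algebra_one_minus: "f \<in> bump_algebra \<Longrightarrow> (\<lambda>x. 1 - f x) \<in> bump_algebra"
  using bump_algebra.add[OF bump_algebra.const[of 1] bump_algebra.mult[OF bump_algebra.const[of "-1"]], of f] by simp

definition box_bump :: "R3 \<Rightarrow> R3 \<Rightarrow> R3 \<Rightarrow> real" where
  "box_bump a b x = (\<Prod>i\<in>UNIV. flat 1 (x $ i - a $ i) * flat 1 (b $ i - x $ i))"

lemma flat_1_bounds: "0 \<le> flat 1 t" "flat 1 t < 1" "flat 1 t > 0 \<longleftrightarrow> t > 0"
  by (auto simp: flat_def)

lemma box_bump_bounds: "0 \<le> box_bump a b x" "box_bump a b x < 1" "box_bump a b x > 0 \<longleftrightarrow> x \<in> box a b"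
proof -
  show "0 \<le> box_bump a b x" unfolding box_bump_def by (intro prod_nonneg ballI mult_nonneg_nonneg flat_1_bounds)
  have 1: "0 \<le> flat 1 (x $ i - a $ i) * flat 1 (b $ i - x $ i)" "flat 1 (x $ i - a $ i) * flat 1 (b $ i - x $ i) < 1" for i
  proof -
    show "0 \<le> flat 1 (x $ i - a $ i) * flat 1 (b $ i - x $ i)" by (intro mult_nonneg_nonneg flat_1_bounds)
    have "flat 1 (x $ i - a $ i) * flat 1 (b $ i - x $ i) \<le> flat 1 (x $ i - a $ i) * 1"
      using flat_1_bounds by (intro mult_left_mono) (auto intro: less_imp_le)
    then show "flat 1 (x $ i - a $ i) * flat 1 (b $ i - x $ i) < 1" using flat_1_bounds(2)[of "x $ i - a $ i"] by linarith
  qed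
  have "box_bump a b x < (\<Prod>i\<in>(UNIV::3 set). 1)" unfolding box_bump_def by (intro prod_mono_strict) (auto simp: 1 less_imp_le)
  then show "box_bump a b x < 1" by simp
  have "box_bump a b x > 0 \<longleftrightarrow> box_bump a b x \<noteq> 0" using \<open>0 \<le> box_bump a b x\<close> by linarith
  also have "\<dots> \<longleftrightarrow> (\<forall>i. flat 1 (x $ i - a $ i) \<noteq> 0 \<and> flat 1 (b $ i - x $ i) \<noteq> 0)"
    by (simp add: box_bump_def)
  also have "\<dots> \<longleftrightarrow> (\<forall>i. flat 1 (x $ i - a $ i) > 0 \<and> flat 1 (b $ i - x $ i) > 0)"
    using flat_1_bounds(1) by (metis less_le)
  also have "\<dots> \<longleftrightarrow> x \<in> box a b" by (auto simp: flat_1_bounds mem_box_cart)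
  finally show "box_bump a b x > 0 \<longleftrightarrow> x \<in> box a b" .
qed

lemma box_bump_in_bump_algebra: "(\<lambda>x. of_real (box_bump a b x)) \<in> bump_algebra"
proof -
  have "(\<lambda>x. \<Prod>i\<in>UNIV. of_real (flat 1 (1 * x $ i + (- a $ i))) * of_real (flat 1 (- 1 * x $ i + b $ i))) \<in> bump_algebra"
    by (intro bump_algebra_prod bump_algebra.mult bump_algebra.flat)
  then show ?thesis by (simp add: box_bump_def)
qed

text \<open>Exhaust \<open>V\<close> by open boxes whose closures lie in \<open>V\<close>, with bumps \<open>\<beta>\<^sub>j\<close> that are positive exactly on the
  \<open>j\<close>-th box and take values in \<open>[0, 1)\<close>. Then \<open>1 - (\<Prod>j<m. 1 - \<beta>\<^sub>j)\<^sup>m\<close> vanishes outside the first \<open>m\<close> boxes and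
  tends to \<open>1\<close> on all of \<open>V\<close>, so no normalisation of the bumps is required.\<close>

lemma Cc_infty_approximates_open:
  assumes "open V"
  obtains \<Psi> :: "nat \<Rightarrow> R3 \<Rightarrow> complex" where "\<And>m. \<Psi> m \<in> Cc_infty V" "\<And>m x. cmod (\<Psi> m x) \<le> 1"
    "\<And>x. (\<lambda>m. \<Psi> m x) \<longlonglongrightarrow> indicator V x"
proof -
  define \<F> where "\<F> = {box a b | a b. cbox a b \<subseteq> V}"
  have "\<exists>X\<in>\<F>. x \<in> X" if "x \<in> V" for x
    by (rule open_contains_cbox[OF assms that]) (auto simp: \<F>_def)
  moreover have "X \<subseteq> V" if "X \<in> \<F>" for X using that box_subset_cbox by (auto simp: \<F>_def)
  ultimately have V: "\<Union>\<F> = V" by blast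
  obtain \<F>' where F': "\<F>' \<subseteq> \<F>" "countable \<F>'" "\<Union>\<F>' = \<Union>\<F>"
    by (rule Lindelof[of \<F>]) (auto simp: \<F>_def)
  have e: "{} \<in> \<F>"
  proof -
    have "cbox 1 (0::R3) = {}" "box 1 (0::R3) = {}"
      by (auto simp: set_eq_iff mem_box_cart)
    then show ?thesis unfolding \<F>_def mem_Collect_eq
      by (intro exI[of _ "1 :: R3"] exI[of _ "0 :: R3"]) simp
  qed
  define B where "B = from_nat_into (insert {} \<F>')"
  have rB: "range B = insert {} \<F>'" unfolding B_def by (rule range_from_nat_into) (simp_all add: F'(2))
  have "\<exists>a b. B j = box a b \<and> cbox a b \<subseteq> V" for j
  proof -
    have "B j \<in> insert {} \<F>'" unfolding rB[symmetric] by (rule rangeI)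
    then have "B j \<in> \<F>" using e subsetD[OF F'(1)] by (elim insertE) simp_all
    then show ?thesis by (auto simp: \<F>_def)
  qed
  then obtain a b where ab: "\<And>j. B j = box (a j) (b j)" "\<And>j. cbox (a j) (b j) \<subseteq> V" by metis
  have UB: "(\<Union>j. B j) = V" unfolding rB V[symmetric] F'(3)[symmetric] by simp
  define \<psi> where "\<psi> m x = (\<Prod>j<m. 1 - box_bump (a j) (b j) x)" for m x
  have \<psi>: "0 \<le> \<psi> m x" "\<psi> m x \<le> 1" for m x
    unfolding \<psi>_def using box_bump_bounds(1,2) by (auto intro!: prod_nonneg prod_le_1 simp: less_imp_le)
  define \<Psi> where "\<Psi> m x = complex_of_real (1 - \<psi> m x ^ m)" for m x
  have \<Psi>0: "\<Psi> m x = 0" if "x \<notin> (\<Union>j<m. B j)" for m x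
  proof -
    have "box_bump (a j) (b j) x = 0" if "j < m" for j
    proof -
      have "x \<notin> box (a j) (b j)" using \<open>x \<notin> (\<Union>j<m. B j)\<close> that ab by auto
      then show ?thesis using box_bump_bounds(1,3)[of "a j" "b j" x] by linarith
    qed
    then show ?thesis by (simp add: \<Psi>_def \<psi>_def)
  qed
  show thesis
  proof (rule that)
    show "\<Psi> m \<in> Cc_infty V" for m
    proof -
      have "(\<lambda>x. 1 - (\<Prod>j<m. 1 - of_real (box_bump (a j) (b j) x)) ^ m) \<in> bump_algebra"
        by (intro bump_algebra_one_minus bump_algebra_power bump_algebra_prod box_bump_in_bump_algebra)
      then have s: "smooth (\<Psi> m)" by (intro bump_algebra_smooth) (simp add: \<Psi>_def[abs_def] \<psi>_def)
      let ?K = "\<Union>j<m. cbox (a j) (b j)"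
      have K: "compact ?K" by (intro compact_UN) auto
      have "x \<in> ?K" if "\<Psi> m x \<noteq> 0" for x
      proof -
        have "x \<in> (\<Union>j<m. B j)" using \<Psi>0[of x m] that by blast
        then show ?thesis unfolding ab(1) using box_subset_cbox by blast
      qed
      then have "{x. \<Psi> m x \<noteq> 0} \<subseteq> ?K" by blast
      then have sub: "closure {x. \<Psi> m x \<noteq> 0} \<subseteq> ?K" using K by (intro closure_minimal compact_imp_closed)
      have "compact (?K \<inter> closure {x. \<Psi> m x \<noteq> 0})" by (intro compact_Int_closed K closed_closure)
      moreover have "?K \<inter> closure {x. \<Psi> m x \<noteq> 0} = closure {x. \<Psi> m x \<noteq> 0}" using sub by blast
      ultimately have "compact (closure {x. \<Psi> m x \<noteq> 0})" by simp
      moreover have "closure {x. \<Psi> m x \<noteq> 0} \<subseteq> V" using sub ab(2) by blast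
      ultimately show ?thesis unfolding Cc_infty_def using s by (intro CollectI conjI)
    qed
    show "cmod (\<Psi> m x) \<le> 1" for m x
    proof -
      have "0 \<le> \<psi> m x ^ m" "\<psi> m x ^ m \<le> 1" using \<psi> by (auto intro: power_le_one)
      then have "\<bar>1 - \<psi> m x ^ m\<bar> \<le> 1" by linarith
      then show ?thesis unfolding \<Psi>_def by (simp only: norm_of_real)
    qed
    show "(\<lambda>m. \<Psi> m x) \<longlonglongrightarrow> indicator V x" for x
    proof (cases "x \<in> V")
      case False
      then have "\<Psi> m x = 0" for m using \<Psi>0 UB by blast
      then show ?thesis using False by simp
    next
      case True
      then obtain j where j: "x \<in> B j" using UB by blast
      define q where "q = 1 - box_bump (a j) (b j) x"
      have q: "0 \<le> q" "q < 1" using box_bump_bounds[of "a j" "b j" x] j ab(1) by (auto simp: q_def)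
      have le: "\<psi> m x \<le> q" if "m > j" for m
      proof -
        have "\<psi> m x = q * (\<Prod>k\<in>{..<m} - {j}. 1 - box_bump (a k) (b k) x)"
          unfolding \<psi>_def q_def using that by (intro prod.remove) auto
        also have "\<dots> \<le> q * 1"
          using q box_bump_bounds(1,2) by (intro mult_left_mono prod_le_1) (auto simp: less_imp_le)
        finally show ?thesis by simp
      qed
      have "(\<lambda>m. \<psi> m x ^ m) \<longlonglongrightarrow> 0"
      proof (rule tendsto_sandwich[of "\<lambda>_. 0"])
        show "\<forall>\<^sub>F m in sequentially. \<psi> m x ^ m \<le> q ^ m"
          using le \<psi>(1) by (intro eventually_sequentiallyI[of "Suc j"] power_mono) auto
        show "(\<lambda>m. q ^ m) \<longlonglongrightarrow> 0" using q by (intro LIMSEQ_power_zero) auto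
      qed (use \<psi> in auto)
      then have "(\<lambda>m. 1 - \<psi> m x ^ m) \<longlonglongrightarrow> 1 - 0" by (intro tendsto_intros)
      then have "(\<lambda>m. complex_of_real (1 - \<psi> m x ^ m)) \<longlonglongrightarrow> of_real (1 - 0)" by (rule tendsto_of_real)
      then show ?thesis using True by (simp add: \<Psi>_def)
    qed
  qed
qed

lemma sigma_finite_lebesgue: "sigma_finite_measure (lebesgue :: R3 measure)"
proof
  let ?A = "range (\<lambda>n::nat. ball (0::R3) (real n))"
  have "\<Union>?A = UNIV"
    using reals_Archimedean2 by (auto simp: set_eq_iff)
  moreover have "emeasure lebesgue (ball (0::R3) (real n)) \<noteq> \<infinity>" for n
    using emeasure_bounded_finite[of "ball (0::R3) (real n)"] by simp
  ultimately show "\<exists>A::R3 set set. countable A \<and> A \<subseteq> sets lebesgue \<and> \<Union> A = space lebesgue \<and> (\<forall>a\<in>A. emeasure lebesgue a \<noteq> \<infinity>)"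
    by (intro exI[of _ ?A]) auto
qed

lemma indicator_ball_measurable: "(indicator (ball 0 r) :: R3 \<Rightarrow> real) \<in> borel_measurable (lebesgue_on Omega)"
  by (intro measurable_restrict_space1 borel_measurable_indicator) auto

lemma L2_integrable_ball:
  assumes w: "w \<in> L2 Omega"
  shows "integrable lebesgue (\<lambda>x. indicator (Omega \<inter> ball 0 r) x *\<^sub>R w x)"
proof -
  have wm: "w \<in> borel_measurable (lebesgue_on Omega)" and wi: "integrable (lebesgue_on Omega) (\<lambda>x. (cmod (w x))\<^sup>2)"
    using w by (auto simp: L2_def)
  have "integrable (lebesgue_on Omega) (\<lambda>x. indicator (ball 0 r) x *\<^sub>R w x)"
  proof (rule Bochner_Integration.integrable_bound)
    show "(\<lambda>x. indicator (ball 0 r) x *\<^sub>R w x) \<in> borel_measurable (lebesgue_on Omega)"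
      by (intro borel_measurable_scaleR indicator_ball_measurable wm)
    show "integrable (lebesgue_on Omega) (\<lambda>x. (cmod (w x))\<^sup>2 + indicator (ball 0 r) x)"
      by (intro Bochner_Integration.integrable_add wi
          lebesgue_on_bounded_integrable[OF indicator_ball_measurable, where B = 1 and R = r]) auto
    show "AE x in lebesgue_on Omega. norm (indicator (ball 0 r) x *\<^sub>R w x) \<le> norm ((cmod (w x))\<^sup>2 + indicator (ball 0 r) x)"
    proof (rule AE_I2)
      fix x
      have "0 \<le> (cmod (w x) - 1)\<^sup>2" by simp
      then have "2 * cmod (w x) \<le> (cmod (w x))\<^sup>2 + 1" by (simp add: power2_diff)
      then have "cmod (w x) \<le> (cmod (w x))\<^sup>2 + 1" using norm_ge_zero[of "w x"] by linarith
      then show "norm (indicator (ball 0 r) x *\<^sub>R w x) \<le> norm ((cmod (w x))\<^sup>2 + indicator (ball 0 r) x)"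
        by (auto simp: indicator_def)
    qed
  qed
  moreover have "Omega \<inter> space lebesgue \<in> sets lebesgue" by simp
  ultimately have "integrable lebesgue (\<lambda>x. indicator Omega x *\<^sub>R (indicator (ball 0 r) x *\<^sub>R w x))"
    by (simp only: integrable_restrict_space)
  then show ?thesis by (simp only: indicator_inter_arith scaleR_scaleR)
qed

text \<open>The integral of \<open>w\<close> over bounded open sets vanishes by the approximation above. Open sets are stable
  under intersection and generate the Borel sets, so it vanishes over all measurable sets.\<close>

lemma L2_zero_if_orthogonal_to_Cc_infty:
  assumes w: "w \<in> L2 Omega" and orth: "\<And>\<phi>. \<phi> \<in> Cc_infty Omega \<Longrightarrow> (LINT x|lebesgue_on Omega. w x * \<phi> x) = 0"
  shows "AE x in lebesgue_on Omega. w x = 0"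
proof -
  have "AE x in lebesgue. indicator (Omega \<inter> ball 0 r) x *\<^sub>R w x = 0" for r
  proof (rule sigma_finite_measure.density_zero[OF sigma_finite_lebesgue])
    let ?g = "\<lambda>x. indicator (Omega \<inter> ball 0 r) x *\<^sub>R w x"
    show int: "integrable lebesgue ?g" by (rule L2_integrable_ball[OF w])
    have opn: "(LINT x:V|lebesgue. ?g x) = 0" if V: "open V" for V
    proof -
      have "open (V \<inter> (Omega \<inter> ball 0 r))" using V open_Omega by auto
      then obtain \<Psi> where \<Psi>: "\<And>m. \<Psi> m \<in> Cc_infty (V \<inter> (Omega \<inter> ball 0 r))" "\<And>m x. cmod (\<Psi> m x) \<le> 1"
        "\<And>x. (\<lambda>m. \<Psi> m x) \<longlonglongrightarrow> indicator (V \<inter> (Omega \<inter> ball 0 r)) x"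
        using Cc_infty_approximates_open by blast
      have gm: "?g \<in> borel_measurable lebesgue" using int by (rule borel_measurable_integrable)
      have \<Psi>m: "\<Psi> m \<in> borel_measurable lebesgue" for m
        using smooth_continuous[OF Cc_infty_smooth[OF \<Psi>(1)], of UNIV m]
        by (intro measurable_completion) (simp add: borel_measurable_continuous_onI)
      have "(\<lambda>m. LINT x|lebesgue. ?g x * \<Psi> m x) \<longlonglongrightarrow> (LINT x|lebesgue. indicator V x *\<^sub>R ?g x)"
      proof (rule integral_dominated_convergence[where w = "\<lambda>x. cmod (?g x)"])
        show "(\<lambda>x. indicator V x *\<^sub>R ?g x) \<in> borel_measurable lebesgue"
          using V by (intro borel_measurable_scaleR borel_measurable_indicator gm) auto
        show "(\<lambda>x. ?g x * \<Psi> m x) \<in> borel_measurable lebesgue" for m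
          by (intro borel_measurable_times gm \<Psi>m)
        show "integrable lebesgue (\<lambda>x. cmod (?g x))" using int by (rule integrable_norm)
        show "AE x in lebesgue. (\<lambda>m. ?g x * \<Psi> m x) \<longlonglongrightarrow> indicator V x *\<^sub>R ?g x"
        proof (rule AE_I2)
          fix x :: R3
          have "(\<lambda>m. ?g x * \<Psi> m x) \<longlonglongrightarrow> ?g x * indicator (V \<inter> (Omega \<inter> ball 0 r)) x"
            by (intro tendsto_intros \<Psi>)
          moreover have "?g x * indicator (V \<inter> (Omega \<inter> ball 0 r)) x = indicator V x *\<^sub>R ?g x"
            by (auto simp: indicator_def)
          ultimately show "(\<lambda>m. ?g x * \<Psi> m x) \<longlonglongrightarrow> indicator V x *\<^sub>R ?g x" by (simp only:)
        qed
        show "AE x in lebesgue. norm (?g x * \<Psi> m x) \<le> cmod (?g x)" for m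
          using mult_left_le[OF \<Psi>(2) norm_ge_zero] by (intro AE_I2) (simp only: norm_mult)
      qed
      moreover have "(LINT x|lebesgue. ?g x * \<Psi> m x) = 0" for m
      proof -
        have "\<Psi> m \<in> Cc_infty Omega" using \<Psi>(1)[of m] by (auto simp: Cc_infty_def)
        from orth[OF this] have "(LINT x|lebesgue. indicator Omega x *\<^sub>R (w x * \<Psi> m x)) = 0"
          by (simp add: integral_restrict_space)
        moreover have "indicator Omega x *\<^sub>R (w x * \<Psi> m x) = ?g x * \<Psi> m x" for x
          using Cc_infty_vanishes[OF \<Psi>(1), of x m] by (auto simp: indicator_def)
        ultimately show ?thesis by simp
      qed
      ultimately show ?thesis by (simp add: LIMSEQ_const_iff set_lebesgue_integral_def)
    qed
    have setint: "set_integrable lebesgue A ?g" if "A \<in> sets lebesgue" for A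
      unfolding set_integrable_def by (rule integrable_mult_indicator[OF that int])
    have bor: "(LINT x:A|lebesgue. ?g x) = 0" if "A \<in> sets borel" for A
    proof -
      have "Int_stable {S :: R3 set. open S}" by (auto simp: Int_stable_def)
      moreover have "{S :: R3 set. open S} \<subseteq> Pow UNIV" by simp
      moreover have "A \<in> sigma_sets UNIV {S. open S}" using that by (simp add: sets_borel)
      ultimately show ?thesis
      proof (induction rule: sigma_sets_induct_disjoint)
        case (basic A)
        then show ?case using opn by simp
      next
        case empty
        show ?case by (simp add: set_lebesgue_integral_def)
      next
        case (compl A)
        have A: "A \<in> sets lebesgue" using compl(1) by (simp flip: sets_borel)
        have "(LINT x:UNIV|lebesgue. ?g x) = (LINT x:A|lebesgue. ?g x) + (LINT x:(UNIV - A)|lebesgue. ?g x)"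
          using setint[OF A] setint[OF sets.compl_sets[OF A]] by (subst set_integral_Un[symmetric]) auto
        then show ?case using compl opn[of UNIV] by simp
      next
        case (union A)
        have A: "A i \<in> sets lebesgue" for i using union(2) by (auto simp flip: sets_borel)
        have "(LINT x:(\<Union>i. A i)|lebesgue. ?g x) = (\<Sum>i. (LINT x:(A i)|lebesgue. ?g x))"
        proof (rule lebesgue_integral_countable_add)
          show "A i \<inter> A j = {}" if "i \<noteq> j" for i j using union(1) that by (auto simp: disjoint_family_on_def)
          show "set_integrable lebesgue (\<Union>i. A i) ?g" using A by (intro setint) auto
        qed (rule A)
        then show ?case using union by simp
      qed
    qed
    show "(LINT x:A|lebesgue. ?g x) = 0" if A: "A \<in> sets lebesgue" for A
    proof -
      obtain S N N' where S: "A = S \<union> N" "N \<subseteq> N'" "N' \<in> null_sets lborel" "S \<in> sets lborel"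
        using sets_completionE[OF A] by blast
      have N': "AE x in lebesgue. x \<notin> N'" using S(3) by (intro AE_not_in null_sets_completionI)
      have gm: "?g \<in> borel_measurable lebesgue" using int by (rule borel_measurable_integrable)
      have S': "S \<in> sets lebesgue" using S(4) by simp
      have "(LINT x:A|lebesgue. ?g x) = (LINT x:S|lebesgue. ?g x)"
        unfolding set_lebesgue_integral_def
      proof (rule integral_cong_AE)
        show "AE x in lebesgue. indicator A x *\<^sub>R ?g x = indicator S x *\<^sub>R ?g x"
          using N' S(1,2) by (auto simp: indicator_def elim!: eventually_mono)
      qed (intro borel_measurable_scaleR borel_measurable_indicator gm A S')+
      then show ?thesis using bor[of S] S(4) by simp
    qed
  qed
  then have "AE x in lebesgue. \<forall>r::nat. indicator (Omega \<inter> ball 0 (real r)) x *\<^sub>R w x = 0"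
    unfolding AE_all_countable by blast
  then have "AE x in lebesgue. x \<in> Omega \<longrightarrow> w x = 0"
  proof (rule eventually_mono)
    fix x assume *: "\<forall>r::nat. indicator (Omega \<inter> ball 0 (real r)) x *\<^sub>R w x = 0"
    obtain r :: nat where "norm x < real r" using reals_Archimedean2 by blast
    then show "x \<in> Omega \<longrightarrow> w x = 0" using *[rule_format, of r] by auto
  qed
  then show ?thesis by (simp add: AE_restrict_space_iff)
qed

section \<open>Eigenstates are orthogonal to the range of the adjoint problem\<close>

lemma L2_measurable: "u \<in> L2 Omega \<Longrightarrow> u \<in> borel_measurable (lebesgue_on Omega)"
  by (simp add: L2_def)

lemma L2_square_integrable: "u \<in> L2 Omega \<Longrightarrow> integrable (lebesgue_on Omega) (\<lambda>x. (cmod (u x))\<^sup>2)"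
  by (simp add: L2_def)

lemma L2_cmult: "u \<in> L2 Omega \<Longrightarrow> (\<lambda>x. c * u x) \<in> L2 Omega"
  by (auto simp: L2_def norm_mult power_mult_distrib)

lemma L2_add:
  assumes "u \<in> L2 Omega" "v \<in> L2 Omega" shows "(\<lambda>x. u x + v x) \<in> L2 Omega"
proof -
  have m: "(\<lambda>x. u x + v x) \<in> borel_measurable (lebesgue_on Omega)"
    using assms by (intro borel_measurable_add L2_measurable)
  have "integrable (lebesgue_on Omega) (\<lambda>x. (cmod (u x + v x))\<^sup>2)"
  proof (rule Bochner_Integration.integrable_bound)
    show "integrable (lebesgue_on Omega) (\<lambda>x. 2 * (cmod (u x))\<^sup>2 + 2 * (cmod (v x))\<^sup>2)"
      using assms by (intro Bochner_Integration.integrable_add integrable_mult_right L2_square_integrable)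
    show "(\<lambda>x. (cmod (u x + v x))\<^sup>2) \<in> borel_measurable (lebesgue_on Omega)"
      using m by simp
    show "AE x in lebesgue_on Omega. norm ((cmod (u x + v x))\<^sup>2) \<le> norm (2 * (cmod (u x))\<^sup>2 + 2 * (cmod (v x))\<^sup>2)"
    proof (rule AE_I2)
      fix x
      have "(cmod (u x + v x))\<^sup>2 \<le> (cmod (u x) + cmod (v x))\<^sup>2"
        by (intro power_mono norm_triangle_ineq) auto
      also have "\<dots> \<le> 2 * (cmod (u x))\<^sup>2 + 2 * (cmod (v x))\<^sup>2"
        using zero_le_power2[of "cmod (u x) - cmod (v x)"] by (simp add: power2_sum power2_diff)
      finally show "norm ((cmod (u x + v x))\<^sup>2) \<le> norm (2 * (cmod (u x))\<^sup>2 + 2 * (cmod (v x))\<^sup>2)" by simp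
    qed
  qed
  with m show ?thesis by (simp add: L2_def)
qed

lemma L2_diff: "u \<in> L2 Omega \<Longrightarrow> v \<in> L2 Omega \<Longrightarrow> (\<lambda>x. u x - v x) \<in> L2 Omega"
  using L2_add[of u "\<lambda>x. - 1 * v x"] L2_cmult[of v "-1"] by simp

lemma L2_mult_integrable:
  assumes "u \<in> L2 Omega" "v \<in> L2 Omega" shows "integrable (lebesgue_on Omega) (\<lambda>x. u x * v x)"
proof (rule Bochner_Integration.integrable_bound)
  show "integrable (lebesgue_on Omega) (\<lambda>x. (cmod (u x))\<^sup>2 + (cmod (v x))\<^sup>2)"
    using assms by (intro Bochner_Integration.integrable_add L2_square_integrable)
  show "(\<lambda>x. u x * v x) \<in> borel_measurable (lebesgue_on Omega)"
    using assms by (intro borel_measurable_times L2_measurable)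
  show "AE x in lebesgue_on Omega. norm (u x * v x) \<le> norm ((cmod (u x))\<^sup>2 + (cmod (v x))\<^sup>2)"
  proof (rule AE_I2)
    fix x
    have "0 \<le> (cmod (u x) - cmod (v x))\<^sup>2" by simp
    then have "2 * (cmod (u x) * cmod (v x)) \<le> (cmod (u x))\<^sup>2 + (cmod (v x))\<^sup>2" by (simp add: power2_diff)
    moreover have "0 \<le> cmod (u x) * cmod (v x)" by simp
    ultimately have "norm (u x * v x) \<le> (cmod (u x))\<^sup>2 + (cmod (v x))\<^sup>2"
      unfolding norm_mult by linarith
    then show "norm (u x * v x) \<le> norm ((cmod (u x))\<^sup>2 + (cmod (v x))\<^sup>2)" by simp
  qed
qed

lemma L2_norm_power2: "(L2_norm Omega u)\<^sup>2 = (LINT x|lebesgue_on Omega. (cmod (u x))\<^sup>2)"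
  by (simp add: L2_norm_def)

lemma L2_norm_nonneg: "L2_norm Omega u \<ge> 0"
  by (simp add: L2_norm_def)

text \<open>The arithmetic-geometric form of the Cauchy-Schwarz inequality, weighted by \<open>\<epsilon>\<close>.\<close>

lemma integral_mult_small:
  assumes u: "u \<in> L2 Omega" and v: "v \<in> L2 Omega" and \<epsilon>: "L2_norm Omega u \<le> \<epsilon>" "\<epsilon> > 0"
  shows "cmod (LINT x|lebesgue_on Omega. u x * v x) \<le> \<epsilon> * (1 + (L2_norm Omega v)\<^sup>2)"
proof -
  have "cmod (LINT x|lebesgue_on Omega. u x * v x) \<le> (LINT x|lebesgue_on Omega. cmod (u x * v x))"
    by (rule integral_norm_bound)
  also have "\<dots> \<le> (LINT x|lebesgue_on Omega. (cmod (u x))\<^sup>2 / \<epsilon> + \<epsilon> * (cmod (v x))\<^sup>2)"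
  proof (rule integral_mono)
    show "integrable (lebesgue_on Omega) (\<lambda>x. cmod (u x * v x))" by (intro integrable_norm L2_mult_integrable u v)
    show "integrable (lebesgue_on Omega) (\<lambda>x. (cmod (u x))\<^sup>2 / \<epsilon> + \<epsilon> * (cmod (v x))\<^sup>2)"
      by (intro Bochner_Integration.integrable_add integrable_divide integrable_mult_right L2_square_integrable u v)
    fix x
    have "0 \<le> (cmod (u x) - \<epsilon> * cmod (v x))\<^sup>2 / \<epsilon>" using \<epsilon> by simp
    also have "\<dots> = (cmod (u x))\<^sup>2 / \<epsilon> + \<epsilon> * (cmod (v x))\<^sup>2 - 2 * (cmod (u x) * cmod (v x))"
      using \<epsilon> by (simp add: power2_diff field_simps power2_eq_square)
    finally have "2 * (cmod (u x) * cmod (v x)) \<le> (cmod (u x))\<^sup>2 / \<epsilon> + \<epsilon> * (cmod (v x))\<^sup>2" by simp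
    moreover have "0 \<le> cmod (u x) * cmod (v x)" by simp
    ultimately show "cmod (u x * v x) \<le> (cmod (u x))\<^sup>2 / \<epsilon> + \<epsilon> * (cmod (v x))\<^sup>2"
      unfolding norm_mult by linarith
  qed
  also have "\<dots> = (L2_norm Omega u)\<^sup>2 / \<epsilon> + \<epsilon> * (L2_norm Omega v)\<^sup>2"
    unfolding L2_norm_power2
    by (subst Bochner_Integration.integral_add) (use u v in \<open>auto intro!: integrable_divide integrable_mult_right L2_square_integrable\<close>)
  also have "(L2_norm Omega u)\<^sup>2 / \<epsilon> \<le> \<epsilon>\<^sup>2 / \<epsilon>"
    using \<epsilon> by (intro divide_right_mono power_mono L2_norm_nonneg) auto
  also have "\<epsilon>\<^sup>2 / \<epsilon> + \<epsilon> * (L2_norm Omega v)\<^sup>2 = \<epsilon> * (1 + (L2_norm Omega v)\<^sup>2)"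
    using \<epsilon> by (simp add: power2_eq_square algebra_simps)
  finally show ?thesis by simp
qed

lemma has_weak_pderiv_lincomb:
  assumes "u \<in> L2 Omega" "w \<in> L2 Omega" "v \<in> L2 Omega" "z \<in> L2 Omega"
    and "has_weak_pderiv Omega i u w" "has_weak_pderiv Omega i v z"
  shows "has_weak_pderiv Omega i (\<lambda>x. u x + c * v x) (\<lambda>x. w x + c * z x)"
  unfolding has_weak_pderiv_def
proof
  fix \<phi> assume \<phi>: "\<phi> \<in> Cc_infty Omega"
  have i: "integrable (lebesgue_on Omega) (\<lambda>x. y x * \<phi> x)" "integrable (lebesgue_on Omega) (\<lambda>x. y x * pderiv_dir i \<phi> x)"
    if "y \<in> L2 Omega" for y
    using that \<phi> by (auto intro!: L2_mult_integrable Cc_infty_L2 Cc_infty_pderiv_dir)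
  have "(LINT x|lebesgue_on Omega. (u x + c * v x) * pderiv_dir i \<phi> x)
      = (LINT x|lebesgue_on Omega. u x * pderiv_dir i \<phi> x) + c * (LINT x|lebesgue_on Omega. v x * pderiv_dir i \<phi> x)"
    using assms i by (simp add: distrib_right mult.assoc)
  also have "\<dots> = - ((LINT x|lebesgue_on Omega. w x * \<phi> x) + c * (LINT x|lebesgue_on Omega. z x * \<phi> x))"
    using assms(5,6) \<phi> by (simp add: has_weak_pderiv_def)
  also have "\<dots> = - (LINT x|lebesgue_on Omega. (w x + c * z x) * \<phi> x)"
    using assms i by (simp add: distrib_right mult.assoc)
  finally show "(LINT x|lebesgue_on Omega. (u x + c * v x) * pderiv_dir i \<phi> x) = - (LINT x|lebesgue_on Omega. (w x + c * z x) * \<phi> x)" .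
qed

lemma has_weak_laplacian_lincomb:
  assumes "u \<in> L2 Omega" "w \<in> L2 Omega" "v \<in> L2 Omega" "z \<in> L2 Omega"
    and "has_weak_laplacian Omega u w" "has_weak_laplacian Omega v z"
  shows "has_weak_laplacian Omega (\<lambda>x. u x + c * v x) (\<lambda>x. w x + c * z x)"
  unfolding has_weak_laplacian_def
proof
  fix \<phi> assume \<phi>: "\<phi> \<in> Cc_infty Omega"
  have i: "integrable (lebesgue_on Omega) (\<lambda>x. y x * \<phi> x)" "integrable (lebesgue_on Omega) (\<lambda>x. y x * laplacian \<phi> x)"
    if "y \<in> L2 Omega" for y
    using that \<phi> by (auto intro!: L2_mult_integrable Cc_infty_L2 laplacian_Cc_infty_L2)
  have "(LINT x|lebesgue_on Omega. (u x + c * v x) * laplacian \<phi> x)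
      = (LINT x|lebesgue_on Omega. u x * laplacian \<phi> x) + c * (LINT x|lebesgue_on Omega. v x * laplacian \<phi> x)"
    using assms i by (simp add: distrib_right mult.assoc)
  also have "\<dots> = (LINT x|lebesgue_on Omega. w x * \<phi> x) + c * (LINT x|lebesgue_on Omega. z x * \<phi> x)"
    using assms(5,6) \<phi> by (simp add: has_weak_laplacian_def)
  also have "\<dots> = (LINT x|lebesgue_on Omega. (w x + c * z x) * \<phi> x)"
    using assms i by (simp add: distrib_right mult.assoc)
  finally show "(LINT x|lebesgue_on Omega. (u x + c * v x) * laplacian \<phi> x) = (LINT x|lebesgue_on Omega. (w x + c * z x) * \<phi> x)" .
qed

text \<open>The operators of the domain pick weak derivatives by choice. Uniqueness is what links the chosen
  ones to the classical derivatives of core states.\<close>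

lemma weak_derivative_unique:
  assumes "w \<in> L2 Omega" "z \<in> L2 Omega"
    and eq: "\<And>\<phi>. \<phi> \<in> Cc_infty Omega \<Longrightarrow> (LINT x|lebesgue_on Omega. w x * \<phi> x) = (LINT x|lebesgue_on Omega. z x * \<phi> x)"
  shows "AE x in lebesgue_on Omega. w x = z x"
proof -
  have "AE x in lebesgue_on Omega. w x - z x = 0"
  proof (rule L2_zero_if_orthogonal_to_Cc_infty)
    show "(\<lambda>x. w x - z x) \<in> L2 Omega" using assms by (intro L2_diff)
    fix \<phi> assume \<phi>: "\<phi> \<in> Cc_infty Omega"
    then show "(LINT x|lebesgue_on Omega. (w x - z x) * \<phi> x) = 0"
      using eq[OF \<phi>] L2_mult_integrable[OF assms(1) Cc_infty_L2[OF \<phi>]] L2_mult_integrable[OF assms(2) Cc_infty_L2[OF \<phi>]]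
      by (simp add: left_diff_distrib)
  qed
  then show ?thesis by simp
qed

lemma weak_pderiv_unique:
  assumes "w \<in> L2 Omega" "z \<in> L2 Omega" "has_weak_pderiv Omega i u w" "has_weak_pderiv Omega i v z"
    and uv: "AE x in lebesgue_on Omega. u x = v x" and "u \<in> L2 Omega" "v \<in> L2 Omega"
  shows "AE x in lebesgue_on Omega. w x = z x"
proof (rule weak_derivative_unique[OF assms(1,2)])
  fix \<phi> assume \<phi>: "\<phi> \<in> Cc_infty Omega"
  have m: "pderiv_dir i \<phi> \<in> borel_measurable (lebesgue_on Omega)"
    by (rule L2_measurable[OF Cc_infty_L2[OF Cc_infty_pderiv_dir[OF \<phi>]]])
  have "(LINT x|lebesgue_on Omega. u x * pderiv_dir i \<phi> x) = (LINT x|lebesgue_on Omega. v x * pderiv_dir i \<phi> x)"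
  proof (rule integral_cong_AE)
    show "AE x in lebesgue_on Omega. u x * pderiv_dir i \<phi> x = v x * pderiv_dir i \<phi> x"
      using uv by (rule eventually_mono) simp
  qed (rule borel_measurable_times[OF L2_measurable[OF assms(6)] m], rule borel_measurable_times[OF L2_measurable[OF assms(7)] m])
  then show "(LINT x|lebesgue_on Omega. w x * \<phi> x) = (LINT x|lebesgue_on Omega. z x * \<phi> x)"
    using assms(3,4) \<phi> by (simp add: has_weak_pderiv_def)
qed

lemma weak_laplacian_unique:
  assumes "w \<in> L2 Omega" "z \<in> L2 Omega" "has_weak_laplacian Omega u w" "has_weak_laplacian Omega u z"
  shows "AE x in lebesgue_on Omega. w x = z x"
  using assms by (intro weak_derivative_unique) (auto simp: has_weak_laplacian_def)

lemma weak_pderiv_L2: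
  assumes "w \<in> L2 Omega" "has_weak_pderiv Omega i u w"
  shows "weak_pderiv Omega i u \<in> L2 Omega" "has_weak_pderiv Omega i u (weak_pderiv Omega i u)"
  using someI[of "\<lambda>w. w \<in> L2 Omega \<and> has_weak_pderiv Omega i u w" w] assms by (auto simp: weak_pderiv_def)

lemma weak_laplacian_L2:
  assumes "w \<in> L2 Omega" "has_weak_laplacian Omega u w"
  shows "weak_laplacian Omega u \<in> L2 Omega" "has_weak_laplacian Omega u (weak_laplacian Omega u)"
  using someI[of "\<lambda>w. w \<in> L2 Omega \<and> has_weak_laplacian Omega u w" w] assms by (auto simp: weak_laplacian_def)

lemma H1_norm_ge: "L2_norm Omega u \<le> H1_norm Omega u" "L2_norm Omega (weak_pderiv Omega i u) \<le> H1_norm Omega u"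
proof -
  show "L2_norm Omega u \<le> H1_norm Omega u"
    unfolding H1_norm_def by (rule real_le_rsqrt) (simp add: sum_nonneg)
  have "(L2_norm Omega (weak_pderiv Omega i u))\<^sup>2 \<le> (\<Sum>i\<in>UNIV. (L2_norm Omega (weak_pderiv Omega i u))\<^sup>2)"
    by (intro member_le_sum) auto
  then have "(L2_norm Omega (weak_pderiv Omega i u))\<^sup>2 \<le> (L2_norm Omega u)\<^sup>2 + (\<Sum>i\<in>UNIV. (L2_norm Omega (weak_pderiv Omega i u))\<^sup>2)"
    using zero_le_power2[of "L2_norm Omega u"] by linarith
  then show "L2_norm Omega (weak_pderiv Omega i u) \<le> H1_norm Omega u"
    unfolding H1_norm_def by (rule real_le_rsqrt)
qed

lemma graph_norm_ge:
  "H1_norm Omega (fst d) \<le> graph_norm d" "H1_norm Omega (snd d) \<le> graph_norm d"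
  "L2_norm Omega (weak_laplacian Omega (fst d)) \<le> graph_norm d"
  unfolding graph_norm_def energy_norm_def G_def
  by (rule real_le_rsqrt; simp)+

lemma normal_deriv_sum:
  assumes "smooth u" "norm x = 1"
  shows "normal_deriv u x = (\<Sum>i\<in>UNIV. of_real (x $ i) * pderiv_dir i u x)"
  using frechet_derivative_at[OF C1_on_has_derivative[OF smooth_C1_on[OF assms(1), of UNIV], of x]] assms(2)
  by (simp add: normal_deriv_def fun_eq_iff)

text \<open>The boundary condition of \<open>h\<close> and that of \<open>\<phi>\<close> together leave the flux \<open>\<gamma> (h2 - \<mu> h1) \<phi>\<close>. Subtracting
  \<open>\<gamma> (h2 - \<mu> h1) \<phi> x\<close> from the field \<open>\<phi> \<nabla>h1 - h1 \<nabla>\<phi>\<close> removes it at the price of a volume term.\<close>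

lemma green_identity:
  fixes h1 h2 :: "R3 \<Rightarrow> complex"
  assumes h: "smooth h1" "smooth h2"
    and bc: "\<And>x. norm x = 1 \<Longrightarrow> normal_deriv h1 x = of_real \<gamma> * h2 x"
    and \<phi>: "C1_on (- {0}) \<phi> p" and p: "\<And>i. C1_on (- {0}) (p i) (q i)"
    and supp: "\<And>x. norm x \<ge> R \<Longrightarrow> \<phi> x = 0" "\<And>i x. norm x \<ge> R \<Longrightarrow> p i x = 0" "\<And>i j x. norm x \<ge> R \<Longrightarrow> q i j x = 0"
    and robin: "\<And>x. norm x = 1 \<Longrightarrow> (\<Sum>i\<in>UNIV. of_real (x $ i) * p i x) = of_real \<gamma> * \<mu> * \<phi> x"
  shows "(LINT x|lebesgue_on Omega. laplacian h1 x * \<phi> x - h1 x * (\<Sum>i\<in>UNIV. q i i x)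
      - of_real \<gamma> * ((\<Sum>i\<in>UNIV. (pderiv_dir i h2 x - \<mu> * pderiv_dir i h1 x) * (of_real (x $ i) * \<phi> x))
         + (h2 x - \<mu> * h1 x) * ((\<Sum>i\<in>UNIV. of_real (x $ i) * p i x) + 3 * \<phi> x))) = 0"
proof -
  let ?S = "- {0 :: R3}"
  define e where "e x = h2 x - \<mu> * h1 x" for x
  define de where "de i x = pderiv_dir i h2 x - \<mu> * pderiv_dir i h1 x" for i x
  have e: "C1_on ?S e de"
    unfolding e_def de_def by (intro C1_on_diff C1_on_cmult smooth_C1_on h)
  define X where "X i x = \<phi> x * pderiv_dir i h1 x - h1 x * p i x - of_real \<gamma> * ((e x * \<phi> x) * of_real (x $ i))" for i x
  define D where "D i j x = (p j x * pderiv_dir i h1 x + \<phi> x * pderiv_dir j (pderiv_dir i h1) x)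
     - (pderiv_dir j h1 x * p i x + h1 x * q i j x)
     - of_real \<gamma> * ((de j x * \<phi> x + e x * p j x) * of_real (x $ i) + (e x * \<phi> x) * (if j = i then 1 else 0))" for i j x
  have "(LINT x|lebesgue_on Omega. (\<Sum>i\<in>UNIV. D i i x)) = 0"
  proof (rule divergence_exterior[where X = X and D = D and R = R])
    show "C1_on ?S (X i) (D i)" for i
      unfolding X_def D_def
      by (intro C1_on_diff C1_on_mult C1_on_cmult C1_on_coord e \<phi> p smooth_C1_on h smooth_pderiv_dir)
    show "X i x = 0" if "norm x \<ge> R" for i x using supp[OF that] by (simp add: X_def)
    show "D i j x = 0" if "norm x \<ge> R" for i j x using supp[OF that] by (simp add: D_def)
    show "(\<Sum>i\<in>UNIV. of_real (x $ i) * X i x) = 0" if x: "norm x = 1" for x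
    proof -
      have sq: "(\<Sum>i\<in>UNIV. complex_of_real (x $ i) * of_real (x $ i)) = 1"
      proof -
        have "(\<Sum>i\<in>UNIV. x $ i * x $ i) = 1"
          using x by (simp add: norm_eq_1 inner_vec_def)
        then have "complex_of_real (\<Sum>i\<in>UNIV. x $ i * x $ i) = 1" by simp
        then show ?thesis by simp
      qed
      have "(\<Sum>i\<in>UNIV. of_real (x $ i) * X i x) = \<phi> x * (\<Sum>i\<in>UNIV. of_real (x $ i) * pderiv_dir i h1 x)
        - h1 x * (\<Sum>i\<in>UNIV. of_real (x $ i) * p i x) - of_real \<gamma> * (e x * \<phi> x) * (\<Sum>i\<in>UNIV. of_real (x $ i) * of_real (x $ i))"
        by (simp add: X_def sum_distrib_left sum_subtractf[symmetric] algebra_simps)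
      also have "\<dots> = \<phi> x * (of_real \<gamma> * h2 x) - h1 x * (of_real \<gamma> * \<mu> * \<phi> x) - of_real \<gamma> * (e x * \<phi> x)"
        using bc[OF x] robin[OF x] normal_deriv_sum[OF h(1) x] sq by simp
      also have "\<dots> = 0" by (simp add: e_def algebra_simps)
      finally show ?thesis .
    qed
  qed
  moreover have "(\<Sum>i\<in>UNIV. D i i x) = laplacian h1 x * \<phi> x - h1 x * (\<Sum>i\<in>UNIV. q i i x)
      - of_real \<gamma> * ((\<Sum>i\<in>UNIV. de i x * (of_real (x $ i) * \<phi> x))
         + e x * ((\<Sum>i\<in>UNIV. of_real (x $ i) * p i x) + 3 * \<phi> x))" for x
  proof -
    have "(\<Sum>i\<in>UNIV. D i i x) = (\<Sum>i\<in>UNIV. pderiv_dir i (pderiv_dir i h1) x * \<phi> x - h1 x * q i i x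
      - of_real \<gamma> * (de i x * (of_real (x $ i) * \<phi> x) + e x * (of_real (x $ i) * p i x) + e x * \<phi> x))"
      by (intro sum.cong refl) (simp add: D_def algebra_simps)
    also have "\<dots> = laplacian h1 x * \<phi> x - h1 x * (\<Sum>i\<in>UNIV. q i i x)
      - of_real \<gamma> * ((\<Sum>i\<in>UNIV. de i x * (of_real (x $ i) * \<phi> x)) + e x * (\<Sum>i\<in>UNIV. of_real (x $ i) * p i x) + 3 * (e x * \<phi> x))"
      by (simp add: laplacian_def sum_subtractf sum.distrib sum_distrib_left[symmetric] sum_distrib_right[symmetric])
    finally show ?thesis by (simp add: algebra_simps)
  qed
  ultimately show ?thesis by (simp add: e_def de_def)
qed

text \<open>The limit of the Green identity along core states. All error terms pair a fixed
  bounded function of bounded support with a function that is small in \<open>L\<^sup>2\<close>: the differences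
  \<open>f - h\<close>, their gradients, and the Laplacian of \<open>f\<^sub>1 - h\<^sub>1\<close>. The combination \<open>h\<^sub>2 - \<mu> h\<^sub>1\<close> is among these because
  \<open>f\<^sub>2 - \<mu> f\<^sub>1 = 0\<close>.\<close>

lemma eigenstate_orthogonal:
  assumes f: "f \<in> G_domain \<gamma>" and eig: "state_eq (G f) (state_scale \<mu> f)"
    and \<phi>: "C1_on (- {0}) \<phi> p" and p: "\<And>i. C1_on (- {0}) (p i) (q i)"
    and supp: "\<And>x. norm x \<ge> R \<Longrightarrow> \<phi> x = 0" "\<And>i x. norm x \<ge> R \<Longrightarrow> p i x = 0" "\<And>i j x. norm x \<ge> R \<Longrightarrow> q i j x = 0"
    and robin: "\<And>x. norm x = 1 \<Longrightarrow> (\<Sum>i\<in>UNIV. of_real (x $ i) * p i x) = of_real \<gamma> * \<mu> * \<phi> x"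
  shows "(LINT x|lebesgue_on Omega. fst f x * ((\<Sum>i\<in>UNIV. q i i x) - \<mu>\<^sup>2 * \<phi> x)) = 0"
proof -
  let ?M = "lebesgue_on Omega"
  define Q where "Q x = (\<Sum>i\<in>UNIV. q i i x)" for x
  define \<psi> where "\<psi> i x = of_real (x $ i) * \<phi> x" for i x
  define \<psi>0 where "\<psi>0 x = (\<Sum>i\<in>UNIV. of_real (x $ i) * p i x) + 3 * \<phi> x" for x
  have cont: "continuous_on (- {0}) \<phi>" "\<And>i. continuous_on (- {0}) (p i)" "\<And>i j. continuous_on (- {0}) (q i j)"
    using C1_on_continuous[OF \<phi>] C1_on_continuous[OF p] C1_on_continuous_derivative[OF p] by auto
  have L: "\<phi> \<in> L2 Omega" "Q \<in> L2 Omega" "\<And>i. \<psi> i \<in> L2 Omega" "\<psi>0 \<in> L2 Omega"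
    unfolding Q_def \<psi>_def \<psi>0_def
    by (rule compact_support_L2[where R = R]; use supp in \<open>auto intro!: continuous_intros cont\<close>)+
  obtain f1 f2 where ff: "f = (f1, f2)" by fastforce
  have f1: "f1 \<in> L2 Omega" "\<And>i. \<exists>w\<in>L2 Omega. has_weak_pderiv Omega i f1 w"
    and f2: "f2 \<in> L2 Omega" "\<And>i. \<exists>w\<in>L2 Omega. has_weak_pderiv Omega i f2 w"
    and fl: "\<exists>w\<in>L2 Omega. has_weak_laplacian Omega f1 w"
    using f by (auto simp: ff G_domain_def maximal_domain_def energy_space_def H1_def)
  define w0 where "w0 = weak_laplacian Omega f1"
  have w0: "w0 \<in> L2 Omega" "has_weak_laplacian Omega f1 w0"
    using fl weak_laplacian_L2 unfolding w0_def by blast+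
  have eq: "AE x in ?M. f2 x = \<mu> * f1 x \<and> w0 x = \<mu> * f2 x"
    using eig by (simp add: ff state_eq_def G_def state_scale_def w0_def)
  define C where "C = (1 + (L2_norm Omega \<phi>)\<^sup>2) + (1 + (L2_norm Omega Q)\<^sup>2)
    + \<bar>\<gamma>\<bar> * ((\<Sum>i\<in>UNIV. (cmod \<mu> + 1) * (1 + (L2_norm Omega (\<psi> i))\<^sup>2)) + (cmod \<mu> + 1) * (1 + (L2_norm Omega \<psi>0)\<^sup>2))"
  have main: "cmod (LINT x|?M. f1 x * (Q x - \<mu>\<^sup>2 * \<phi> x)) \<le> \<epsilon> * C" if \<epsilon>: "\<epsilon> > 0" for \<epsilon>
  proof -
    obtain h where h: "h \<in> G_core \<gamma>" "graph_norm (state_diff f h) < \<epsilon>"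
      using f \<epsilon> by (auto simp: G_domain_def)
    obtain h1 h2 where hh: "h = (h1, h2)" by fastforce
    have hc: "h1 \<in> Cc_infty UNIV" "h2 \<in> Cc_infty UNIV"
      and hbc: "\<And>x. norm x = 1 \<Longrightarrow> normal_deriv h1 x = of_real \<gamma> * h2 x"
      using h(1) by (auto simp: hh G_core_def Gamma_def)
    note hs = Cc_infty_smooth[OF hc(1)] Cc_infty_smooth[OF hc(2)]
    have hL: "h1 \<in> L2 Omega" "h2 \<in> L2 Omega" "\<And>i. pderiv_dir i h1 \<in> L2 Omega" "\<And>i. pderiv_dir i h2 \<in> L2 Omega" "laplacian h1 \<in> L2 Omega"
      using hc[THEN Cc_infty_L2] hc[THEN Cc_infty_pderiv_dir, THEN Cc_infty_L2] hc[THEN laplacian_Cc_infty_L2] by blast+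
    define d1 where "d1 x = f1 x - h1 x" for x
    define d2 where "d2 x = f2 x - h2 x" for x
    have sd: "state_diff f h = (d1, d2)" by (simp add: state_diff_def ff hh d1_def[abs_def] d2_def[abs_def])
    have dL: "d1 \<in> L2 Omega" "d2 \<in> L2 Omega"
      unfolding d1_def d2_def by (intro L2_diff f1(1) f2(1) hL)+
    define w where "w = weak_laplacian Omega d1"
    define v1 where "v1 i = weak_pderiv Omega i d1" for i
    define v2 where "v2 i = weak_pderiv Omega i d2" for i
    have gn: "H1_norm Omega d1 \<le> \<epsilon>" "H1_norm Omega d2 \<le> \<epsilon>" "L2_norm Omega w \<le> \<epsilon>"
      using h(2) graph_norm_ge[of "(d1, d2)"] unfolding sd w_def by auto
    have small: "L2_norm Omega d1 \<le> \<epsilon>" "L2_norm Omega d2 \<le> \<epsilon>" "L2_norm Omega (v1 i) \<le> \<epsilon>"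
      "L2_norm Omega (v2 i) \<le> \<epsilon>" "L2_norm Omega w \<le> \<epsilon>" for i
      unfolding v1_def v2_def
      by (rule order_trans[OF H1_norm_ge(1) gn(1)] order_trans[OF H1_norm_ge(1) gn(2)]
          order_trans[OF H1_norm_ge(2) gn(1)] order_trans[OF H1_norm_ge(2) gn(2)] gn(3))+
    have v1: "v1 i \<in> L2 Omega" "has_weak_pderiv Omega i d1 (v1 i)" for i
    proof -
      obtain z where z: "z \<in> L2 Omega" "has_weak_pderiv Omega i f1 z" using f1(2) by blast
      have "has_weak_pderiv Omega i (\<lambda>x. f1 x + - 1 * h1 x) (\<lambda>x. z x + - 1 * pderiv_dir i h1 x)"
        by (intro has_weak_pderiv_lincomb f1 z hL smooth_has_weak_pderiv hs)
      then have "has_weak_pderiv Omega i d1 (\<lambda>x. z x - pderiv_dir i h1 x)" by (simp add: d1_def[abs_def])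
      moreover have "(\<lambda>x. z x - pderiv_dir i h1 x) \<in> L2 Omega" by (intro L2_diff z hL)
      ultimately show "v1 i \<in> L2 Omega" "has_weak_pderiv Omega i d1 (v1 i)"
        unfolding v1_def using weak_pderiv_L2 by blast+
    qed
    have v2: "v2 i \<in> L2 Omega" "has_weak_pderiv Omega i d2 (v2 i)" for i
    proof -
      obtain z where z: "z \<in> L2 Omega" "has_weak_pderiv Omega i f2 z" using f2(2) by blast
      have "has_weak_pderiv Omega i (\<lambda>x. f2 x + - 1 * h2 x) (\<lambda>x. z x + - 1 * pderiv_dir i h2 x)"
        by (intro has_weak_pderiv_lincomb f2 z hL smooth_has_weak_pderiv hs)
      then have "has_weak_pderiv Omega i d2 (\<lambda>x. z x - pderiv_dir i h2 x)" by (simp add: d2_def[abs_def])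
      moreover have "(\<lambda>x. z x - pderiv_dir i h2 x) \<in> L2 Omega" by (intro L2_diff z hL)
      ultimately show "v2 i \<in> L2 Omega" "has_weak_pderiv Omega i d2 (v2 i)"
        unfolding v2_def using weak_pderiv_L2 by blast+
    qed
    have hwl: "has_weak_laplacian Omega d1 (\<lambda>x. w0 x - laplacian h1 x)"
      using has_weak_laplacian_lincomb[OF f1(1) w0(1) hL(1,5) w0(2) smooth_has_weak_laplacian[OF hs(1)], of "- 1"]
      by (simp add: d1_def[abs_def])
    have w: "w \<in> L2 Omega" "has_weak_laplacian Omega d1 w"
      unfolding w_def using weak_laplacian_L2[OF L2_diff[OF w0(1) hL(5)] hwl] by blast+
    have lap: "AE x in ?M. w x = w0 x - laplacian h1 x"
      by (rule weak_laplacian_unique[OF w(1) L2_diff[OF w0(1) hL(5)] w(2) hwl])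
    have grad: "AE x in ?M. \<mu> * v1 i x - v2 i x = pderiv_dir i h2 x - \<mu> * pderiv_dir i h1 x" for i
    proof -
      have 1: "has_weak_pderiv Omega i (\<lambda>x. h2 x + (- \<mu>) * h1 x) (\<lambda>x. pderiv_dir i h2 x + (- \<mu>) * pderiv_dir i h1 x)"
        by (intro has_weak_pderiv_lincomb hL smooth_has_weak_pderiv hs)
      have 2: "has_weak_pderiv Omega i (\<lambda>x. d2 x + (- \<mu>) * d1 x) (\<lambda>x. v2 i x + (- \<mu>) * v1 i x)"
        by (intro has_weak_pderiv_lincomb dL v1 v2)
      have z: "(\<lambda>x::R3. 0) \<in> L2 Omega" by (simp add: L2_def)
      have 3: "has_weak_pderiv Omega i (\<lambda>x. 0 + (- 1) * (d2 x + (- \<mu>) * d1 x)) (\<lambda>x. 0 + (- 1) * (v2 i x + (- \<mu>) * v1 i x))"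
        by (intro has_weak_pderiv_lincomb z 2 L2_add L2_cmult dL v1 v2) (simp add: has_weak_pderiv_def)
      have "AE x in ?M. 0 + (- 1) * (v2 i x + (- \<mu>) * v1 i x) = pderiv_dir i h2 x + (- \<mu>) * pderiv_dir i h1 x"
      proof (rule weak_pderiv_unique[OF _ _ 3 1])
        show "AE x in ?M. 0 + - 1 * (d2 x + - \<mu> * d1 x) = h2 x + - \<mu> * h1 x"
          using eq by (rule eventually_mono) (simp add: d1_def d2_def algebra_simps)
      qed (intro L2_add L2_cmult z dL v1 v2 hL)+
      then show ?thesis by (rule eventually_mono) (simp add: algebra_simps)
    qed
    define e where "e x = \<mu> * d1 x - d2 x" for x
    have eL: "e \<in> L2 Omega" unfolding e_def by (intro L2_diff L2_cmult dL)
    have gL: "(\<lambda>x. \<mu> * v1 i x - v2 i x) \<in> L2 Omega" for i by (intro L2_diff L2_cmult v1 v2)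
    have I: "integrable ?M (\<lambda>x. a x * b x)" if "a \<in> L2 Omega" "b \<in> L2 Omega" for a b
      by (rule L2_mult_integrable[OF that])
    have "(LINT x|?M. laplacian h1 x * \<phi> x - h1 x * Q x
      - of_real \<gamma> * ((\<Sum>i\<in>UNIV. (pderiv_dir i h2 x - \<mu> * pderiv_dir i h1 x) * \<psi> i x) + (h2 x - \<mu> * h1 x) * \<psi>0 x)) = 0"
      using green_identity[OF hs hbc \<phi> p supp robin] by (simp add: Q_def \<psi>_def \<psi>0_def)
    moreover have "(LINT x|?M. laplacian h1 x * \<phi> x - h1 x * Q x
      - of_real \<gamma> * ((\<Sum>i\<in>UNIV. (pderiv_dir i h2 x - \<mu> * pderiv_dir i h1 x) * \<psi> i x) + (h2 x - \<mu> * h1 x) * \<psi>0 x))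
      = (LINT x|?M. d1 x * Q x - w x * \<phi> x - f1 x * (Q x - \<mu>\<^sup>2 * \<phi> x)
          - of_real \<gamma> * ((\<Sum>i\<in>UNIV. (\<mu> * v1 i x - v2 i x) * \<psi> i x) + e x * \<psi>0 x))"
    proof (rule integral_cong_AE)
      have "AE x in ?M. \<forall>i\<in>UNIV. \<mu> * v1 i x - v2 i x = pderiv_dir i h2 x - \<mu> * pderiv_dir i h1 x"
        using grad by (intro AE_finite_allI) auto
      then show "AE x in ?M. laplacian h1 x * \<phi> x - h1 x * Q x
        - of_real \<gamma> * ((\<Sum>i\<in>UNIV. (pderiv_dir i h2 x - \<mu> * pderiv_dir i h1 x) * \<psi> i x) + (h2 x - \<mu> * h1 x) * \<psi>0 x)
        = d1 x * Q x - w x * \<phi> x - f1 x * (Q x - \<mu>\<^sup>2 * \<phi> x)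
          - of_real \<gamma> * ((\<Sum>i\<in>UNIV. (\<mu> * v1 i x - v2 i x) * \<psi> i x) + e x * \<psi>0 x)"
        using eq lap
      proof eventually_elim
        case (elim x)
        have "laplacian h1 x = \<mu>\<^sup>2 * f1 x - w x" using elim by (simp add: power2_eq_square)
        moreover have "h2 x - \<mu> * h1 x = e x" using elim by (simp add: e_def d1_def d2_def algebra_simps)
        moreover have "(\<Sum>i\<in>UNIV. (pderiv_dir i h2 x - \<mu> * pderiv_dir i h1 x) * \<psi> i x) = (\<Sum>i\<in>UNIV. (\<mu> * v1 i x - v2 i x) * \<psi> i x)"
          using elim(1) by simp
        ultimately show ?case by (simp only:) (simp add: d1_def algebra_simps)
      qed
    qed (intro borel_measurable_diff borel_measurable_times borel_measurable_add borel_measurable_sum borel_measurable_const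
          L2_measurable hL L dL w v1 v2 f1 eL)+
    moreover have "\<dots> = (LINT x|?M. d1 x * Q x) - (LINT x|?M. w x * \<phi> x) - (LINT x|?M. f1 x * (Q x - \<mu>\<^sup>2 * \<phi> x))
          - of_real \<gamma> * ((\<Sum>i\<in>UNIV. LINT x|?M. (\<mu> * v1 i x - v2 i x) * \<psi> i x) + (LINT x|?M. e x * \<psi>0 x))"
      (is "?l = ?r")
    proof -
      have i1: "integrable ?M (\<lambda>x. d1 x * Q x)" by (intro I dL L)
      have i2: "integrable ?M (\<lambda>x. w x * \<phi> x)" by (intro I w L)
      have i3: "integrable ?M (\<lambda>x. f1 x * (Q x - \<mu>\<^sup>2 * \<phi> x))" by (intro I f1 L2_diff L2_cmult L)
      have i4: "integrable ?M (\<lambda>x. (\<mu> * v1 i x - v2 i x) * \<psi> i x)" for i by (intro I gL L)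
      have i5: "integrable ?M (\<lambda>x. e x * \<psi>0 x)" by (intro I eL L)
      have i6: "integrable ?M (\<lambda>x. \<Sum>i\<in>UNIV. (\<mu> * v1 i x - v2 i x) * \<psi> i x)"
        by (intro Bochner_Integration.integrable_sum i4)
      show ?thesis
        by (simp only: Bochner_Integration.integral_diff Bochner_Integration.integral_add Bochner_Integration.integral_sum
            integral_mult_right_zero Bochner_Integration.integrable_diff Bochner_Integration.integrable_add integrable_mult_right
            i1 i2 i3 i4 i5 i6)
    qed
    ultimately have id: "(LINT x|?M. f1 x * (Q x - \<mu>\<^sup>2 * \<phi> x)) = (LINT x|?M. d1 x * Q x) - (LINT x|?M. w x * \<phi> x)
          - of_real \<gamma> * ((\<Sum>i\<in>UNIV. LINT x|?M. (\<mu> * v1 i x - v2 i x) * \<psi> i x) + (LINT x|?M. e x * \<psi>0 x))"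
      by (simp add: algebra_simps)
    have two: "cmod (LINT x|?M. (\<mu> * a x - b x) * c x) \<le> \<epsilon> * ((cmod \<mu> + 1) * (1 + (L2_norm Omega c)\<^sup>2))"
      if "a \<in> L2 Omega" "b \<in> L2 Omega" "c \<in> L2 Omega" "L2_norm Omega a \<le> \<epsilon>" "L2_norm Omega b \<le> \<epsilon>" for a b c
    proof -
      have "(LINT x|?M. (\<mu> * a x - b x) * c x) = \<mu> * (LINT x|?M. a x * c x) - (LINT x|?M. b x * c x)"
        using I[OF that(1,3)] I[OF that(2,3)] by (simp add: left_diff_distrib mult.assoc)
      also have "cmod \<dots> \<le> cmod \<mu> * cmod (LINT x|?M. a x * c x) + cmod (LINT x|?M. b x * c x)"
        by (rule order_trans[OF norm_triangle_ineq4]) (simp add: norm_mult)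
      also have "\<dots> \<le> cmod \<mu> * (\<epsilon> * (1 + (L2_norm Omega c)\<^sup>2)) + \<epsilon> * (1 + (L2_norm Omega c)\<^sup>2)"
        by (intro add_mono mult_left_mono integral_mult_small that \<epsilon>) auto
      finally show ?thesis by (simp add: algebra_simps)
    qed
    have "cmod (LINT x|?M. f1 x * (Q x - \<mu>\<^sup>2 * \<phi> x)) \<le> cmod (LINT x|?M. d1 x * Q x) + cmod (LINT x|?M. w x * \<phi> x)
      + cmod (of_real \<gamma> * ((\<Sum>i\<in>UNIV. LINT x|?M. (\<mu> * v1 i x - v2 i x) * \<psi> i x) + (LINT x|?M. e x * \<psi>0 x)))"
      unfolding id by (intro order_trans[OF norm_triangle_ineq4] add_mono order_refl norm_triangle_ineq4)
    also have "\<dots> \<le> \<epsilon> * (1 + (L2_norm Omega Q)\<^sup>2) + \<epsilon> * (1 + (L2_norm Omega \<phi>)\<^sup>2)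
      + \<bar>\<gamma>\<bar> * ((\<Sum>i\<in>UNIV. \<epsilon> * ((cmod \<mu> + 1) * (1 + (L2_norm Omega (\<psi> i))\<^sup>2))) + \<epsilon> * ((cmod \<mu> + 1) * (1 + (L2_norm Omega \<psi>0)\<^sup>2)))"
    proof (intro add_mono integral_mult_small dL w L small \<epsilon>)
      have "cmod ((\<Sum>i\<in>UNIV. LINT x|?M. (\<mu> * v1 i x - v2 i x) * \<psi> i x) + (LINT x|?M. e x * \<psi>0 x))
        \<le> (\<Sum>i\<in>UNIV. \<epsilon> * ((cmod \<mu> + 1) * (1 + (L2_norm Omega (\<psi> i))\<^sup>2))) + \<epsilon> * ((cmod \<mu> + 1) * (1 + (L2_norm Omega \<psi>0)\<^sup>2))"
        unfolding e_def
        by (intro order_trans[OF norm_triangle_ineq] add_mono order_trans[OF norm_sum] sum_mono two v1 v2 L dL small)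
      then show "cmod (of_real \<gamma> * ((\<Sum>i\<in>UNIV. LINT x|?M. (\<mu> * v1 i x - v2 i x) * \<psi> i x) + (LINT x|?M. e x * \<psi>0 x)))
        \<le> \<bar>\<gamma>\<bar> * ((\<Sum>i\<in>UNIV. \<epsilon> * ((cmod \<mu> + 1) * (1 + (L2_norm Omega (\<psi> i))\<^sup>2))) + \<epsilon> * ((cmod \<mu> + 1) * (1 + (L2_norm Omega \<psi>0)\<^sup>2)))"
        unfolding norm_mult norm_of_real by (intro mult_left_mono) auto
    qed
    also have "\<dots> = \<epsilon> * C"
      unfolding C_def sum_distrib_left[symmetric] by (simp add: algebra_simps)
    finally show ?thesis .
  qed
  have "cmod (LINT x|?M. f1 x * (Q x - \<mu>\<^sup>2 * \<phi> x)) \<le> 0"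
  proof (rule field_le_epsilon)
    fix \<delta> :: real assume \<delta>: "\<delta> > 0"
    have C0: "C \<ge> 0" unfolding C_def by (intro add_nonneg_nonneg mult_nonneg_nonneg sum_nonneg) auto
    have "cmod (LINT x|?M. f1 x * (Q x - \<mu>\<^sup>2 * \<phi> x)) \<le> (\<delta> / (C + 1)) * C"
      using C0 \<delta> by (intro main) auto
    also have "\<dots> \<le> 0 + \<delta>" using C0 \<delta> by (simp add: field_simps)
    finally show "cmod (LINT x|?M. f1 x * (Q x - \<mu>\<^sup>2 * \<phi> x)) \<le> 0 + \<delta>" .
  qed
  then show ?thesis by (simp add: ff Q_def)
qed

section \<open>Decaying solutions of the radial equations at the boundary\<close>

text \<open>In terms of modified spherical Bessel functions of the third kind this is \<open>k\<^sub>n\<^sub>+\<^sub>1(s) / k\<^sub>n(s)\<close> at \<open>s = 1/z\<close>. The variable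
  \<open>z\<close> makes it regular at the origin, so that quarter discs can serve as domains for the maximum
  principle.\<close>

fun mode_ratio :: "nat \<Rightarrow> complex \<Rightarrow> complex" where
  "mode_ratio 0 z = 1 + z"
| "mode_ratio (Suc n) z = 1 / mode_ratio n z + of_nat (2 * n + 3) * z"

lemma Re_inverse_pos:
  assumes "Re w > 0" shows "Re (1 / w) > 0"
proof -
  have "Re (1 / w) = Re w / (cmod w)\<^sup>2"
    by (simp add: Re_divide cmod_power2)
  moreover have "w \<noteq> 0" using assms by auto
  ultimately show ?thesis using assms by simp
qed

lemma Re_inverse_nonneg: "Re w \<ge> 0 \<Longrightarrow> Re (1 / w) \<ge> 0"
  by (simp add: Re_divide)

lemma Re_mode_ratio_pos: "Re z \<ge> 0 \<Longrightarrow> Re (mode_ratio n z) > 0"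
proof (induction n)
  case (Suc n)
  have "Re (1 / mode_ratio n z) > 0" using Suc by (intro Re_inverse_pos) auto
  moreover have "Re (of_nat (2 * n + 3) * z) = of_nat (2*n+3) * Re z" by simp
  moreover have "of_nat (2*n+3) * Re z \<ge> 0" using Suc by simp
  ultimately show ?case by (simp only: mode_ratio.simps plus_complex.sel)
qed auto

lemma mode_ratio_nonzero: "Re z \<ge> 0 \<Longrightarrow> mode_ratio n z \<noteq> 0"
  using Re_mode_ratio_pos[of z n] by auto

text \<open>The number \<open>(2 j choose j) / 4\<^sup>j\<close>.\<close>

fun central_coeff :: "nat \<Rightarrow> real" where
  "central_coeff 0 = 1"
| "central_coeff (Suc j) = central_coeff j * (2 * real j + 1) / (2 * real j + 2)"

text \<open>Coefficients of \<open>\<bar>y\<^sub>n(\<i> \<tau>)\<bar>\<^sup>2\<close> as a polynomial in \<open>T = \<tau>\<^sup>2\<close>, where \<open>y\<^sub>n\<close> is the Bessel polynomial of degree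
  \<open>n\<close>, the polynomial part of the \<open>n\<close>-th radial solution.\<close>

definition amp_coeff :: "nat \<Rightarrow> nat \<Rightarrow> real" where
  "amp_coeff n j = (if j \<le> n then central_coeff j * fact (n + j) / fact (n - j) else 0)"

definition amplitude :: "nat \<Rightarrow> real \<Rightarrow> real" where
  "amplitude n T = (\<Sum>j\<le>n. amp_coeff n j * T ^ j)"

text \<open>This is \<open>T\<^sup>-\<^sup>n\<close> times the derivative of \<open>T\<^sup>n\<^sup>+\<^sup>1 amplitude n T\<close>.\<close>

definition flux :: "nat \<Rightarrow> real \<Rightarrow> real" where
  "flux n T = (\<Sum>j\<le>n. real (n + 1 + j) * amp_coeff n j * T ^ j)"

lemma central_coeff_pos: "central_coeff j > 0"
  by (induction j) auto

lemma amp_coeff_nonneg: "amp_coeff n j \<ge> 0"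
  using central_coeff_pos[of j] by (simp add: amp_coeff_def)

lemma amp_coeff_step: "real (n + 1 + j) * amp_coeff n j = (real (n + 1) - j) * amp_coeff (Suc n) j"
proof (cases "j \<le> n")
  case True
  then obtain m where m: "n = j + m" using le_Suc_ex by blast
  have f: "fact (Suc m) = (real m + 1) * fact m" by simp
  have d: "Suc (j + m) - j = Suc m" "j + m - j = m" by auto
  have F: "fact (Suc (j + m) + j) = real (j + m + 1 + j) * fact (j + m + j)" by simp
  have e: "real (j + m + 1) - real j = real m + 1" by simp
  have "real m + 1 \<noteq> 0" by linarith
  moreover have "j \<le> j + m" "j \<le> Suc (j + m)" by auto
  ultimately show ?thesis unfolding m
    by (simp only: amp_coeff_def d f F e if_True) (simp add: divide_simps)
next
  case False
  then show ?thesis by (cases "j = n + 1") (auto simp: amp_coeff_def)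
qed

lemma amp_coeff_step2:
  "amp_coeff (n + 2) (Suc j) - amp_coeff n (Suc j) = (2 * n + 3) * (2 * j + 1) * amp_coeff (Suc n) j"
proof -
  consider "j + 1 \<le> n" | "j = n" | "j = n + 1" | "j > n + 1" by linarith
  then show ?thesis
  proof cases
    case 1
    define m where "m = n - Suc j"
    have n: "n = m + Suc j" using 1 by (simp add: m_def)
    have d: "n + 2 - Suc j = m + 2" "n - Suc j = m" "Suc n - j = m + 2" by (simp_all add: n)
    have f1: "fact (n + 2 + Suc j) = (real n + j + 3) * (real n + j + 2) * fact (n + 1 + j)"
      by (simp add: algebra_simps)
    have f2: "fact (n + Suc j) = (fact (n + 1 + j) :: real)" "fact (Suc n + j) = (fact (n + 1 + j) :: real)"
      by simp_all
    have f3: "fact (m + 2) = (real m + 2) * (real m + 1) * fact m" by (simp add: algebra_simps)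
    have m: "real m = real n - j - 1" using n by simp
    have pos: "real m + 2 \<noteq> 0" "real m + 1 \<noteq> 0" by linarith+
    let ?F = "fact (n + 1 + j) :: real" and ?c = "central_coeff j"
    have "amp_coeff (n + 2) (Suc j) - amp_coeff n (Suc j)
      = ?c * (2 * real j + 1) / (2 * real j + 2) * ((real n + j + 3) * (real n + j + 2) * ?F) / ((real m + 2) * (real m + 1) * fact m)
        - ?c * (2 * real j + 1) / (2 * real j + 2) * ?F / fact m"
      using 1 by (simp only: amp_coeff_def d f1 f2 f3 if_True central_coeff.simps) simp
    also have "\<dots> = ?c * (2 * real j + 1) / (2 * real j + 2) * ?F / ((real m + 2) * (real m + 1) * fact m)
       * ((real n + j + 3) * (real n + j + 2) - (real m + 2) * (real m + 1))"
    proof -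
      have "c * k / l * (A * B * F) / (p * q * f) - c * k / l * F / f = c * k / l * F / (p * q * f) * (A * B - p * q)"
        if "p \<noteq> 0" "q \<noteq> 0" for c k l A B F p q f :: real
      proof -
        have "c * k / l * F / f = c * k / l * F / (p * q * f) * (p * q)" using that by simp
        moreover have "c * k / l * (A * B * F) / (p * q * f) = c * k / l * F / (p * q * f) * (A * B)" by simp
        ultimately show ?thesis by (simp only: right_diff_distrib)
      qed
      from this[OF pos] show ?thesis .
    qed
    also have "(real n + j + 3) * (real n + j + 2) - (real m + 2) * (real m + 1) = (2 * real j + 2) * (2 * real n + 3)"
      unfolding m by (simp add: algebra_simps)
    also have "?c * (2 * real j + 1) / (2 * real j + 2) * ?F / ((real m + 2) * (real m + 1) * fact m) * ((2 * real j + 2) * (2 * real n + 3))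
      = (2 * real n + 3) * (2 * real j + 1) * (?c * ?F / ((real m + 2) * (real m + 1) * fact m))"
      by (simp add: divide_simps)
    also have "?c * ?F / ((real m + 2) * (real m + 1) * fact m) = amp_coeff (Suc n) j"
      using 1 by (simp only: amp_coeff_def d f2 f3) simp
    finally show ?thesis by (simp add: algebra_simps)
  next
    case 2
    have f: "fact (n + 2 + Suc n) = (2 * real n + 3) * (2 * real n + 2) * fact (Suc n + n)"
      by (simp add: algebra_simps)
    have d: "n + 2 - Suc n = 1" "Suc n - n = 1" by auto
    have c: "central_coeff (Suc n) * (2 * real n + 2) = central_coeff n * (2 * real n + 1)"
    proof -
      have "2 * real n + 2 \<noteq> 0" by linarith
      then have "x / (2 * real n + 2) * (2 * real n + 2) = x" for x by (rule nonzero_eq_divide_eq[THEN iffD1]) simp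
      then show ?thesis by (simp only: central_coeff.simps)
    qed
    have "amp_coeff (n + 2) (Suc n) = (2 * real n + 3) * fact (Suc n + n) * (central_coeff (Suc n) * (2 * real n + 2))"
      by (simp only: amp_coeff_def d f) simp
    moreover have "amp_coeff (Suc n) n = central_coeff n * fact (Suc n + n)"
      by (simp only: amp_coeff_def d) simp
    moreover have "amp_coeff n (Suc n) = 0" by (simp add: amp_coeff_def)
    ultimately have "amp_coeff (n + 2) (Suc n) - amp_coeff n (Suc n)
       = (2 * real n + 3) * fact (Suc n + n) * (central_coeff n * (2 * real n + 1))"
      "amp_coeff (Suc n) n = central_coeff n * fact (Suc n + n)" by (simp_all only: c diff_zero)
    then have "amp_coeff (n + 2) (Suc n) - amp_coeff n (Suc n) = (2 * real n + 3) * (2 * real n + 1) * amp_coeff (Suc n) n"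
      by (simp only: mult.assoc mult.commute mult.left_commute)
    then show ?thesis unfolding 2 by simp
  next
    case 3
    define m where "m = n + 1"
    have f: "fact (n + 2 + Suc m) = (2 * real m + 1) * (2 * real m + 2) * fact (Suc n + m)"
      by (simp add: m_def algebra_simps)
    have d: "n + 2 - Suc m = 0" "Suc n - m = 0" by (auto simp: m_def)
    have c: "central_coeff (Suc m) * (2 * real m + 2) = central_coeff m * (2 * real m + 1)"
    proof -
      have "2 * real m + 2 \<noteq> 0" by linarith
      then have "x / (2 * real m + 2) * (2 * real m + 2) = x" for x by (rule nonzero_eq_divide_eq[THEN iffD1]) simp
      then show ?thesis by (simp only: central_coeff.simps)
    qed
    have "amp_coeff (n + 2) (Suc m) = (2 * real m + 1) * fact (Suc n + m) * (central_coeff (Suc m) * (2 * real m + 2))"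
      by (simp only: amp_coeff_def d f) (simp add: m_def)
    moreover have "amp_coeff (Suc n) m = central_coeff m * fact (Suc n + m)"
      by (simp only: amp_coeff_def d) (simp add: m_def)
    moreover have "amp_coeff n (Suc m) = 0" by (simp add: amp_coeff_def m_def)
    ultimately have "amp_coeff (n + 2) (Suc m) - amp_coeff n (Suc m)
       = (2 * real m + 1) * fact (Suc n + m) * (central_coeff m * (2 * real m + 1))"
      "amp_coeff (Suc n) m = central_coeff m * fact (Suc n + m)" by (simp_all only: c diff_zero)
    then have "amp_coeff (n + 2) (Suc m) - amp_coeff n (Suc m) = (2 * real m + 1) * (2 * real m + 1) * amp_coeff (Suc n) m"
      by (simp only: mult.assoc mult.commute mult.left_commute)
    moreover have "2 * real n + 3 = 2 * real m + 1" "j = m" using 3 by (simp_all add: m_def)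
    ultimately show ?thesis by simp
  next
    case 4
    then show ?thesis by (simp add: amp_coeff_def)
  qed
qed

lemma amplitude_upto: "n \<le> N \<Longrightarrow> amplitude n T = (\<Sum>j\<le>N. amp_coeff n j * T ^ j)"
  unfolding amplitude_def by (rule sum.mono_neutral_left) (auto simp: amp_coeff_def)

lemma flux_upto: "n \<le> N \<Longrightarrow> flux n T = (\<Sum>j\<le>N. real (n + 1 + j) * amp_coeff n j * T ^ j)"
  unfolding flux_def by (rule sum.mono_neutral_left) (auto simp: amp_coeff_def)

lemma amplitude_pos:
  assumes "T \<ge> 0" shows "amplitude n T > 0"
proof -
  have "amplitude n T \<ge> amp_coeff n 0 * T ^ 0"
    unfolding amplitude_def using assms amp_coeff_nonneg
    by (intro member_le_sum) auto
  then show ?thesis by (simp add: amp_coeff_def)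
qed

lemma flux_ge:
  assumes "T \<ge> 0" shows "flux n T \<ge> real (n + 1) * amplitude n T"
proof -
  have "real (n + 1) * amplitude n T = (\<Sum>j\<le>n. real (n + 1) * (amp_coeff n j * T ^ j))"
    by (simp add: amplitude_def sum_distrib_left)
  also have "\<dots> \<le> flux n T"
    unfolding flux_def
  proof (rule sum_mono)
    fix j
    have "real (n + 1) * (amp_coeff n j * T ^ j) \<le> real (n + 1 + j) * (amp_coeff n j * T ^ j)"
      using amp_coeff_nonneg assms by (intro mult_right_mono) auto
    then show "real (n + 1) * (amp_coeff n j * T ^ j) \<le> real (n + 1 + j) * amp_coeff n j * T ^ j"
      by (simp add: mult.assoc)
  qed
  finally show ?thesis .
qed

lemma flux_add: "flux (Suc n) T + flux n T = real (2 * n + 3) * amplitude (Suc n) T"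
proof -
  have "flux (Suc n) T + flux n T = (\<Sum>j\<le>Suc n. real (Suc n + 1 + j) * amp_coeff (Suc n) j * T ^ j + real (n + 1 + j) * amp_coeff n j * T ^ j)"
    by (simp add: flux_upto[of "Suc n" "Suc n"] flux_upto[of n "Suc n"] sum.distrib)
  also have "\<dots> = (\<Sum>j\<le>Suc n. real (2 * n + 3) * (amp_coeff (Suc n) j * T ^ j))"
  proof (rule sum.cong[OF refl])
    fix j
    show "real (Suc n + 1 + j) * amp_coeff (Suc n) j * T ^ j + real (n + 1 + j) * amp_coeff n j * T ^ j
        = real (2 * n + 3) * (amp_coeff (Suc n) j * T ^ j)"
      unfolding amp_coeff_step[of n j] by (simp add: algebra_simps)
  qed
  also have "\<dots> = real (2 * n + 3) * amplitude (Suc n) T"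
    by (simp add: amplitude_def sum_distrib_left del: sum.atMost_Suc)
  finally show ?thesis .
qed

lemma amplitude_step:
  "amplitude (n + 2) T = amplitude n T + (2 * n + 3) * T * (flux (Suc n) T - flux n T)"
proof -
  have "amplitude (n + 2) T - amplitude n T = (\<Sum>j\<le>Suc (Suc n). (amp_coeff (n + 2) j - amp_coeff n j) * T ^ j)"
    by (simp add: amplitude_upto[of "Suc (Suc n)" "Suc (Suc n)"] amplitude_upto[of n "Suc (Suc n)"] sum_subtractf left_diff_distrib del: sum.atMost_Suc)
  also have "\<dots> = (\<Sum>j\<le>Suc n. (amp_coeff (n + 2) (Suc j) - amp_coeff n (Suc j)) * T ^ Suc j)"
    by (subst sum.atMost_Suc_shift) (simp add: amp_coeff_def)
  also have "\<dots> = (\<Sum>j\<le>Suc n. real (2 * n + 3) * T * (real (Suc n + 1 + j) * amp_coeff (Suc n) j * T ^ j - real (n + 1 + j) * amp_coeff n j * T ^ j))"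
  proof (rule sum.cong[OF refl])
    fix j
    show "(amp_coeff (n + 2) (Suc j) - amp_coeff n (Suc j)) * T ^ Suc j
      = real (2 * n + 3) * T * (real (Suc n + 1 + j) * amp_coeff (Suc n) j * T ^ j - real (n + 1 + j) * amp_coeff n j * T ^ j)"
      unfolding amp_coeff_step2 amp_coeff_step[of n j] by (simp add: algebra_simps)
  qed
  also have "\<dots> = (2 * n + 3) * T * (flux (Suc n) T - flux n T)"
    by (simp add: flux_upto[of "Suc n" "Suc n"] flux_upto[of n "Suc n"] sum_subtractf sum_distrib_left right_diff_distrib del: sum.atMost_Suc)
  finally show ?thesis by simp
qed

text \<open>On the imaginary axis modulus and imaginary part satisfy a closed recursion, which the polynomials
  above solve.\<close>

lemma mode_ratio_imaginary_axis:
  fixes \<tau> :: real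
  defines "W \<equiv> \<lambda>n. mode_ratio n (\<i> * \<tau>)"
  shows "(cmod (W n))\<^sup>2 = amplitude (Suc n) (\<tau>\<^sup>2) / amplitude n (\<tau>\<^sup>2)
       \<and> Im (W n) = \<tau> * flux n (\<tau>\<^sup>2) / amplitude n (\<tau>\<^sup>2)"
proof (induction n)
  case 0
  show ?case
    by (simp add: W_def amplitude_def flux_def amp_coeff_def cmod_power2)
next
  case (Suc n)
  let ?T = "\<tau>\<^sup>2"
  let ?a = "\<lambda>n. amplitude n ?T" and ?b = "\<lambda>n. flux n ?T"
  have pos: "?a n > 0" "?a (Suc n) > 0" "?a (Suc (Suc n)) > 0" by (auto intro: amplitude_pos)
  let ?D = "(cmod (W n))\<^sup>2"
  have D: "?D = ?a (Suc n) / ?a n" and I: "Im (W n) = \<tau> * ?b n / ?a n" using Suc by auto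
  have Dpos: "?D > 0" using pos by (simp add: D)
  have W: "W (Suc n) = 1 / W n + of_nat (2 * n + 3) * (\<i> * \<tau>)" by (simp add: W_def)
  have re: "Re (W (Suc n)) = Re (W n) / ?D"
    by (simp add: W Re_divide cmod_power2)
  have im: "Im (W (Suc n)) = (2 * n + 3) * \<tau> - Im (W n) / ?D"
    by (simp add: W Im_divide cmod_power2)
  have q: "Im (W n) / ?D = \<tau> * ?b n / ?a (Suc n)"
    using pos by (simp add: D I)
  have b: "?b n = (2 * n + 3) * ?a (Suc n) - ?b (Suc n)" using flux_add[of n ?T] by simp
  have Im: "Im (W (Suc n)) = \<tau> * ?b (Suc n) / ?a (Suc n)"
    unfolding im q b using pos by (simp add: field_simps)
  have "(cmod (W (Suc n)))\<^sup>2 = (Re (W n))\<^sup>2 / ?D\<^sup>2 + ((2 * n + 3) * \<tau> - Im (W n) / ?D)\<^sup>2"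
    by (simp add: cmod_power2[of "W (Suc n)"] re im power_divide)
  also have "\<dots> = ((Re (W n))\<^sup>2 + (Im (W n))\<^sup>2) / ?D\<^sup>2 + (2 * n + 3)\<^sup>2 * ?T - 2 * (2 * n + 3) * \<tau> * (Im (W n) / ?D)"
    by (simp add: power2_diff power_divide power_mult_distrib add_divide_distrib)
  also have "((Re (W n))\<^sup>2 + (Im (W n))\<^sup>2) / ?D\<^sup>2 = 1 / ?D"
    using Dpos unfolding cmod_power2[symmetric] by (simp add: power2_eq_square)
  also have "1 / ?D = ?a n / ?a (Suc n)" using pos by (simp add: D)
  also have "?a n / ?a (Suc n) + (2 * n + 3)\<^sup>2 * ?T - 2 * (2 * n + 3) * \<tau> * (Im (W n) / ?D)
     = (?a n + (2 * n + 3) * ?T * ((2 * n + 3) * ?a (Suc n) - ?b n - ?b n)) / ?a (Suc n)"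
    unfolding q using pos by (simp add: field_simps power2_eq_square)
  also have "(2 * n + 3) * ?a (Suc n) - ?b n - ?b n = ?b (Suc n) - ?b n" using b by simp
  also have "?a n + (2 * n + 3) * ?T * (?b (Suc n) - ?b n) = ?a (Suc (Suc n))"
    using amplitude_step[of n ?T] by simp
  finally show ?case using Im by simp
qed

text \<open>The monotonicity in \<open>r\<close> of the squared modulus of \<open>r k\<^sub>n(\<i> r)\<close> in disguise: it comes from the factors
  \<open>n + 1 + j \<ge> n + 1\<close> in the definition of \<open>flux\<close> and the positivity of all coefficients.\<close>

lemma Im_mode_ratio_imaginary_axis:
  assumes "\<tau> \<ge> 0"
  shows "Im (mode_ratio n (\<i> * of_real \<tau>)) \<ge> real (n + 1) * \<tau>"
proof -
  have pos: "amplitude n (\<tau>\<^sup>2) > 0" by (simp add: amplitude_pos)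
  have "real (n + 1) * \<tau> = \<tau> * (real (n + 1) * amplitude n (\<tau>\<^sup>2)) / amplitude n (\<tau>\<^sup>2)"
    using pos by simp
  also have "\<dots> \<le> \<tau> * flux n (\<tau>\<^sup>2) / amplitude n (\<tau>\<^sup>2)"
    using assms pos flux_ge[of "\<tau>\<^sup>2" n] by (intro divide_right_mono mult_left_mono) (auto simp del: of_nat_add)
  also have "\<dots> = Im (mode_ratio n (\<i> * of_real \<tau>))"
    using mode_ratio_imaginary_axis[of n \<tau>] by simp
  finally show ?thesis .
qed

lemma mode_ratio_real: "z \<in> \<real> \<Longrightarrow> mode_ratio n z \<in> \<real>"
  by (induction n) auto

lemma mode_ratio_remainder_bounded:
  assumes "cmod z \<ge> 2"
  shows "cmod (mode_ratio n z - of_nat (2 * n + 1) * z) \<le> 1"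
proof (induction n)
  case (Suc n)
  let ?t = "mode_ratio n z - of_nat (2 * n + 1) * z"
  have "cmod (of_nat (2 * n + 1) * z) - cmod ?t \<le> cmod (of_nat (2 * n + 1) * z + ?t)"
    by (rule norm_diff_ineq)
  also have "of_nat (2 * n + 1) * z + ?t = mode_ratio n z" by simp
  finally have l: "cmod (mode_ratio n z) \<ge> real (2 * n + 1) * cmod z - 1"
    using Suc by (simp only: norm_mult norm_of_nat)
  moreover have "1 * cmod z \<le> real (2 * n + 1) * cmod z" using assms by (intro mult_right_mono) auto
  ultimately have g: "cmod (mode_ratio n z) \<ge> 1" using assms by linarith
  have e: "mode_ratio (Suc n) z - of_nat (2 * Suc n + 1) * z = 1 / mode_ratio n z"
    by (simp add: algebra_simps)
  show ?case unfolding e using g by (simp add: norm_divide divide_simps)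
qed auto

lemma mode_ratio_remainder_small:
  assumes "cmod z \<ge> 2"
  shows "cmod (mode_ratio (Suc n) z - of_nat (2 * n + 3) * z) \<le> 1 / (cmod z - 1)"
proof -
  let ?t = "mode_ratio n z - of_nat (2 * n + 1) * z"
  have "cmod (of_nat (2 * n + 1) * z) - cmod ?t \<le> cmod (of_nat (2 * n + 1) * z + ?t)"
    by (rule norm_diff_ineq)
  also have "of_nat (2 * n + 1) * z + ?t = mode_ratio n z" by simp
  finally have l: "cmod (mode_ratio n z) \<ge> real (2 * n + 1) * cmod z - 1"
    using mode_ratio_remainder_bounded[OF assms, of n] by (simp only: norm_mult norm_of_nat)
  moreover have "1 * cmod z \<le> real (2 * n + 1) * cmod z" using assms by (intro mult_right_mono) auto
  ultimately have g: "cmod (mode_ratio n z) \<ge> cmod z - 1" using assms by linarith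
  have e: "mode_ratio (Suc n) z - of_nat (2 * n + 3) * z = 1 / mode_ratio n z"
    by (simp add: algebra_simps)
  show ?thesis unfolding e using g assms by (simp add: norm_divide frac_le)
qed

lemma holomorphic_mode_ratio: "mode_ratio n holomorphic_on {z. Re z > 0}"
proof (induction n)
  case 0
  show ?case by (simp add: fun_eq_iff[symmetric] cong: holomorphic_cong) (intro holomorphic_intros)
next
  case (Suc n)
  have "(\<lambda>z. 1 / mode_ratio n z + of_nat (2 * n + 3) * z) holomorphic_on {z. Re z > 0}"
    by (intro holomorphic_intros Suc) (use mode_ratio_nonzero in \<open>fastforce\<close>)
  then show ?case by (simp cong: holomorphic_cong)
qed

lemma continuous_mode_ratio: "continuous_on {z. Re z \<ge> 0} (mode_ratio n)"
proof (induction n)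
  case 0
  have "continuous_on {z. Re z \<ge> 0} (\<lambda>z. 1 + z)" by (intro continuous_intros)
  then show ?case by (simp cong: continuous_on_cong)
next
  case (Suc n)
  have "continuous_on {z. Re z \<ge> 0} (\<lambda>z. 1 / mode_ratio n z + of_nat (2 * n + 3) * z)"
    by (intro continuous_intros Suc) (use mode_ratio_nonzero in \<open>fastforce\<close>)
  then show ?case by (simp cong: continuous_on_cong)
qed

text \<open>The maximum principle on a quarter disc for \<open>exp (\<i> a)\<close>, whose modulus is \<open>exp (- Im a)\<close>. On the
  circular arc \<open>a = mode_ratio n z - (n + 1) z\<close> differs from \<open>n z\<close> by a term that tends to \<open>0\<close> with growing radius.\<close>

lemma Im_mode_ratio_quadrant:
  assumes z: "Re z > 0" "Im z > 0"
  shows "Im (mode_ratio n z) \<ge> (n + 1) * Im z"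
proof (cases n)
  case 0
  then show ?thesis by simp
next
  case (Suc k)
  define a where "a = (\<lambda>z. mode_ratio n z - of_nat (n + 1) * z)"
  have Ima: "Im (a w) = Im (mode_ratio n w) - (n + 1) * Im w" for w by (simp add: a_def)
  have "Im (a z) \<ge> - \<delta>" if \<delta>: "\<delta> > 0" for \<delta>
  proof -
    define R where "R = max (cmod z + 1) (1 / \<delta> + 2)"
    have R: "R > cmod z" "R \<ge> 2" "1 / (R - 1) \<le> \<delta>"
    proof -
      show "R > cmod z" "R \<ge> 2" using \<delta> by (auto simp: R_def le_max_iff_disj)
      have "R - 1 \<ge> 1 / \<delta>" by (auto simp: R_def)
      then have "1 / (R - 1) \<le> 1 / (1 / \<delta>)" using \<delta> \<open>R \<ge> 2\<close> by (intro divide_left_mono) auto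
      then show "1 / (R - 1) \<le> \<delta>" by simp
    qed
    define S where "S = {w. Re w > 0} \<inter> {w. Im w > 0} \<inter> ball 0 R"
    have opS: "open S" unfolding S_def by (intro open_Int open_halfspace_Re_gt open_halfspace_Im_gt open_ball)
    have clS: "closure S \<subseteq> {w. Re w \<ge> 0} \<inter> {w. Im w \<ge> 0} \<inter> cball 0 R"
    proof (rule closure_minimal)
      show "closed ({w. Re w \<ge> 0} \<inter> {w. Im w \<ge> 0} \<inter> cball 0 R)"
        by (intro closed_Int closed_halfspace_Re_ge closed_halfspace_Im_ge closed_cball)
    qed (auto simp: S_def)
    have "norm (exp (\<i> * a z)) \<le> exp \<delta>"
    proof (rule maximum_modulus_frontier[where S = S and f = "\<lambda>w. exp (\<i> * a w)" and \<xi> = z])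
      show "(\<lambda>w. exp (\<i> * a w)) holomorphic_on interior S"
      proof -
        have "mode_ratio n holomorphic_on S"
          by (rule holomorphic_on_subset[OF holomorphic_mode_ratio]) (auto simp: S_def)
        then show ?thesis unfolding interior_open[OF opS] a_def by (intro holomorphic_intros)
      qed
      show "continuous_on (closure S) (\<lambda>w. exp (\<i> * a w))"
      proof -
        have "continuous_on (closure S) (mode_ratio n)"
          by (rule continuous_on_subset[OF continuous_mode_ratio]) (use clS in auto)
        then show ?thesis unfolding a_def by (intro continuous_intros)
      qed
      show "bounded S" by (rule bounded_subset[of "ball 0 R"]) (auto simp: S_def)
      show "z \<in> S" using z R by (auto simp: S_def)
      fix w assume "w \<in> frontier S"
      then have w: "w \<in> closure S" "w \<notin> S" using opS by (auto simp: frontier_def interior_open)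
      then have w': "Re w \<ge> 0" "Im w \<ge> 0" "cmod w \<le> R" using clS by auto
      have "\<not> (Re w > 0 \<and> Im w > 0 \<and> cmod w < R)" using w(2) by (auto simp: S_def)
      then consider "Re w = 0" | "Im w = 0" | "cmod w = R" using w' by linarith
      then have "Im (a w) \<ge> - \<delta>"
      proof cases
        case 1
        then have "\<i> * of_real (Im w) = w" by (simp add: complex_eq_iff)
        with Im_mode_ratio_imaginary_axis[OF w'(2), of n]
        have "Im (mode_ratio n w) \<ge> real (n + 1) * Im w" by (simp only:)
        then show ?thesis using \<delta> by (simp add: Ima)
      next
        case 2
        then have "w \<in> \<real>" by (simp add: complex_is_Real_iff)
        then have "Im (mode_ratio n w) = 0" using mode_ratio_real by (simp add: complex_is_Real_iff)
        then show ?thesis using 2 \<delta> by (simp add: Ima)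
      next
        case 3
        let ?t = "mode_ratio (Suc k) w - of_nat (2 * k + 3) * w"
        have t: "cmod ?t \<le> \<delta>"
          using mode_ratio_remainder_small[of w k] 3 R by simp
        have "Im (a w) = Im ?t + (k + 1) * Im w" by (simp add: Ima Suc algebra_simps)
        moreover have "Im ?t \<ge> - \<delta>" using t abs_Im_le_cmod[of ?t] by linarith
        moreover have "(k + 1) * Im w \<ge> 0" using w' by simp
        ultimately show ?thesis by linarith
      qed
      then show "norm (exp (\<i> * a w)) \<le> exp \<delta>" by simp
    qed
    then show ?thesis by simp
  qed
  from this[of "- Im (a z) / 2"] have "Im (a z) \<ge> 0" by linarith
  then show ?thesis by (simp add: Ima algebra_simps)
qed

lemma mode_ratio_cnj: "mode_ratio n (cnj z) = cnj (mode_ratio n z)"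
  by (induction n) auto

text \<open>The upper bound for \<open>t\<close> at \<open>n\<close> yields the lower bound at \<open>n + 1\<close>, and vice versa.\<close>

lemma mode_ratio_positive_real:
  fixes x :: real
  assumes x: "x > 0"
  shows "\<exists>t. mode_ratio n (of_real x) = of_real (t + real (2 * n + 1) * x) \<and> 1 - n * x \<le> t \<and> t * (1 + n * x) \<le> 1"
proof (induction n)
  case 0
  show ?case by (rule exI[of _ 1]) auto
next
  case (Suc n)
  then obtain t where t: "mode_ratio n (of_real x) = of_real (t + real (2 * n + 1) * x)"
    "1 - n * x \<le> t" "t * (1 + n * x) \<le> 1" by blast
  let ?w = "t + (2 * n + 1) * x"
  have w: "?w \<ge> 1 + (n + 1) * x" using t(2) by (simp add: algebra_simps)
  have "(n + 1) * x \<ge> 0" using x by simp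
  then have w0: "?w > 0" using w by linarith
  have up: "1 / ?w * (1 + Suc n * x) \<le> 1" using w w0 by (simp add: field_simps)
  have nx: "n * x \<ge> 0" using x by simp
  have "(1 - Suc n * x) * ?w \<le> 1"
  proof (cases "1 - Suc n * x \<ge> 0")
    case True
    have "?w * (1 + n * x) \<le> 1 + (2 * n + 1) * x * (1 + n * x)" using t(3) by (simp add: algebra_simps)
    then have "(1 - Suc n * x) * (?w * (1 + n * x)) \<le> (1 - Suc n * x) * (1 + (2 * n + 1) * x * (1 + n * x))"
      using True by (intro mult_left_mono) auto
    also have "\<dots> = 1 + n * x - (2 * n + 1) * x\<^sup>2 - (n + 1) * n * (2 * n + 1) * x ^ 3"
      by (simp add: algebra_simps power2_eq_square power3_eq_cube)
    also have "\<dots> \<le> 1 + n * x"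
    proof -
      have "(2 * n + 1) * x\<^sup>2 \<ge> 0" "(n + 1) * n * (2 * n + 1) * x ^ 3 \<ge> 0" using x by auto
      then show ?thesis by linarith
    qed
    finally have "((1 - Suc n * x) * ?w) * (1 + n * x) \<le> 1 * (1 + n * x)" by (simp add: mult.assoc)
    then show ?thesis using nx by (simp only: mult_le_cancel_right)
  next
    case False
    then have "(1 - Suc n * x) * ?w \<le> 0" using w0 by (intro mult_nonpos_nonneg) auto
    then show ?thesis by linarith
  qed
  then have lo: "1 - Suc n * x \<le> 1 / ?w" using w0 by (simp add: field_simps)
  have "mode_ratio (Suc n) (of_real x) = of_real (1 / ?w + (2 * Suc n + 1) * x)"
    by (simp add: t(1))
  then show ?case using up lo by (intro exI[of _ "1 / ?w"] conjI) auto
qed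

lemma mode_ratio_avoids_unit_interval:
  assumes z: "Re z > 0" and \<gamma>: "0 < \<gamma>" "\<gamma> < (1::real)"
  shows "mode_ratio n z - of_nat n * z \<noteq> of_real \<gamma>"
proof
  assume eq: "mode_ratio n z - of_nat n * z = of_real \<gamma>"
  have gen: False if "Re y > 0" "Im y > 0" "mode_ratio n y - of_nat n * y = of_real \<gamma>" for y
  proof -
    have "Im (mode_ratio n y - of_nat n * y) = 0" using that by simp
    then show False using Im_mode_ratio_quadrant[OF that(1,2), of n] that(2) by (simp add: algebra_simps)
  qed
  consider "Im z > 0" | "Im z < 0" | "Im z = 0" by linarith
  then show False
  proof cases
    case 1
    then show False using gen z eq by blast
  next
    case 2
    have "cnj (mode_ratio n z - of_nat n * z) = of_real \<gamma>" using eq by simp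
    then show False using gen[of "cnj z"] z 2 by (simp add: mode_ratio_cnj)
  next
    case 3
    then have zr: "z = of_real (Re z)" by (simp add: complex_eq_iff)
    obtain t where t: "mode_ratio n (of_real (Re z)) = of_real (t + real (2 * n + 1) * Re z)" "1 - n * Re z \<le> t"
      using mode_ratio_positive_real[OF z, of n] by auto
    have "mode_ratio n z - of_nat n * z = of_real (t + (2 * n + 1) * Re z - n * Re z)"
      by (subst (1 2) zr) (simp add: t(1))
    then have "t + (2 * n + 1) * Re z - n * Re z = \<gamma>" using eq by (metis of_real_eq_iff)
    then have "\<gamma> \<ge> 1 + Re z" using t(2) by (simp add: algebra_simps)
    then show False using z \<gamma> by linarith
  qed
qed

lemma mode_ratio_avoids_negative_reals:
  assumes z: "Re z \<ge> 0" "z \<noteq> 0" and \<gamma>: "0 < (\<gamma>::real)"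
  shows "mode_ratio n z - of_nat n * z \<noteq> - of_real \<gamma>"
proof -
  have "Re (mode_ratio n z - of_nat n * z) > 0"
  proof (cases n)
    case 0
    then show ?thesis using z by simp
  next
    case (Suc k)
    have "mode_ratio n z - of_nat n * z = 1 / mode_ratio k z + of_nat (k + 2) * z"
      by (simp add: Suc algebra_simps)
    moreover have "Re (1 / mode_ratio k z) > 0" by (intro Re_inverse_pos Re_mode_ratio_pos z)
    moreover have "Re (of_nat (k + 2) * z) \<ge> 0" using z by simp
    ultimately show ?thesis by (simp only: plus_complex.sel)
  qed
  moreover have "Re (- of_real \<gamma>) < 0" using \<gamma> by simp
  ultimately show ?thesis by (metis less_asym)
qed

section \<open>Solutions of the radial equation\<close>

text \<open>Up to a constant, \<open>k\<^sub>n(s z) / z\<^sup>n\<close>: multiplied by a homogeneous harmonic polynomial of degree \<open>n\<close> it solves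
  \<open>\<Delta>v = s\<^sup>2 v\<close>. The division by powers of \<open>s\<close> has been normalised away, so that \<open>s = 0\<close> is covered.\<close>

fun radial_sol :: "complex \<Rightarrow> nat \<Rightarrow> complex \<Rightarrow> complex" where
  "radial_sol s 0 z = exp (- s * z) / z"
| "radial_sol s (Suc 0) z = (s * z + 1) * exp (- s * z) / z ^ 3"
| "radial_sol s (Suc (Suc n)) z = (of_nat (2 * n + 3) * radial_sol s (Suc n) z + s\<^sup>2 * radial_sol s n z) / z\<^sup>2"

text \<open>The operator \<open>- (1/z) d/dz\<close> raises the index; with the recursion this is the radial equation.\<close>

lemma radial_sol_field_derivative:
  "z \<noteq> 0 \<Longrightarrow> (radial_sol s n has_field_derivative - z * radial_sol s (Suc n) z) (at z)"
proof (induction s n z rule: radial_sol.induct)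
  case (1 s z)
  have "((\<lambda>z. exp (- s * z) / z) has_field_derivative - z * ((s * z + 1) * exp (- s * z) / z ^ 3)) (at z)"
    using 1 by (auto intro!: derivative_eq_intros simp: field_simps power2_eq_square power3_eq_cube)
  then show ?case by (simp only: radial_sol.simps)
next
  case (2 s z)
  have "((\<lambda>z. (s * z + 1) * exp (- s * z) / z ^ 3) has_field_derivative
      (s * exp (- s * z) + (s * z + 1) * (- s * exp (- s * z))) / z ^ 3 - 3 * ((s * z + 1) * exp (- s * z)) / z ^ 4) (at z)"
    using 2 by (auto intro!: derivative_eq_intros simp: divide_simps) (simp add: algebra_simps eval_nat_numeral)
  moreover have "(s * exp (- s * z) + (s * z + 1) * (- s * exp (- s * z))) / z ^ 3 - 3 * ((s * z + 1) * exp (- s * z)) / z ^ 4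
      = - z * radial_sol s (Suc (Suc 0)) z"
    using 2 by (simp add: divide_simps) (simp add: algebra_simps eval_nat_numeral)
  ultimately have "((\<lambda>z. (s * z + 1) * exp (- s * z) / z ^ 3) has_field_derivative - z * radial_sol s (Suc (Suc 0)) z) (at z)"
    by simp
  then show ?case by (simp only: radial_sol.simps(2)[abs_def])
next
  case (3 s n z)
  let ?g = "\<lambda>k. radial_sol s k z"
  have "((\<lambda>z. (of_nat (2 * n + 3) * radial_sol s (Suc n) z + s\<^sup>2 * radial_sol s n z) / z\<^sup>2) has_field_derivative
     (of_nat (2 * n + 3) * (- z * ?g (Suc (Suc n))) + s\<^sup>2 * (- z * ?g (Suc n))) / z\<^sup>2
      - 2 * ((of_nat (2 * n + 3) * ?g (Suc n) + s\<^sup>2 * ?g n)) / z ^ 3) (at z)"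
    using 3 by (auto intro!: derivative_eq_intros simp del: radial_sol.simps simp: divide_simps)
      (simp add: algebra_simps eval_nat_numeral)
  moreover have "of_nat (2 * n + 3) * ?g (Suc n) + s\<^sup>2 * ?g n = z\<^sup>2 * ?g (Suc (Suc n))"
    using 3(3) by simp
  moreover have "(of_nat (2 * n + 3) * (- z * ?g (Suc (Suc n))) + s\<^sup>2 * (- z * ?g (Suc n))) / z\<^sup>2 - 2 * (z\<^sup>2 * ?g (Suc (Suc n))) / z ^ 3
     = - z * ((of_nat (2 * Suc n + 3) * ?g (Suc (Suc n)) + s\<^sup>2 * ?g (Suc n)) / z\<^sup>2)"
    using 3(3) by (simp add: divide_simps del: radial_sol.simps) (simp add: algebra_simps eval_nat_numeral del: radial_sol.simps)
  ultimately have "((\<lambda>z. (of_nat (2 * n + 3) * radial_sol s (Suc n) z + s\<^sup>2 * radial_sol s n z) / z\<^sup>2) has_field_derivative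
     - z * ((of_nat (2 * Suc n + 3) * ?g (Suc (Suc n)) + s\<^sup>2 * ?g (Suc n)) / z\<^sup>2)) (at z)"
    by (simp only:)
  then show ?case by (simp only: radial_sol.simps(3)[of s "Suc n" z] radial_sol.simps(3)[of s n, abs_def])
qed

lemma radial_sol_derivative:
  "r > 0 \<Longrightarrow> ((\<lambda>r. radial_sol s n (of_real r)) has_vector_derivative (of_real r * (- radial_sol s (Suc n) (of_real r)))) (at r)"
  using has_vector_derivative_real_field[OF radial_sol_field_derivative[of "of_real r" s n]] by simp

lemma radial_sol_continuous: "continuous_on {0<..} (\<lambda>r. radial_sol s n (of_real r))"
  by (intro continuous_at_imp_continuous_on ballI has_vector_derivative_continuous[OF radial_sol_derivative]) simp

lemma radial_sol_recurrence:
  "r > 0 \<Longrightarrow> (of_real r)\<^sup>2 * radial_sol s (Suc (Suc n)) (of_real r)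
     = of_nat (2 * n + 3) * radial_sol s (Suc n) (of_real r) + s\<^sup>2 * radial_sol s n (of_real r)"
  by simp

lemma radial_sol_ratio:
  assumes s: "Re s \<ge> 0" "s \<noteq> 0" and r: "r > 0"
  shows "(of_real r)\<^sup>2 * radial_sol s (Suc n) (of_real r)
      = s * of_real r * mode_ratio n (1 / (s * of_real r)) * radial_sol s n (of_real r)"
proof (induction n)
  case 0
  show ?case using s r by (simp add: divide_simps) (simp add: algebra_simps eval_nat_numeral)
next
  case (Suc n)
  let ?z = "1 / (s * of_real r)" and ?g = "\<lambda>n. radial_sol s n (of_real r)"
  have "Re ?z \<ge> 0" using s r by (intro Re_inverse_nonneg) simp
  then have W: "mode_ratio n ?z \<noteq> 0" by (rule mode_ratio_nonzero)
  have gn: "s * of_real r * ?g n = (of_real r)\<^sup>2 * ?g (Suc n) / mode_ratio n ?z"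
    unfolding Suc using W by simp
  have "s * of_real r * mode_ratio (Suc n) ?z * ?g (Suc n)
     = s * of_real r * ?g (Suc n) / mode_ratio n ?z + of_nat (2 * n + 3) * ?g (Suc n)"
    using s r W by (simp add: field_simps del: radial_sol.simps)
  also have "s * of_real r * ?g (Suc n) / mode_ratio n ?z = s * (s * of_real r * ?g n) / of_real r"
    unfolding gn using r by (simp add: power2_eq_square del: radial_sol.simps)
  also have "\<dots> = s\<^sup>2 * ?g n" using r by (simp add: power2_eq_square del: radial_sol.simps)
  finally show ?case unfolding radial_sol_recurrence[OF r] by simp
qed

lemma radial_sol_ratio_0: "r > 0 \<Longrightarrow> (of_real r)\<^sup>2 * radial_sol 0 (Suc n) (of_real r) = of_nat (2 * n + 1) * radial_sol 0 n (of_real r)"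
proof (cases n)
  case 0
  then show "r > 0 \<Longrightarrow> ?thesis" by (simp add: eval_nat_numeral)
next
  case (Suc m)
  then show "r > 0 \<Longrightarrow> ?thesis" using radial_sol_recurrence[of r 0 m] by (simp del: radial_sol.simps)
qed

lemma radial_sol_nonzero:
  assumes s: "Re s \<ge> 0" and r: "r > 0"
  shows "radial_sol s n (of_real r) \<noteq> 0"
proof (induction n)
  case 0
  show ?case using r by simp
next
  case (Suc n)
  have "(of_real r)\<^sup>2 * radial_sol s (Suc n) (of_real r) \<noteq> 0"
  proof (cases "s = 0")
    case True
    have "of_nat (2 * n + 1) \<noteq> (0::complex)" by (simp only: of_nat_eq_0_iff)
    then show ?thesis unfolding True radial_sol_ratio_0[OF r] using Suc True by (simp del: radial_sol.simps)
  next
    case False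
    have "Re (1 / (s * of_real r)) \<ge> 0" using s r by (intro Re_inverse_nonneg) simp
    then show ?thesis
      unfolding radial_sol_ratio[OF s False r] using mode_ratio_nonzero Suc False r by (simp del: radial_sol.simps)
  qed
  then show ?case by auto
qed

lemma radial_sol_bound:
  assumes s: "Re s \<ge> 0"
  shows "\<exists>C. \<forall>r\<ge>1. cmod (radial_sol s n (of_real r)) \<le> C / r ^ Suc n"
proof (induction n rule: induct_nat_012)
  case 0
  have "cmod (exp (- s * of_real r) / of_real r) \<le> 1 / r" if "r \<ge> 1" for r
    using that s by (simp add: norm_divide divide_right_mono)
  then show ?case by (intro exI[of _ 1]) simp
next
  case 1
  have "cmod ((s * of_real r + 1) * exp (- s * of_real r) / of_real r ^ 3) \<le> (cmod s + 1) / r ^ 2" if r: "r \<ge> 1" for r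
  proof -
    have "cmod (s * of_real r + 1) \<le> cmod s * r + 1"
      by (rule order_trans[OF norm_triangle_ineq]) (use r in \<open>simp add: norm_mult\<close>)
    also have "\<dots> \<le> (cmod s + 1) * r" using r by (simp add: algebra_simps)
    finally have "cmod (s * of_real r + 1) * cmod (exp (- s * of_real r)) \<le> ((cmod s + 1) * r) * 1"
      using s r by (intro mult_mono) auto
    then have "cmod ((s * of_real r + 1) * exp (- s * of_real r)) / r ^ 3 \<le> ((cmod s + 1) * r) / r ^ 3"
      using r by (intro divide_right_mono) (auto simp: norm_mult)
    also have "\<dots> = (cmod s + 1) / r ^ 2" using r by (simp add: eval_nat_numeral)
    finally show ?thesis using r by (simp add: norm_divide norm_power)
  qed
  then show ?case by (intro exI[of _ "cmod s + 1"]) (simp add: numeral_2_eq_2)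
next
  case (ge2 n)
  then obtain A B where A: "\<And>r. r \<ge> 1 \<Longrightarrow> cmod (radial_sol s n (of_real r)) \<le> A / r ^ Suc n"
    and B: "\<And>r. r \<ge> 1 \<Longrightarrow> cmod (radial_sol s (Suc n) (of_real r)) \<le> B / r ^ Suc (Suc n)" by blast
  have "A \<ge> 0" "B \<ge> 0" using order_trans[OF norm_ge_zero A[of 1]] order_trans[OF norm_ge_zero B[of 1]] by simp_all
  show ?case
  proof (intro exI allI impI)
    fix r :: real assume r: "r \<ge> 1"
    let ?g = "\<lambda>n. radial_sol s n (of_real r)"
    have "cmod (of_nat (2 * n + 3) * ?g (Suc n) + s\<^sup>2 * ?g n) \<le> real (2 * n + 3) * cmod (?g (Suc n)) + (cmod s)\<^sup>2 * cmod (?g n)"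
      by (rule order_trans[OF norm_triangle_ineq]) (simp only: norm_mult norm_of_nat norm_power)
    also have "\<dots> \<le> real (2 * n + 3) * (B / r ^ Suc n) + (cmod s)\<^sup>2 * (A / r ^ Suc n)"
    proof (intro add_mono mult_left_mono A r)
      have "cmod (?g (Suc n)) \<le> B / r ^ Suc (Suc n)" by (rule B[OF r])
      also have "\<dots> \<le> B / r ^ Suc n"
      proof (intro divide_left_mono power_increasing)
      qed (use r \<open>B \<ge> 0\<close> in auto)
      finally show "cmod (?g (Suc n)) \<le> B / r ^ Suc n" .
    qed auto
    also have "\<dots> = (real (2 * n + 3) * B + (cmod s)\<^sup>2 * A) / r ^ Suc n" by (simp add: add_divide_distrib)
    finally have "cmod (of_nat (2 * n + 3) * ?g (Suc n) + s\<^sup>2 * ?g n) / r\<^sup>2 \<le> ((real (2 * n + 3) * B + (cmod s)\<^sup>2 * A) / r ^ Suc n) / r\<^sup>2"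
      by (intro divide_right_mono) auto
    also have "\<dots> = (real (2 * n + 3) * B + (cmod s)\<^sup>2 * A) / r ^ Suc (Suc (Suc n))"
      by (simp add: power2_eq_square mult_ac)
    finally show "cmod (?g (Suc (Suc n))) \<le> (real (2 * n + 3) * B + (cmod s)\<^sup>2 * A) / r ^ Suc (Suc (Suc n))"
      using r by (simp add: norm_divide norm_power)
  qed
qed

text \<open>The last expression is the defect of the boundary condition for \<open>radial_sol s n\<close> times a monomial of
  degree \<open>n\<close>. For \<open>Re \<mu> < 0\<close> the decaying solution belongs to \<open>s = - \<mu>\<close>, otherwise to \<open>s = \<mu>\<close>; for purely
  imaginary \<open>\<mu>\<close> no solution decays exponentially, and the decay like \<open>1/r\<close> of the product with the monomial has to suffice below.\<close>

lemma boundary_value_nonzero: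
  fixes \<gamma> :: real
  assumes \<gamma>: "0 < \<gamma>" "\<gamma> < 1"
  obtains s where "Re s \<ge> 0" "s\<^sup>2 = \<mu>\<^sup>2"
    "\<And>n. (of_nat n - of_real \<gamma> * \<mu>) * radial_sol s n 1 - radial_sol s (Suc n) 1 \<noteq> 0"
proof -
  define s where "s = (if Re \<mu> < 0 then - \<mu> else \<mu>)"
  have s: "Re s \<ge> 0" "s\<^sup>2 = \<mu>\<^sup>2" by (auto simp: s_def)
  have "(of_nat n - of_real \<gamma> * \<mu>) * radial_sol s n 1 - radial_sol s (Suc n) 1 \<noteq> 0" for n
  proof (cases "s = 0")
    case True
    then have "\<mu> = 0" using s by simp
    have "radial_sol s (Suc n) 1 = of_nat (2 * n + 1) * radial_sol s n 1"
      using radial_sol_ratio_0[of 1 n] True by (simp del: radial_sol.simps)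
    then have "(of_nat n - of_real \<gamma> * \<mu>) * radial_sol s n 1 - radial_sol s (Suc n) 1 = - of_nat (n + 1) * radial_sol s n 1"
      by (simp add: \<open>\<mu> = 0\<close> algebra_simps del: radial_sol.simps)
    moreover have "of_nat (n + 1) \<noteq> (0::complex)" by (simp only: of_nat_eq_0_iff)
    moreover have "radial_sol s n 1 \<noteq> 0" using radial_sol_nonzero[of s 1 n] s by (simp del: radial_sol.simps)
    ultimately show ?thesis by (simp only: mult_eq_0_iff neg_equal_0_iff_equal simp_thms)
  next
    case False
    let ?W = "mode_ratio n (1 / s)"
    have g: "radial_sol s (Suc n) 1 = s * ?W * radial_sol s n 1"
      using radial_sol_ratio[OF s(1) False, of 1 n] by (simp del: radial_sol.simps)
    have "(of_nat n - of_real \<gamma> * \<mu>) * radial_sol s n 1 - radial_sol s (Suc n) 1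
       = - s * radial_sol s n 1 * (?W - of_nat n * (1 / s) + of_real \<gamma> * (\<mu> / s))"
      unfolding g using False by (simp add: field_simps del: radial_sol.simps)
    moreover have "?W - of_nat n * (1 / s) + of_real \<gamma> * (\<mu> / s) \<noteq> 0"
    proof (cases "Re \<mu> < 0")
      case True
      then have "\<mu> / s = - 1" using False by (simp add: s_def)
      moreover have "Re (1 / s) > 0" using True by (intro Re_inverse_pos) (simp add: s_def)
      ultimately show ?thesis using mode_ratio_avoids_unit_interval[OF _ \<gamma>, of "1 / s" n] by simp
    next
      case F: False
      then have "\<mu> / s = 1" using False by (simp add: s_def)
      moreover have "Re (1 / s) \<ge> 0"
        using s(1) by (rule Re_inverse_nonneg)
      ultimately show ?thesis using mode_ratio_avoids_negative_reals[of "1 / s" \<gamma> n] \<gamma> False by (simp add: eq_neg_iff_add_eq_0)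
    qed
    ultimately show ?thesis using False radial_sol_nonzero[of s 1 n] s by (simp del: radial_sol.simps)
  qed
  then show thesis using that s by blast
qed

lemma antiderivative_vanishing:
  fixes f :: "real \<Rightarrow> complex"
  assumes f: "continuous_on {0<..} f" and R: "R > 0" "\<And>r. r \<ge> R \<Longrightarrow> f r = 0"
  obtains F where "\<And>r. r > 0 \<Longrightarrow> (F has_vector_derivative f r) (at r)" "\<And>r. r \<ge> R \<Longrightarrow> F r = 0"
proof -
  define J where "J r = (LBINT y=ereal 1..ereal r. f y)" for r
  have J: "(J has_vector_derivative f r) (at r)" if r: "r > 0" for r
  proof -
    let ?a = "min (r / 2) (1 / 2)" and ?b = "max (r + 1) 2"
    have "((\<lambda>u. LBINT y=ereal 1..ereal u. f y) has_vector_derivative f r) (at r within {?a..?b})"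
      using r by (intro interval_integral_FTC2 continuous_on_subset[OF f]) (auto simp: min_def max_def)
    moreover have "at r within {?a..?b} = at r" using r by (intro at_within_Icc_at) (auto simp: min_def max_def)
    ultimately show ?thesis by (simp add: J_def[abs_def])
  qed
  have c: "J r = J R" if "r \<ge> R" for r
  proof -
    have "(J has_vector_derivative 0) (at x within {R..})" if x: "x \<in> {R..}" for x
    proof -
      have "x > 0" "f x = 0" using x R(1) R(2)[of x] by simp_all
      then show ?thesis using has_vector_derivative_at_within[OF J[OF \<open>x > 0\<close>], of "{R..}"] by simp
    qed
    then obtain c where c: "\<And>x. x \<in> {R..} \<Longrightarrow> J x = c"
      using has_vector_derivative_zero_constant[OF convex_real_interval(1), of R J] by blast
    then show ?thesis using c[of r] c[of R] that by simp
  qed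
  show thesis
  proof (rule that[of "\<lambda>r. J r - J R"])
    show "((\<lambda>r. J r - J R) has_vector_derivative f r) (at r)" if "r > 0" for r
      using has_vector_derivative_diff[OF J[OF that] has_vector_derivative_const[of "J R"]] by simp
    show "J r - J R = 0" if "r \<ge> R" for r using c[OF that] by (rule right_minus_eq[THEN iffD2])
  qed
qed

section \<open>Monomials\<close>

lemma C1_on_cong_derivative: "C1_on S F D \<Longrightarrow> (\<And>i x. D i x = D' i x) \<Longrightarrow> C1_on S F D'"
  by (metis (no_types, lifting) ext)

lemma C1_on_power:
  assumes "C1_on S F D" shows "C1_on S (\<lambda>x. F x ^ n) (\<lambda>i x. of_nat n * F x ^ (n - 1) * D i x)"
proof (induction n)
  case 0
  show ?case using C1_on_const[of S 1] by simp
next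
  case (Suc n)
  have "C1_on S (\<lambda>x. F x * F x ^ n) (\<lambda>i x. D i x * F x ^ n + F x * (of_nat n * F x ^ (n - 1) * D i x))"
    by (rule C1_on_mult[OF assms Suc])
  moreover have "D i x * F x ^ n + F x * (of_nat n * F x ^ (n - 1) * D i x) = of_nat (Suc n) * F x ^ (Suc n - 1) * D i x" for i x
    by (cases n) (simp_all add: algebra_simps)
  ultimately show ?case by (simp only: power_Suc)
qed

definition monomial :: "(3 \<Rightarrow> nat) \<Rightarrow> R3 \<Rightarrow> complex" where
  "monomial a x = (\<Prod>i\<in>UNIV. of_real (x $ i) ^ a i)"

lemma monomial_C1_on: "C1_on S (monomial a) (\<lambda>j x. of_nat (a j) * monomial (a(j := a j - 1)) x)"
proof -
  let ?x = "\<lambda>k (x::R3). complex_of_real (x $ k)"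
  have m: "monomial b x = ?x 1 x ^ b 1 * ?x 2 x ^ b 2 * ?x 3 x ^ b 3" for b x
    unfolding monomial_def UNIV_3 by (simp add: ac_simps)
  have "C1_on S (\<lambda>x. ?x 1 x ^ a 1 * ?x 2 x ^ a 2 * ?x 3 x ^ a 3)
    (\<lambda>i x. ((of_nat (a 1) * ?x 1 x ^ (a 1 - 1) * (if i = 1 then 1 else 0)) * ?x 2 x ^ a 2
          + ?x 1 x ^ a 1 * (of_nat (a 2) * ?x 2 x ^ (a 2 - 1) * (if i = 2 then 1 else 0))) * ?x 3 x ^ a 3
       + (?x 1 x ^ a 1 * ?x 2 x ^ a 2) * (of_nat (a 3) * ?x 3 x ^ (a 3 - 1) * (if i = 3 then 1 else 0)))"
    by (intro C1_on_mult C1_on_power C1_on_coord)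
  then have "C1_on S (\<lambda>x. ?x 1 x ^ a 1 * ?x 2 x ^ a 2 * ?x 3 x ^ a 3) (\<lambda>j x. of_nat (a j) * monomial (a(j := a j - 1)) x)"
  proof (rule C1_on_cong_derivative)
    fix i :: 3 and x :: R3
    show "((of_nat (a 1) * ?x 1 x ^ (a 1 - 1) * (if i = 1 then 1 else 0)) * ?x 2 x ^ a 2
          + ?x 1 x ^ a 1 * (of_nat (a 2) * ?x 2 x ^ (a 2 - 1) * (if i = 2 then 1 else 0))) * ?x 3 x ^ a 3
       + (?x 1 x ^ a 1 * ?x 2 x ^ a 2) * (of_nat (a 3) * ?x 3 x ^ (a 3 - 1) * (if i = 3 then 1 else 0))
       = of_nat (a i) * monomial (a(i := a i - 1)) x"
      using exhaust_3[of i] by (auto simp: m)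
  qed
  then show ?thesis by (simp only: m[abs_def])
qed

lemma monomial_lower: "of_real (x $ j) * (of_nat (a j) * monomial (a(j := a j - 1)) x) = of_nat (a j) * monomial a x"
proof (cases "a j")
  case 0
  then show ?thesis by simp
next
  case (Suc k)
  have "monomial b x = of_real (x $ j) ^ b j * (\<Prod>i\<in>UNIV - {j}. of_real (x $ i) ^ b i)" for b
    unfolding monomial_def by (rule prod.remove) auto
  from this[of a] this[of "a(j := a j - 1)"] show ?thesis by (simp add: Suc)
qed

lemma norm_monomial_le: "cmod (monomial a x) \<le> norm x ^ (\<Sum>i\<in>UNIV. a i)"
proof -
  have "cmod (monomial a x) = (\<Prod>i\<in>UNIV. \<bar>x $ i\<bar> ^ a i)"
    by (simp add: monomial_def prod_norm[symmetric] norm_power)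
  also have "\<dots> \<le> (\<Prod>i\<in>UNIV. norm x ^ a i)"
    by (intro prod_mono conjI power_mono component_le_norm_cart) auto
  also have "\<dots> = norm x ^ (\<Sum>i\<in>UNIV. a i)" by (simp add: power_sum)
  finally show ?thesis .
qed

definition laplacian_monomial :: "(3 \<Rightarrow> nat) \<Rightarrow> R3 \<Rightarrow> complex" where
  "laplacian_monomial a x = (\<Sum>i\<in>UNIV. of_nat (a i) * (of_nat (a i - 1) * monomial (a(i := a i - 1 - 1)) x))"

section \<open>Testing with a radial function times a monomial\<close>

text \<open>The adjoint formulation of \<open>\<Delta>u = \<mu>\<^sup>2 u\<close> with \<open>\<partial>\<^sub>r u = \<gamma> \<mu> u\<close> on the sphere: all conditions are imposed on the
  test function.\<close>

definition weak_robin_solution :: "real \<Rightarrow> complex \<Rightarrow> (R3 \<Rightarrow> complex) \<Rightarrow> bool" where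
  "weak_robin_solution \<gamma> \<mu> u \<longleftrightarrow> u \<in> L2 Omega \<and> (\<forall>\<phi> p q R. C1_on (- {0}) \<phi> p \<longrightarrow> (\<forall>i. C1_on (- {0}) (p i) (q i)) \<longrightarrow>
     (\<forall>x i j. norm x \<ge> R \<longrightarrow> \<phi> x = 0 \<and> p i x = 0 \<and> q i j x = 0) \<longrightarrow>
     (\<forall>x. norm x = 1 \<longrightarrow> (\<Sum>i\<in>UNIV. of_real (x $ i) * p i x) = of_real \<gamma> * \<mu> * \<phi> x) \<longrightarrow>
     (LINT x|lebesgue_on Omega. u x * ((\<Sum>i\<in>UNIV. q i i x) - \<mu>\<^sup>2 * \<phi> x)) = 0)"

lemma sum_coord_square: "(\<Sum>i\<in>UNIV. complex_of_real (x $ i) * of_real (x $ i)) = (of_real (norm x))\<^sup>2"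
proof -
  have "(\<Sum>i\<in>UNIV. x $ i * x $ i) = (norm x)\<^sup>2"
    by (simp add: power2_norm_eq_inner inner_vec_def)
  then have "complex_of_real (\<Sum>i\<in>UNIV. x $ i * x $ i) = of_real ((norm x)\<^sup>2)" by simp
  then show ?thesis by simp
qed

text \<open>With \<open>c1\<close> and \<open>c2\<close> obtained from \<open>c0\<close> by \<open>(1/r) d/dr\<close>, the Laplacian of \<open>c0(r) P\<close> is
  \<open>(r\<^sup>2 c2 + (2 n + 3) c1) P + c0 \<Delta>P\<close>, by Euler's identity for homogeneous functions.\<close>

lemma radial_monomial_test:
  assumes u: "weak_robin_solution \<gamma> \<mu> u"
    and c0: "\<And>r. r > 0 \<Longrightarrow> (c0 has_vector_derivative (of_real r * c1 r)) (at r)"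
    and c1: "\<And>r. r > 0 \<Longrightarrow> (c1 has_vector_derivative (of_real r * c2 r)) (at r)"
    and c2: "continuous_on {0<..} c2"
    and R: "\<And>r. r \<ge> R \<Longrightarrow> c0 r = 0" "\<And>r. r \<ge> R \<Longrightarrow> c1 r = 0" "\<And>r. r \<ge> R \<Longrightarrow> c2 r = 0"
    and n: "n = (\<Sum>i\<in>UNIV. a i)" and bc: "c1 1 + (of_nat n - of_real \<gamma> * \<mu>) * c0 1 = 0"
  shows "(LINT x|lebesgue_on Omega. u x * (((of_real (norm x))\<^sup>2 * c2 (norm x) + of_nat (2 * n + 3) * c1 (norm x)
      - \<mu>\<^sup>2 * c0 (norm x)) * monomial a x + c0 (norm x) * laplacian_monomial a x)) = 0"
proof -
  let ?S = "- {0 :: R3}"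
  define P1 where "P1 i x = of_nat (a i) * monomial (a(i := a i - 1)) x" for i x
  define P2 where "P2 i j x = of_nat (a i) * (of_nat ((a(i := a i - 1)) j) * monomial ((a(i := a i - 1))(j := (a(i := a i - 1)) j - 1)) x)" for i j x
  have P: "C1_on ?S (monomial a) P1" unfolding P1_def by (rule monomial_C1_on)
  have PP: "C1_on ?S (P1 i) (P2 i)" for i
    unfolding P1_def P2_def by (intro C1_on_cmult monomial_C1_on)
  have cont1: "continuous_on {0<..} c1"
    by (intro continuous_at_imp_continuous_on ballI has_vector_derivative_continuous[OF c1]) simp
  have r0: "C1_on ?S (\<lambda>x. c0 (norm x)) (\<lambda>i x. c1 (norm x) * of_real (x $ i))"
    by (rule C1_on_radial[OF c0 cont1])
  have r1: "C1_on ?S (\<lambda>x. c1 (norm x)) (\<lambda>i x. c2 (norm x) * of_real (x $ i))"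
    by (rule C1_on_radial[OF c1 c2])
  define \<phi> where "\<phi> x = c0 (norm x) * monomial a x" for x
  define p where "p i x = (c1 (norm x) * of_real (x $ i)) * monomial a x + c0 (norm x) * P1 i x" for i x
  define q where "q i j x = (((c2 (norm x) * of_real (x $ j)) * of_real (x $ i) + c1 (norm x) * (if j = i then 1 else 0)) * monomial a x
     + (c1 (norm x) * of_real (x $ i)) * P1 j x) + ((c1 (norm x) * of_real (x $ j)) * P1 i x + c0 (norm x) * P2 i j x)" for i j x
  have \<phi>: "C1_on ?S \<phi> p" unfolding \<phi>_def p_def by (intro C1_on_mult r0 P)
  have p: "C1_on ?S (p i) (q i)" for i
    unfolding p_def q_def by (intro C1_on_add C1_on_mult r0 r1 P PP C1_on_coord)
  have euler: "(\<Sum>i\<in>UNIV. of_real (x $ i) * P1 i x) = of_nat n * monomial a x" for x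
    unfolding P1_def monomial_lower by (simp add: n sum_distrib_right)
  have supp: "\<phi> x = 0 \<and> p i x = 0 \<and> q i j x = 0" if "norm x \<ge> R" for x i j
    using R[OF that] by (simp add: \<phi>_def p_def q_def)
  have radial: "(\<Sum>i\<in>UNIV. of_real (x $ i) * p i x) = ((of_real (norm x))\<^sup>2 * c1 (norm x) + of_nat n * c0 (norm x)) * monomial a x" for x
  proof -
    have "(\<Sum>i\<in>UNIV. of_real (x $ i) * p i x) = (\<Sum>i\<in>UNIV. complex_of_real (x $ i) * of_real (x $ i)) * (c1 (norm x) * monomial a x)
       + c0 (norm x) * (\<Sum>i\<in>UNIV. of_real (x $ i) * P1 i x)"
      by (simp add: p_def sum.distrib sum_distrib_left sum_distrib_right algebra_simps)
    then show ?thesis unfolding sum_coord_square euler by (simp add: algebra_simps)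
  qed
  have robin: "(\<Sum>i\<in>UNIV. of_real (x $ i) * p i x) = of_real \<gamma> * \<mu> * \<phi> x" if x: "norm x = 1" for x
  proof -
    have "c1 1 + of_nat n * c0 1 = of_real \<gamma> * \<mu> * c0 1" using bc by (simp add: algebra_simps)
    then show ?thesis unfolding radial \<phi>_def x by simp
  qed
  have tr: "(\<Sum>i\<in>UNIV. q i i x) - \<mu>\<^sup>2 * \<phi> x = ((of_real (norm x))\<^sup>2 * c2 (norm x) + of_nat (2 * n + 3) * c1 (norm x)
      - \<mu>\<^sup>2 * c0 (norm x)) * monomial a x + c0 (norm x) * laplacian_monomial a x" for x
  proof -
    have "(\<Sum>i\<in>UNIV. q i i x) = (\<Sum>i\<in>UNIV. complex_of_real (x $ i) * of_real (x $ i)) * (c2 (norm x) * monomial a x)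
       + 3 * (c1 (norm x) * monomial a x) + 2 * c1 (norm x) * (\<Sum>i\<in>UNIV. of_real (x $ i) * P1 i x)
       + c0 (norm x) * (\<Sum>i\<in>UNIV. P2 i i x)"
      by (simp add: q_def sum_3 algebra_simps)
    moreover have "(\<Sum>i\<in>UNIV. P2 i i x) = laplacian_monomial a x" by (simp add: P2_def laplacian_monomial_def)
    ultimately show ?thesis unfolding sum_coord_square euler \<phi>_def by (simp add: algebra_simps)
  qed
  have "(LINT x|lebesgue_on Omega. u x * ((\<Sum>i\<in>UNIV. q i i x) - \<mu>\<^sup>2 * \<phi> x)) = 0"
  proof -
    note W = u[unfolded weak_robin_solution_def, THEN conjunct2, THEN spec, of \<phi>, THEN spec, of p, THEN spec, of q, THEN spec, of R]
    show ?thesis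
      by (rule W[THEN mp, OF \<phi>, THEN mp, THEN mp, THEN mp]) (intro allI impI p supp robin; assumption)+
  qed
  then show ?thesis by (simp only: tr)
qed

lemma radial_monomial_L2:
  assumes "continuous_on {0<..} \<psi>" "\<And>r. r \<ge> R \<Longrightarrow> \<psi> r = 0"
  shows "(\<lambda>x. \<psi> (norm x) * monomial a x) \<in> L2 Omega"
proof (rule compact_support_L2[where R = R])
  have "continuous_on (- {0}) (\<lambda>x::R3. \<psi> (norm x))"
    by (rule continuous_on_compose2[OF assms(1)]) (auto intro!: continuous_intros)
  then show "continuous_on (- {0}) (\<lambda>x. \<psi> (norm x) * monomial a x)"
    by (intro continuous_intros C1_on_continuous[OF monomial_C1_on])
  show "\<psi> (norm x) * monomial a x = 0" if "norm x \<ge> R" for x using assms(2)[OF that] by simp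
qed

text \<open>A radial cutoff at radius \<open>N\<close> and its derivatives under \<open>(1/r) d/dr\<close>.\<close>

definition cut0 :: "real \<Rightarrow> real \<Rightarrow> real" where "cut0 N r = 1 - ramp (r / N)"
definition cut1 :: "real \<Rightarrow> real \<Rightarrow> real" where "cut1 N r = - ramp' (r / N) / (N * r)"
definition cut2 :: "real \<Rightarrow> real \<Rightarrow> real" where
  "cut2 N r = - ramp'' (r / N) / (N\<^sup>2 * r\<^sup>2) + ramp' (r / N) / (N * r ^ 3)"

lemma cut_derivative:
  assumes "N > 0" "r > 0"
  shows "(cut0 N has_real_derivative r * cut1 N r) (at r)" "(cut1 N has_real_derivative r * cut2 N r) (at r)"
proof -
  have l: "((\<lambda>r. r / N) has_real_derivative 1 / N) (at r)" using assms by (auto intro!: derivative_eq_intros)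
  have d0: "((\<lambda>r. ramp (r / N)) has_real_derivative ramp' (r / N) * (1 / N)) (at r)"
    using DERIV_chain'[OF l ramp_derivative] by (simp add: mult.commute)
  have d1: "((\<lambda>r. ramp' (r / N)) has_real_derivative ramp'' (r / N) * (1 / N)) (at r)"
    using DERIV_chain'[OF l ramp'_derivative] by (simp add: mult.commute)
  show "(cut0 N has_real_derivative r * cut1 N r) (at r)"
    unfolding cut0_def[abs_def] cut1_def using DERIV_diff[OF DERIV_const[of 1] d0] assms by simp
  have "((\<lambda>r. - ramp' (r / N) / (N * r)) has_real_derivative
     ((- (ramp'' (r / N) * (1 / N))) * (N * r) - (- ramp' (r / N)) * N) / (N * r * (N * r))) (at r)"
    by (rule DERIV_divide[OF DERIV_minus[OF d1]]) (use assms in \<open>auto intro!: derivative_eq_intros\<close>)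
  moreover have "((- (ramp'' (r / N) * (1 / N))) * (N * r) - (- ramp' (r / N)) * N) / (N * r * (N * r)) = r * cut2 N r"
    using assms by (simp add: cut2_def field_simps power2_eq_square power3_eq_cube)
  ultimately show "(cut1 N has_real_derivative r * cut2 N r) (at r)" by (simp add: cut1_def[abs_def])
qed

lemma cut_continuous: "N > 0 \<Longrightarrow> continuous_on {0<..} (cut2 N)"
  unfolding cut2_def ramp''_def ramp'_def by (intro continuous_intros) auto

lemma cut_near:
  assumes "N > 0" "r \<le> N" shows "cut0 N r = 1" "cut1 N r = 0" "cut2 N r = 0"
proof -
  have "r / N \<le> 1" using assms by (simp add: pos_divide_le_eq)
  then show "cut0 N r = 1" "cut1 N r = 0" "cut2 N r = 0" by (simp_all add: cut0_def cut1_def cut2_def ramp_0)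
qed

lemma cut_far:
  assumes "N > 0" "r \<ge> 2 * N" shows "cut0 N r = 0" "cut1 N r = 0" "cut2 N r = 0"
proof -
  have "r / N \<ge> 2" using assms by (simp add: pos_le_divide_eq)
  then show "cut0 N r = 0" "cut1 N r = 0" "cut2 N r = 0" by (simp_all add: cut0_def cut1_def cut2_def ramp_1)
qed

lemma cut_bounds:
  assumes "N \<ge> 1" "r \<ge> N" shows "\<bar>cut1 N r\<bar> \<le> 9 / (N * r)" "r\<^sup>2 * \<bar>cut2 N r\<bar> \<le> 81 / N"
proof -
  have r: "r \<ge> 1" "N > 0" "r > 0" using assms by auto
  show "\<bar>cut1 N r\<bar> \<le> 9 / (N * r)"
    using r ramp_bounds(2)[of "r / N"] by (simp add: cut1_def abs_mult divide_right_mono)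
  have "\<bar>cut2 N r\<bar> \<le> \<bar>ramp'' (r / N)\<bar> / (N\<^sup>2 * r\<^sup>2) + \<bar>ramp' (r / N)\<bar> / (N * r ^ 3)"
    unfolding cut2_def by (rule order_trans[OF abs_triangle_ineq]) (use r in \<open>simp add: abs_mult\<close>)
  also have "\<dots> \<le> 72 / (N\<^sup>2 * r\<^sup>2) + 9 / (N * r ^ 3)"
    using r ramp_bounds by (intro add_mono divide_right_mono) auto
  finally have "r\<^sup>2 * \<bar>cut2 N r\<bar> \<le> r\<^sup>2 * (72 / (N\<^sup>2 * r\<^sup>2) + 9 / (N * r ^ 3))" by (intro mult_left_mono) auto
  also have "\<dots> = 72 / N\<^sup>2 + 9 / (N * r)"
    using r by (simp add: field_simps power2_eq_square power3_eq_cube)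
  also have "\<dots> \<le> 72 / N + 9 / N"
  proof (rule add_mono)
    have "N * 1 \<le> N\<^sup>2" using assms by (simp add: power2_eq_square)
    then show "72 / N\<^sup>2 \<le> 72 / N" using r by (intro divide_left_mono) auto
    have "N * 1 \<le> N * r" using r by (intro mult_left_mono) auto
    then show "9 / (N * r) \<le> 9 / N" using r by (intro divide_left_mono) auto
  qed
  finally show "r\<^sup>2 * \<bar>cut2 N r\<bar> \<le> 81 / N" by simp
qed

text \<open>The error in the radial equation that is caused by truncating the homogeneous solution.\<close>

definition cut_residual :: "complex \<Rightarrow> nat \<Rightarrow> real \<Rightarrow> real \<Rightarrow> complex" where
  "cut_residual s n N r = (of_real r)\<^sup>2 * radial_sol s n (of_real r) * of_real (cut2 N r)
     - 2 * (of_real r)\<^sup>2 * radial_sol s (Suc n) (of_real r) * of_real (cut1 N r)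
     + of_nat (2 * n + 3) * radial_sol s n (of_real r) * of_real (cut1 N r)"

text \<open>The error lives on \<open>N \<le> r \<le> 2 N\<close>, where each derivative of the cutoff gains a factor \<open>1/N\<close> over the
  decay \<open>r\<^sup>-\<^sup>n\<^sup>-\<^sup>1\<close> of the solution. After multiplication by a monomial of degree \<open>n\<close> it is \<open>O(N\<^sup>-\<^sup>2)\<close> on a ball of volume
  \<open>O(N\<^sup>3)\<close>, hence tends to \<open>0\<close> in \<open>L\<^sup>2\<close>.\<close>

lemma cut_residual_bound:
  assumes s: "Re s \<ge> 0"
  obtains K where "K \<ge> 0" "\<And>N r. N \<ge> 1 \<Longrightarrow> r \<ge> 1 \<Longrightarrow> cmod (cut_residual s n N r) * r ^ n \<le> K / N\<^sup>2"
proof -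
  obtain A where A: "\<And>r. r \<ge> 1 \<Longrightarrow> cmod (radial_sol s n (of_real r)) \<le> A / r ^ Suc n" using radial_sol_bound[OF s, of n] by blast
  obtain B where B: "\<And>r. r \<ge> 1 \<Longrightarrow> cmod (radial_sol s (Suc n) (of_real r)) \<le> B / r ^ Suc (Suc n)" using radial_sol_bound[OF s, of "Suc n"] by blast
  have A0: "A \<ge> 0" "B \<ge> 0" using order_trans[OF norm_ge_zero A[of 1]] order_trans[OF norm_ge_zero B[of 1]] by simp_all
  define K where "K = 81 * A + 18 * B + (2 * n + 3) * 9 * A"
  have K0: "K \<ge> 0" using A0 by (simp add: K_def)
  have "cmod (cut_residual s n N r) * r ^ n \<le> K / N\<^sup>2" if N: "N \<ge> 1" and r: "r \<ge> 1" for N r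
  proof (cases "r \<le> N")
    case True
    then show ?thesis using cut_near[of N r] N K0 by (simp add: cut_residual_def)
  next
    case False
    then have rN: "r \<ge> N" "N > 0" "r > 0" using N by auto
    define g where "g = cmod (radial_sol s n (of_real r)) * r ^ n"
    define g1 where "g1 = cmod (radial_sol s (Suc n) (of_real r)) * r ^ n"
    have g: "0 \<le> g" "g \<le> A / r"
    proof -
      show "0 \<le> g" using rN by (simp add: g_def)
      have "g \<le> A / r ^ Suc n * r ^ n" unfolding g_def using rN by (intro mult_right_mono A r) auto
      then show "g \<le> A / r" using rN by simp
    qed
    have g1: "0 \<le> g1" "g1 \<le> B / r\<^sup>2"
    proof -
      show "0 \<le> g1" using rN by (simp add: g1_def)
      have "g1 \<le> B / r ^ Suc (Suc n) * r ^ n" unfolding g1_def using rN by (intro mult_right_mono B r) auto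
      then show "g1 \<le> B / r\<^sup>2" using rN by (simp add: power2_eq_square)
    qed
    have c1: "\<bar>cut1 N r\<bar> \<le> 9 / N" 
    proof -
      have "9 / (N * r) \<le> 9 / N"
      proof (rule divide_left_mono)
        show "N \<le> N * r" using r rN by simp
      qed (use rN in auto)
      then show ?thesis using cut_bounds(1)[OF N rN(1)] by linarith
    qed
    have "cmod (cut_residual s n N r) \<le> cmod ((of_real r)\<^sup>2 * radial_sol s n (of_real r) * of_real (cut2 N r))
      + cmod (2 * (of_real r)\<^sup>2 * radial_sol s (Suc n) (of_real r) * of_real (cut1 N r))
      + cmod (of_nat (2 * n + 3) * radial_sol s n (of_real r) * of_real (cut1 N r))"
      unfolding cut_residual_def by (intro order_trans[OF norm_triangle_ineq] add_right_mono norm_triangle_ineq4)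
    also have "\<dots> = r\<^sup>2 * cmod (radial_sol s n (of_real r)) * \<bar>cut2 N r\<bar>
      + 2 * r\<^sup>2 * cmod (radial_sol s (Suc n) (of_real r)) * \<bar>cut1 N r\<bar>
      + real (2 * n + 3) * cmod (radial_sol s n (of_real r)) * \<bar>cut1 N r\<bar>"
      by (simp only: norm_mult norm_power norm_of_real norm_of_nat norm_numeral power2_abs)
    finally have "cmod (cut_residual s n N r) * r ^ n \<le> (r\<^sup>2 * cmod (radial_sol s n (of_real r)) * \<bar>cut2 N r\<bar>
      + 2 * r\<^sup>2 * cmod (radial_sol s (Suc n) (of_real r)) * \<bar>cut1 N r\<bar>
      + real (2 * n + 3) * cmod (radial_sol s n (of_real r)) * \<bar>cut1 N r\<bar>) * r ^ n"
      using rN by (intro mult_right_mono) auto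
    also have "\<dots> = g * (r\<^sup>2 * \<bar>cut2 N r\<bar>) + 2 * (r\<^sup>2 * g1) * \<bar>cut1 N r\<bar> + real (2 * n + 3) * g * \<bar>cut1 N r\<bar>"
      unfolding g_def g1_def by (simp only: distrib_right) (simp only: mult.assoc mult.commute mult.left_commute)
    also have "\<dots> \<le> A / r * (81 / N) + 2 * B * (9 / (N * r)) + real (2 * n + 3) * (A / r) * (9 / N)"
    proof (intro add_mono)
      show "g * (r\<^sup>2 * \<bar>cut2 N r\<bar>) \<le> A / r * (81 / N)"
        using g cut_bounds(2)[OF N rN(1)] A0 rN by (intro mult_mono) auto
      have "r\<^sup>2 * g1 \<le> r\<^sup>2 * (B / r\<^sup>2)" using g1 by (intro mult_left_mono) auto
      then have "r\<^sup>2 * g1 \<le> B" using rN by simp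
      then show "2 * (r\<^sup>2 * g1) * \<bar>cut1 N r\<bar> \<le> 2 * B * (9 / (N * r))"
        using cut_bounds(1)[OF N rN(1)] A0 g1 by (intro mult_mono mult_nonneg_nonneg) auto
      show "real (2 * n + 3) * g * \<bar>cut1 N r\<bar> \<le> real (2 * n + 3) * (A / r) * (9 / N)"
        using g c1 A0 rN by (intro mult_mono mult_left_mono) auto
    qed
    also have "\<dots> = K / (N * r)" using rN by (simp add: K_def add_divide_distrib) (simp add: field_simps)
    also have "\<dots> \<le> K / N\<^sup>2"
    proof (rule divide_left_mono)
      show "N\<^sup>2 \<le> N * r" using rN by (simp add: power2_eq_square)
    qed (use K0 rN in auto)
    finally show ?thesis .
  qed
  with K0 show thesis by (rule that)
qed

lemma L2_norm_ball_bound: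
  assumes f: "f \<in> L2 Omega" and B: "\<And>x. x \<in> Omega \<Longrightarrow> cmod (f x) \<le> B" and R: "\<And>x. norm x \<ge> R \<Longrightarrow> f x = 0" and "R \<ge> 0" "B \<ge> 0"
  shows "(L2_norm Omega f)\<^sup>2 \<le> B\<^sup>2 * (4 / 3 * R ^ 3 * pi)"
proof -
  have i: "integrable lebesgue (\<lambda>x. B\<^sup>2 * indicator (ball (0::R3) R) x)"
    using lmeasurable_ball[of "0::R3" R] by (intro integrable_mult_right integrable_real_indicator) (auto simp: fmeasurable_def)
  have "(L2_norm Omega f)\<^sup>2 = (LINT x|lebesgue. indicator Omega x *\<^sub>R (cmod (f x))\<^sup>2)"
    unfolding L2_norm_power2 by (simp add: integral_restrict_space)
  also have "\<dots> \<le> (LINT x|lebesgue. B\<^sup>2 * indicator (ball (0::R3) R) x)"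
  proof (rule integral_mono[OF _ i])
    have "Omega \<inter> space lebesgue \<in> sets lebesgue" by simp
    then show "integrable lebesgue (\<lambda>x. indicator Omega x *\<^sub>R (cmod (f x))\<^sup>2)"
      using L2_square_integrable[OF f] by (simp only: integrable_restrict_space)
    show "indicator Omega x *\<^sub>R (cmod (f x))\<^sup>2 \<le> B\<^sup>2 * indicator (ball (0::R3) R) x" for x
    proof (cases "x \<in> Omega \<and> norm x < R")
      case True
      then show ?thesis using B[of x] by (simp add: power_mono)
    next
      case False
      then show ?thesis using R[of x] by (auto simp: indicator_def)
    qed
  qed
  also have "\<dots> = B\<^sup>2 * measure lborel (ball (0::R3) R)"
    by (simp add: measure_completion)
  also have "measure lborel (ball (0::R3) R) = 4 / 3 * R ^ 3 * pi" by (rule sphere_volume) fact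
  finally show ?thesis .
qed

text \<open>Reduction of order: \<open>radial_sol s n\<close> has no zeros, and for \<open>g y\<close> with \<open>g = radial_sol s n\<close> the radial equation
  becomes \<open>(r\<^bsup>2 n + 2\<^esup> g\<^sup>2 y')' = r\<^bsup>2 n + 2\<^esup> g \<psi>\<close>, which two integrations from infinity solve. In the conclusion \<open>g\<close> has
  been divided out.\<close>

lemma radial_solution_with_source:
  fixes \<psi> :: "real \<Rightarrow> complex"
  assumes s: "Re s \<ge> 0" and \<psi>: "continuous_on {0<..} \<psi>" "\<And>r. r \<ge> R \<Longrightarrow> \<psi> r = 0" and R: "R > 0"
  obtains y0 y1 y2 where
    "\<And>r. r > 0 \<Longrightarrow> (y0 has_vector_derivative (of_real r * y1 r)) (at r)"
    "\<And>r. r > 0 \<Longrightarrow> (y1 has_vector_derivative (of_real r * y2 r)) (at r)"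
    "continuous_on {0<..} y2"
    "\<And>r. r \<ge> R \<Longrightarrow> y0 r = 0" "\<And>r. r \<ge> R \<Longrightarrow> y1 r = 0" "\<And>r. r \<ge> R \<Longrightarrow> y2 r = 0"
    "\<And>r. r > 0 \<Longrightarrow> (of_real r)\<^sup>2 * radial_sol s n (of_real r) * y2 r
        - 2 * (of_real r)\<^sup>2 * radial_sol s (Suc n) (of_real r) * y1 r
        + of_nat (2 * n + 3) * radial_sol s n (of_real r) * y1 r = \<psi> r"
proof -
  let ?g = "\<lambda>z. radial_sol s n z" and ?g1 = "\<lambda>z. radial_sol s (Suc n) z"
  have gc: "continuous_on {0<..} (\<lambda>r. ?g (of_real r))" "continuous_on {0<..} (\<lambda>r. ?g1 (of_real r))"
    by (rule radial_sol_continuous)+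
  have g0: "?g (of_real r) \<noteq> 0" if "r > 0" for r :: real using radial_sol_nonzero[OF s that] .
  have f: "continuous_on {0<..} (\<lambda>r. of_real r ^ (2 * n + 2) * ?g (of_real r) * \<psi> r)"
    by (intro continuous_intros gc \<psi>)
  have f0: "of_real r ^ (2 * n + 2) * ?g (of_real r) * \<psi> r = 0" if "r \<ge> R" for r using \<psi>(2)[OF that] by simp
  obtain I where I: "\<And>r. r > 0 \<Longrightarrow> (I has_vector_derivative (of_real r ^ (2 * n + 2) * ?g (of_real r) * \<psi> r)) (at r)"
    and I0: "\<And>r. r \<ge> R \<Longrightarrow> I r = 0"
    by (rule antiderivative_vanishing[OF f R f0 that])
  define k where "k z = 1 / (z ^ (2 * n + 3) * (?g z)\<^sup>2)" for z
  have k: "(k has_field_derivative - k z * (of_nat (2 * n + 3) / z - 2 * z * ?g1 z / ?g z)) (at z)"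
    if z: "z \<noteq> 0" "?g z \<noteq> 0" for z
  proof -
    have p: "((\<lambda>z. z ^ (2 * n + 3)) has_field_derivative of_nat (2 * n + 3) * z ^ (2 * n + 2)) (at z)"
      using DERIV_power[OF DERIV_ident, of "2 * n + 3" z UNIV] by (simp add: eval_nat_numeral)
    have q: "((\<lambda>z. (?g z)\<^sup>2) has_field_derivative 2 * ?g z * (- z * ?g1 z)) (at z)"
      using DERIV_power[OF radial_sol_field_derivative[OF z(1), of s n], of 2] by (simp add: mult_ac)
    have "((\<lambda>z. inverse (z ^ (2 * n + 3) * (?g z)\<^sup>2)) has_field_derivative
      - (inverse (z ^ (2 * n + 3) * (?g z)\<^sup>2) * (of_nat (2 * n + 3) * z ^ (2 * n + 2) * (?g z)\<^sup>2 + 2 * ?g z * (- z * ?g1 z) * z ^ (2 * n + 3))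
         * inverse (z ^ (2 * n + 3) * (?g z)\<^sup>2))) (at z)"
      by (rule DERIV_inverse'[OF DERIV_mult[OF p q]]) (use z in simp)
    moreover have "inverse (z ^ (2 * n + 3) * (?g z)\<^sup>2) * (of_nat (2 * n + 3) * z ^ (2 * n + 2) * (?g z)\<^sup>2 + 2 * ?g z * (- z * ?g1 z) * z ^ (2 * n + 3))
        = of_nat (2 * n + 3) / z - 2 * z * ?g1 z / ?g z"
    proof -
      have "z ^ (2 * n + 3) = z * z ^ (2 * n + 2)" by (simp add: eval_nat_numeral)
      moreover have "z ^ (2 * n + 2) \<noteq> 0" using z by simp
      moreover have "inverse (z * w * g\<^sup>2) * (m * w * g\<^sup>2 + 2 * g * (- z * g1) * (z * w)) = m / z - 2 * z * g1 / g"
        if "w \<noteq> 0" "g \<noteq> 0" for w g g1 m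
        using that z(1) by (simp add: divide_simps) (simp add: algebra_simps power2_eq_square)
      ultimately show ?thesis using z(2) by (simp only:)
    qed
    ultimately show ?thesis unfolding k_def[abs_def] by (simp add: divide_inverse mult.commute)
  qed
  have kc: "continuous_on {0<..} (\<lambda>r. k (of_real r))"
    unfolding k_def by (intro continuous_intros gc) (use g0 in auto)
  define y1 where "y1 r = I r * k (of_real r)" for r
  define y2 where "y2 r = \<psi> r / ((of_real r)\<^sup>2 * ?g (of_real r))
     - y1 r * (of_nat (2 * n + 3) / (of_real r)\<^sup>2 - 2 * ?g1 (of_real r) / ?g (of_real r))" for r
  have Ic: "continuous_on {0<..} I"
    by (intro continuous_at_imp_continuous_on ballI has_vector_derivative_continuous[OF I]) simp
  have y1c: "continuous_on {0<..} y1" unfolding y1_def by (intro continuous_intros Ic kc)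
  have y2c: "continuous_on {0<..} y2"
    unfolding y2_def by (intro continuous_intros gc \<psi> y1c) (use g0 in auto)
  have y1d: "(y1 has_vector_derivative (of_real r * y2 r)) (at r)" if r: "r > 0" for r
  proof -
    have z: "complex_of_real r \<noteq> 0" using r by simp
    let ?z = "complex_of_real r"
    have "((\<lambda>r. k (of_real r)) has_vector_derivative - k ?z * (of_nat (2 * n + 3) / ?z - 2 * ?z * ?g1 ?z / ?g ?z)) (at r)"
      by (rule has_vector_derivative_real_field[OF k[OF z g0[OF r]]])
    from has_vector_derivative_mult[OF I[OF r] this]
    have "(y1 has_vector_derivative I r * (- k ?z * (of_nat (2 * n + 3) / ?z - 2 * ?z * ?g1 ?z / ?g ?z))
      + ?z ^ (2 * n + 2) * ?g ?z * \<psi> r * k ?z) (at r)"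
      by (simp only: y1_def[abs_def])
    moreover have "I r * (- k ?z * (of_nat (2 * n + 3) / ?z - 2 * ?z * ?g1 ?z / ?g ?z)) + ?z ^ (2 * n + 2) * ?g ?z * \<psi> r * k ?z = ?z * y2 r"
    proof -
      have "?z ^ (2 * n + 3) = ?z * ?z ^ (2 * n + 2)" by (simp add: eval_nat_numeral)
      moreover have "?z ^ (2 * n + 2) \<noteq> 0" using z by simp
      moreover have "w * g * p * (1 / (z * w * g\<^sup>2)) = p / (z * g)" if "w \<noteq> 0" "g \<noteq> 0" "z \<noteq> 0" for w g p z :: complex
        using that by (simp add: power2_eq_square)
      ultimately have 1: "?z ^ (2 * n + 2) * ?g ?z * \<psi> r * k ?z = \<psi> r / (?z * ?g ?z)"
        using g0[OF r] z unfolding k_def by (simp only:)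
      have 2: "- y * (m / z - 2 * z * h / g) + p / (z * g) = z * (p / (z\<^sup>2 * g) - y * (m / z\<^sup>2 - 2 * h / g))"
        if "z \<noteq> 0" "g \<noteq> 0" for y m z h g p :: complex
        using that by (simp add: divide_simps) (simp add: algebra_simps power2_eq_square)
      have "I r * (- k ?z * c) = - y1 r * c" for c by (simp add: y1_def)
      then show ?thesis unfolding 1 y2_def using 2[OF z g0[OF r]] by (simp only:)
    qed
    ultimately show ?thesis by (simp only:)
  qed
  have y10: "y1 r = 0" if "r \<ge> R" for r using I0[OF that] by (simp add: y1_def)
  have y20: "y2 r = 0" if "r \<ge> R" for r using y10[OF that] \<psi>(2)[OF that] by (simp add: y2_def)
  have h: "continuous_on {0<..} (\<lambda>r. of_real r * y1 r)" by (intro continuous_intros y1c)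
  have h0: "of_real r * y1 r = 0" if "r \<ge> R" for r using y10[OF that] by simp
  obtain y0 where y0: "\<And>r. r > 0 \<Longrightarrow> (y0 has_vector_derivative (of_real r * y1 r)) (at r)"
    and y00: "\<And>r. r \<ge> R \<Longrightarrow> y0 r = 0"
    by (rule antiderivative_vanishing[OF h R h0 that])
  have eq: "(of_real r)\<^sup>2 * ?g (of_real r) * y2 r - 2 * (of_real r)\<^sup>2 * ?g1 (of_real r) * y1 r
        + of_nat (2 * n + 3) * ?g (of_real r) * y1 r = \<psi> r" if r: "r > 0" for r
  proof -
    have z: "complex_of_real r \<noteq> 0" using r by simp
    have "z\<^sup>2 * g * (p / (z\<^sup>2 * g) - y * (m / z\<^sup>2 - 2 * h / g)) - 2 * z\<^sup>2 * h * y + m * g * y = p"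
      if "z \<noteq> 0" "g \<noteq> 0" for z g p y m h :: complex
      using that by (simp add: divide_simps) (simp add: algebra_simps)
    from this[OF z g0[OF r]] show ?thesis unfolding y2_def .
  qed
  show thesis by (rule that[OF y0 y1d y2c y00 y10 y20 eq])
qed

text \<open>The multiple \<open>c\<close> of the homogeneous solution repairs the boundary condition; it does not depend on \<open>N\<close>
  because the cutoff is \<open>1\<close> near the sphere.\<close>

lemma radial_test_functions:
  fixes \<psi> :: "real \<Rightarrow> complex"
  assumes s: "Re s \<ge> 0" "s\<^sup>2 = \<mu>\<^sup>2"
    and bv: "(of_nat n - of_real \<gamma> * \<mu>) * radial_sol s n 1 - radial_sol s (Suc n) 1 \<noteq> 0"
    and \<psi>: "continuous_on {0<..} \<psi>" "\<And>r. r \<ge> R \<Longrightarrow> \<psi> r = 0"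
  obtains c where "\<And>N. N \<ge> 1 \<Longrightarrow> \<exists>c0 c1 c2 R'.
    (\<forall>r>0. (c0 has_vector_derivative (of_real r * c1 r)) (at r)) \<and>
    (\<forall>r>0. (c1 has_vector_derivative (of_real r * c2 r)) (at r)) \<and>
    continuous_on {0<..} c2 \<and> (\<forall>r\<ge>R'. c0 r = 0 \<and> c1 r = 0 \<and> c2 r = 0) \<and>
    c1 1 + (of_nat n - of_real \<gamma> * \<mu>) * c0 1 = 0 \<and>
    (\<forall>r>0. (of_real r)\<^sup>2 * c2 r + of_nat (2 * n + 3) * c1 r - \<mu>\<^sup>2 * c0 r = \<psi> r + c * cut_residual s n N r)"
proof -
  have R: "max R 1 > 0" by simp
  have \<psi>': "\<psi> r = 0" if "r \<ge> max R 1" for r using \<psi>(2)[of r] that by simp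
  obtain y0 y1 y2 where y:
    "\<And>r. r > 0 \<Longrightarrow> (y0 has_vector_derivative (of_real r * y1 r)) (at r)"
    "\<And>r. r > 0 \<Longrightarrow> (y1 has_vector_derivative (of_real r * y2 r)) (at r)"
    "continuous_on {0<..} y2"
    "\<And>r. r \<ge> max R 1 \<Longrightarrow> y0 r = 0" "\<And>r. r \<ge> max R 1 \<Longrightarrow> y1 r = 0" "\<And>r. r \<ge> max R 1 \<Longrightarrow> y2 r = 0"
    "\<And>r. r > 0 \<Longrightarrow> (of_real r)\<^sup>2 * radial_sol s n (of_real r) * y2 r
        - 2 * (of_real r)\<^sup>2 * radial_sol s (Suc n) (of_real r) * y1 r
        + of_nat (2 * n + 3) * radial_sol s n (of_real r) * y1 r = \<psi> r"
    by (rule radial_solution_with_source[OF s(1) \<psi>(1) \<psi>' R that])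
  let ?g = "\<lambda>r. radial_sol s n (complex_of_real r)" and ?g1 = "\<lambda>r. radial_sol s (Suc n) (complex_of_real r)"
    and ?g2 = "\<lambda>r. radial_sol s (Suc (Suc n)) (complex_of_real r)"
  define b where "b = (of_nat n - of_real \<gamma> * \<mu>) * radial_sol s n 1 - radial_sol s (Suc n) 1"
  \<comment> \<open>The choice of \<open>c\<close> is where nonvanishing of the boundary value enters.\<close>
  define c where "c = - (b * y0 1 + radial_sol s n 1 * y1 1) / b"
  have cb: "b * (y0 1 + c) + radial_sol s n 1 * y1 1 = 0"
    using bv unfolding c_def b_def[symmetric] by (simp add: field_simps del: radial_sol.simps)
  show thesis
  proof (rule that[of c])
    fix N :: real assume N: "N \<ge> 1"
    then have N0: "N > 0" by simp
    define z0 where "z0 r = y0 r + c * of_real (cut0 N r)" for r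
    define z1 where "z1 r = y1 r + c * of_real (cut1 N r)" for r
    define z2 where "z2 r = y2 r + c * of_real (cut2 N r)" for r
    have dcut: "((\<lambda>r. c * of_real (cut0 N r)) has_vector_derivative c * of_real (r * cut1 N r)) (at r)"
      "((\<lambda>r. c * of_real (cut1 N r)) has_vector_derivative c * of_real (r * cut2 N r)) (at r)" if "r > 0" for r
      by (rule has_vector_derivative_mult_right, rule has_vector_derivative_of_real,
          rule cut_derivative[OF N0 that])+
    have z: "(z0 has_vector_derivative (of_real r * z1 r)) (at r)" "(z1 has_vector_derivative (of_real r * z2 r)) (at r)" if r: "r > 0" for r
    proof -
      have "(z0 has_vector_derivative (of_real r * y1 r + c * of_real (r * cut1 N r))) (at r)"
        unfolding z0_def[abs_def] by (rule has_vector_derivative_add[OF y(1)[OF r] dcut(1)[OF r]])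
      then show "(z0 has_vector_derivative (of_real r * z1 r)) (at r)" by (simp add: z1_def algebra_simps)
      have "(z1 has_vector_derivative (of_real r * y2 r + c * of_real (r * cut2 N r))) (at r)"
        unfolding z1_def[abs_def] by (rule has_vector_derivative_add[OF y(2)[OF r] dcut(2)[OF r]])
      then show "(z1 has_vector_derivative (of_real r * z2 r)) (at r)" by (simp add: z2_def algebra_simps)
    qed
    have z2c: "continuous_on {0<..} z2"
      unfolding z2_def by (intro continuous_intros y(3) cut_continuous N0)
    have zc: "continuous_on {0<..} z0" "continuous_on {0<..} z1"
      by (intro continuous_at_imp_continuous_on ballI has_vector_derivative_continuous[OF z(1)], simp)
        (intro continuous_at_imp_continuous_on ballI has_vector_derivative_continuous[OF z(2)], simp)
    define c0 where "c0 r = ?g r * z0 r" for r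
    define c1 where "c1 r = ?g r * z1 r - ?g1 r * z0 r" for r
    define c2 where "c2 r = ?g r * z2 r - 2 * ?g1 r * z1 r + ?g2 r * z0 r" for r
    have d: "(c0 has_vector_derivative (of_real r * c1 r)) (at r)" "(c1 has_vector_derivative (of_real r * c2 r)) (at r)" if r: "r > 0" for r
    proof -
      have "(c0 has_vector_derivative (?g r * (of_real r * z1 r) + (of_real r * - ?g1 r) * z0 r)) (at r)"
        unfolding c0_def[abs_def] by (rule has_vector_derivative_mult[OF radial_sol_derivative[OF r] z(1)[OF r]])
      then show "(c0 has_vector_derivative (of_real r * c1 r)) (at r)" by (simp add: c1_def algebra_simps del: radial_sol.simps)
      have "(c1 has_vector_derivative ((?g r * (of_real r * z2 r) + (of_real r * - ?g1 r) * z1 r) - (?g1 r * (of_real r * z1 r) + (of_real r * - ?g2 r) * z0 r))) (at r)"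
        unfolding c1_def[abs_def]
        by (rule has_vector_derivative_diff[OF has_vector_derivative_mult[OF radial_sol_derivative[OF r] z(2)[OF r]]
              has_vector_derivative_mult[OF radial_sol_derivative[OF r] z(1)[OF r]]])
      then show "(c1 has_vector_derivative (of_real r * c2 r)) (at r)" by (simp add: c2_def algebra_simps del: radial_sol.simps)
    qed
    have c2c: "continuous_on {0<..} c2"
      unfolding c2_def by (intro continuous_intros radial_sol_continuous z2c zc)
    have van: "c0 r = 0 \<and> c1 r = 0 \<and> c2 r = 0" if "r \<ge> max (max R 1) (2 * N)" for r
    proof -
      have "r \<ge> max R 1" "r \<ge> 2 * N" using that by auto
      then have "z0 r = 0" "z1 r = 0" "z2 r = 0"
        using y(4-6)[of r] cut_far[OF N0, of r] by (simp_all add: z0_def z1_def z2_def)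
      then show ?thesis by (simp add: c0_def c1_def c2_def del: radial_sol.simps)
    qed
    have bc: "c1 1 + (of_nat n - of_real \<gamma> * \<mu>) * c0 1 = 0"
    proof -
      have "z0 1 = y0 1 + c" "z1 1 = y1 1" using cut_near[OF N0, of 1] N by (simp_all add: z0_def z1_def)
      then have "c1 1 + (of_nat n - of_real \<gamma> * \<mu>) * c0 1 = b * (y0 1 + c) + radial_sol s n 1 * y1 1"
        by (simp add: c1_def c0_def b_def algebra_simps del: radial_sol.simps)
      then show ?thesis using cb by simp
    qed
    have eq: "(of_real r)\<^sup>2 * c2 r + of_nat (2 * n + 3) * c1 r - \<mu>\<^sup>2 * c0 r = \<psi> r + c * cut_residual s n N r" if r: "r > 0" for r
    proof -
      have "(of_real r)\<^sup>2 * c2 r + of_nat (2 * n + 3) * c1 r - \<mu>\<^sup>2 * c0 r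
        = ((of_real r)\<^sup>2 * ?g2 r - of_nat (2 * n + 3) * ?g1 r - s\<^sup>2 * ?g r) * z0 r
          + ((of_real r)\<^sup>2 * ?g r * z2 r - 2 * (of_real r)\<^sup>2 * ?g1 r * z1 r + of_nat (2 * n + 3) * ?g r * z1 r)"
        unfolding c0_def c1_def c2_def s(2)[symmetric] by (simp only: algebra_simps)
      also have "(of_real r)\<^sup>2 * ?g2 r - of_nat (2 * n + 3) * ?g1 r - s\<^sup>2 * ?g r = 0"
        unfolding radial_sol_recurrence[OF r] by simp
      also have "(of_real r)\<^sup>2 * ?g r * z2 r - 2 * (of_real r)\<^sup>2 * ?g1 r * z1 r + of_nat (2 * n + 3) * ?g r * z1 r
        = ((of_real r)\<^sup>2 * ?g r * y2 r - 2 * (of_real r)\<^sup>2 * ?g1 r * y1 r + of_nat (2 * n + 3) * ?g r * y1 r)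
          + c * cut_residual s n N r"
        unfolding z1_def z2_def cut_residual_def by (simp only: algebra_simps)
      finally show ?thesis unfolding y(7)[OF r] by simp
    qed
    show "\<exists>c0 c1 c2 R'.
      (\<forall>r>0. (c0 has_vector_derivative (of_real r * c1 r)) (at r)) \<and>
      (\<forall>r>0. (c1 has_vector_derivative (of_real r * c2 r)) (at r)) \<and>
      continuous_on {0<..} c2 \<and> (\<forall>r\<ge>R'. c0 r = 0 \<and> c1 r = 0 \<and> c2 r = 0) \<and>
      c1 1 + (of_nat n - of_real \<gamma> * \<mu>) * c0 1 = 0 \<and>
      (\<forall>r>0. (of_real r)\<^sup>2 * c2 r + of_nat (2 * n + 3) * c1 r - \<mu>\<^sup>2 * c0 r = \<psi> r + c * cut_residual s n N r)"
      by (rule exI[of _ c0], rule exI[of _ c1], rule exI[of _ c2], rule exI[of _ "max (max R 1) (2 * N)"])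
        (intro conjI allI impI d c2c van[THEN conjunct1] van[THEN conjunct2, THEN conjunct1] van[THEN conjunct2, THEN conjunct2] bc eq; assumption)
  qed
qed

text \<open>Testing with \<open>radial_test_functions\<close>, the term with \<open>\<Delta>P\<close> drops out by the induction hypothesis and the truncation
  error vanishes as \<open>N\<close> grows.\<close>

lemma radial_monomial_orthogonal:
  assumes u: "weak_robin_solution \<gamma> \<mu> u" and \<gamma>: "0 < \<gamma>" "\<gamma> < 1"
    and "continuous_on {0<..} \<psi>" "\<And>r. r \<ge> R \<Longrightarrow> \<psi> r = 0"
  shows "(LINT x|lebesgue_on Omega. u x * (\<psi> (norm x) * monomial a x)) = 0"
  using assms(4,5)
proof (induction "\<Sum>i\<in>UNIV. a i" arbitrary: a \<psi> R rule: less_induct)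
  case less
  let ?M = "lebesgue_on Omega"
  define n where "n = (\<Sum>i\<in>UNIV. a i)"
  have uL: "u \<in> L2 Omega" using u by (simp add: weak_robin_solution_def)
  obtain s where s: "Re s \<ge> 0" "s\<^sup>2 = \<mu>\<^sup>2"
    "\<And>n. (of_nat n - of_real \<gamma> * \<mu>) * radial_sol s n 1 - radial_sol s (Suc n) 1 \<noteq> 0"
    using boundary_value_nonzero[OF \<gamma>, of \<mu>] by blast
  obtain c where c: "\<And>N. N \<ge> 1 \<Longrightarrow> \<exists>c0 c1 c2 R'.
    (\<forall>r>0. (c0 has_vector_derivative (of_real r * c1 r)) (at r)) \<and>
    (\<forall>r>0. (c1 has_vector_derivative (of_real r * c2 r)) (at r)) \<and>
    continuous_on {0<..} c2 \<and> (\<forall>r\<ge>R'. c0 r = 0 \<and> c1 r = 0 \<and> c2 r = 0) \<and>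
    c1 1 + (of_nat n - of_real \<gamma> * \<mu>) * c0 1 = 0 \<and>
    (\<forall>r>0. (of_real r)\<^sup>2 * c2 r + of_nat (2 * n + 3) * c1 r - \<mu>\<^sup>2 * c0 r = \<psi> r + c * cut_residual s n N r)"
    by (rule radial_test_functions[OF s(1,2) s(3)[of n] less.prems that])
  obtain K where K: "K \<ge> 0" "\<And>N r. N \<ge> 1 \<Longrightarrow> r \<ge> 1 \<Longrightarrow> cmod (cut_residual s n N r) * r ^ n \<le> K / N\<^sup>2"
    using cut_residual_bound[OF s(1), of n] by blast
  have PL: "(\<lambda>x. \<psi> (norm x) * monomial a x) \<in> L2 Omega" by (rule radial_monomial_L2[OF less.prems])
  have res: "(\<lambda>x. cut_residual s n N (norm x) * monomial a x) \<in> L2 Omega"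
    "(L2_norm Omega (\<lambda>x. cut_residual s n N (norm x) * monomial a x))\<^sup>2 \<le> 32 * pi * K\<^sup>2 / N" if N: "N \<ge> 1" for N
  proof -
    have N0: "N > 0" using N by simp
    have cc: "continuous_on {0<..} (cut1 N)"
      by (intro continuous_at_imp_continuous_on ballI DERIV_isCont[OF cut_derivative(2)[OF N0]]) simp
    have rc: "continuous_on {0<..} (cut_residual s n N)"
      unfolding cut_residual_def by (intro continuous_intros radial_sol_continuous cut_continuous N0 cc)
    have r0: "cut_residual s n N r = 0" if "r \<ge> 2 * N" for r
      using cut_far[OF N0 that] by (simp add: cut_residual_def)
    show L: "(\<lambda>x. cut_residual s n N (norm x) * monomial a x) \<in> L2 Omega"
      by (rule radial_monomial_L2[OF rc r0])
    have "(L2_norm Omega (\<lambda>x. cut_residual s n N (norm x) * monomial a x))\<^sup>2 \<le> (K / N\<^sup>2)\<^sup>2 * (4 / 3 * (2 * N) ^ 3 * pi)"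
    proof (rule L2_norm_ball_bound[OF L])
      fix x assume "x \<in> Omega"
      then have x: "norm x \<ge> 1" by (simp add: in_Omega)
      have "cmod (cut_residual s n N (norm x) * monomial a x) \<le> cmod (cut_residual s n N (norm x)) * norm x ^ n"
        unfolding norm_mult n_def by (intro mult_left_mono norm_monomial_le) simp
      also have "\<dots> \<le> K / N\<^sup>2" by (rule K(2)[OF N x])
      finally show "cmod (cut_residual s n N (norm x) * monomial a x) \<le> K / N\<^sup>2" .
    next
      show "cut_residual s n N (norm x) * monomial a x = 0" if "norm x \<ge> 2 * N" for x using r0[OF that] by simp
    qed (use K(1) N in auto)
    also have "\<dots> = (32 / 3 * pi) * K\<^sup>2 / N"
      using N0 by (simp add: field_simps eval_nat_numeral)
    also have "\<dots> \<le> 32 * pi * K\<^sup>2 / N"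
      using N0 by (intro divide_right_mono mult_right_mono) auto
    finally show "(L2_norm Omega (\<lambda>x. cut_residual s n N (norm x) * monomial a x))\<^sup>2 \<le> 32 * pi * K\<^sup>2 / N" .
  qed
  have key: "(LINT x|?M. u x * (\<psi> (norm x) * monomial a x)) = - c * (LINT x|?M. (cut_residual s n N (norm x) * monomial a x) * u x)"
    if N: "N \<ge> 1" for N
  proof -
    obtain c0 c1 c2 R' where C: "\<And>r. r > 0 \<Longrightarrow> (c0 has_vector_derivative (of_real r * c1 r)) (at r)"
      "\<And>r. r > 0 \<Longrightarrow> (c1 has_vector_derivative (of_real r * c2 r)) (at r)"
      "continuous_on {0<..} c2" "\<And>r. r \<ge> R' \<Longrightarrow> c0 r = 0 \<and> c1 r = 0 \<and> c2 r = 0"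
      "c1 1 + (of_nat n - of_real \<gamma> * \<mu>) * c0 1 = 0"
      "\<And>r. r > 0 \<Longrightarrow> (of_real r)\<^sup>2 * c2 r + of_nat (2 * n + 3) * c1 r - \<mu>\<^sup>2 * c0 r = \<psi> r + c * cut_residual s n N r"
      using c[OF N] by (elim exE conjE) metis
    have c0c: "continuous_on {0<..} c0"
      by (intro continuous_at_imp_continuous_on ballI has_vector_derivative_continuous[OF C(1)]) simp
    have c00: "c0 r = 0" if "r \<ge> R'" for r using C(4)[OF that] by blast
    have ih: "(LINT x|?M. u x * (c0 (norm x) * (of_nat (a i) * (of_nat (a i - 1) * monomial (a(i := a i - 1 - 1)) x)))) = 0" for i
    proof (cases "a i \<ge> 2")
      case True
      have "(\<Sum>j\<in>UNIV. (a(i := a i - 1 - 1)) j) < (\<Sum>j\<in>UNIV. a j)"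
        by (rule sum_strict_mono_ex1) (use True in \<open>auto intro!: exI[of _ i]\<close>)
      from less.hyps[OF this c0c c00]
      have "(LINT x|?M. u x * (c0 (norm x) * monomial (a(i := a i - 1 - 1)) x)) = 0" .
      moreover have "u x * (c0 (norm x) * (of_nat (a i) * (of_nat (a i - 1) * monomial (a(i := a i - 1 - 1)) x)))
         = (of_nat (a i) * of_nat (a i - 1)) * (u x * (c0 (norm x) * monomial (a(i := a i - 1 - 1)) x))" for x
        by (simp only: mult.assoc mult.commute mult.left_commute)
      ultimately show ?thesis by (simp only: integral_mult_right_zero mult_zero_right)
    next
      case False
      then have "a i = 0 \<or> a i - 1 = 0" by linarith
      then have "complex_of_nat (a i) = 0 \<or> complex_of_nat (a i - 1) = 0" by (simp only: of_nat_eq_0_iff)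
      then show ?thesis by (auto simp only: mult_zero_left mult_zero_right Bochner_Integration.integral_zero)
    qed
    have iL: "integrable ?M (\<lambda>x. u x * (c0 (norm x) * (of_nat (a i) * (of_nat (a i - 1) * monomial (a(i := a i - 1 - 1)) x))))" for i
    proof -
      have "(\<lambda>x. (of_nat (a i) * of_nat (a i - 1)) * (c0 (norm x) * monomial (a(i := a i - 1 - 1)) x)) \<in> L2 Omega"
        by (intro L2_cmult radial_monomial_L2[OF c0c c00])
      from L2_mult_integrable[OF uL this] show ?thesis by (simp only: mult.assoc mult.commute mult.left_commute)
    qed
    have lap: "(LINT x|?M. u x * (c0 (norm x) * laplacian_monomial a x)) = 0" "integrable ?M (\<lambda>x. u x * (c0 (norm x) * laplacian_monomial a x))"
      unfolding laplacian_monomial_def sum_distrib_left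
      using iL ih by (auto simp only: Bochner_Integration.integral_sum sum.neutral_const intro!: Bochner_Integration.integrable_sum)
    have i1: "integrable ?M (\<lambda>x. u x * (\<psi> (norm x) * monomial a x))" by (rule L2_mult_integrable[OF uL PL])
    have i2: "integrable ?M (\<lambda>x. (cut_residual s n N (norm x) * monomial a x) * u x)" by (rule L2_mult_integrable[OF res(1)[OF N] uL])
    have "0 = (LINT x|?M. u x * (((of_real (norm x))\<^sup>2 * c2 (norm x) + of_nat (2 * n + 3) * c1 (norm x)
      - \<mu>\<^sup>2 * c0 (norm x)) * monomial a x + c0 (norm x) * laplacian_monomial a x))"
      by (rule radial_monomial_test[OF u C(1,2,3) _ _ _ n_def C(5), of R', symmetric]) (use C(4) in blast)+
    also have "\<dots> = (LINT x|?M. (u x * (\<psi> (norm x) * monomial a x) + c * ((cut_residual s n N (norm x) * monomial a x) * u x))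
       + u x * (c0 (norm x) * laplacian_monomial a x))"
    proof (rule Bochner_Integration.integral_cong[OF refl])
      fix x assume "x \<in> space ?M"
      then have "norm x > 1" by (simp add: in_Omega)
      then have "norm x > 0" by linarith
      from C(6)[OF this] show "u x * (((of_real (norm x))\<^sup>2 * c2 (norm x) + of_nat (2 * n + 3) * c1 (norm x)
        - \<mu>\<^sup>2 * c0 (norm x)) * monomial a x + c0 (norm x) * laplacian_monomial a x)
        = (u x * (\<psi> (norm x) * monomial a x) + c * ((cut_residual s n N (norm x) * monomial a x) * u x)) + u x * (c0 (norm x) * laplacian_monomial a x)"
        by (simp only:) (simp only: algebra_simps)
    qed
    also have "\<dots> = (LINT x|?M. u x * (\<psi> (norm x) * monomial a x)) + c * (LINT x|?M. (cut_residual s n N (norm x) * monomial a x) * u x)"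
      by (simp only: Bochner_Integration.integral_add Bochner_Integration.integrable_add integrable_mult_right i1 i2 lap
          integral_mult_right_zero add_0_right)
    finally show ?thesis by (simp add: eq_neg_iff_add_eq_0)
  qed
  have "cmod (LINT x|?M. u x * (\<psi> (norm x) * monomial a x)) \<le> 0"
  proof (rule field_le_epsilon)
    fix \<delta> :: real assume \<delta>: "\<delta> > 0"
    define B where "B = cmod c * (1 + (L2_norm Omega u)\<^sup>2)"
    have B: "B \<ge> 0" by (simp add: B_def)
    define \<epsilon> where "\<epsilon> = \<delta> / (B + 1)"
    have \<epsilon>: "\<epsilon> > 0" using \<delta> B by (simp add: \<epsilon>_def)
    define N where "N = max 1 (32 * pi * K\<^sup>2 / \<epsilon>\<^sup>2)"
    have N: "N \<ge> 1" "32 * pi * K\<^sup>2 / \<epsilon>\<^sup>2 \<le> N" by (auto simp: N_def)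
    have "32 * pi * K\<^sup>2 / N \<le> \<epsilon>\<^sup>2" using N \<epsilon> by (simp add: field_simps)
    then have "(L2_norm Omega (\<lambda>x. cut_residual s n N (norm x) * monomial a x))\<^sup>2 \<le> \<epsilon>\<^sup>2"
      using res(2)[OF N(1)] by linarith
    then have small: "L2_norm Omega (\<lambda>x. cut_residual s n N (norm x) * monomial a x) \<le> \<epsilon>"
      using \<epsilon> by (simp add: power2_le_iff_abs_le)
    have "cmod (LINT x|?M. u x * (\<psi> (norm x) * monomial a x)) = cmod c * cmod (LINT x|?M. (cut_residual s n N (norm x) * monomial a x) * u x)"
      unfolding key[OF N(1)] by (simp only: norm_mult norm_minus_cancel)
    also have "\<dots> \<le> cmod c * (\<epsilon> * (1 + (L2_norm Omega u)\<^sup>2))"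
      by (intro mult_left_mono integral_mult_small res(1)[OF N(1)] uL small \<epsilon>) simp
    also have "\<dots> = \<epsilon> * B" by (simp add: B_def)
    also have "\<dots> \<le> 0 + \<delta>" using B \<delta> by (simp add: \<epsilon>_def field_simps)
    finally show "cmod (LINT x|?M. u x * (\<psi> (norm x) * monomial a x)) \<le> 0 + \<delta>" .
  qed
  then show ?case by simp
qed

section \<open>Completeness and conclusion\<close>

inductive_set monomial_span :: "(R3 \<Rightarrow> real) set" where
  monomial: "(\<lambda>x. \<Prod>i\<in>UNIV. x $ i ^ a i) \<in> monomial_span"
| add: "f \<in> monomial_span \<Longrightarrow> g \<in> monomial_span \<Longrightarrow> (\<lambda>x. f x + g x) \<in> monomial_span"
| scale: "f \<in> monomial_span \<Longrightarrow> (\<lambda>x. c * f x) \<in> monomial_span"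

lemma monomial_span_mult:
  assumes "f \<in> monomial_span" "g \<in> monomial_span" shows "(\<lambda>x. f x * g x) \<in> monomial_span"
  using assms(1)
proof induction
  case (monomial a)
  show ?case using assms(2)
  proof induction
    case (monomial b)
    have "(\<lambda>x::R3. (\<Prod>i\<in>UNIV. x $ i ^ a i) * (\<Prod>i\<in>UNIV. x $ i ^ b i)) = (\<lambda>x. \<Prod>i\<in>UNIV. x $ i ^ (a i + b i))"
      by (simp add: power_add prod.distrib)
    then show ?case using monomial_span.monomial[of "\<lambda>i. a i + b i"] by simp
  next
    case (add f g)
    then show ?case using monomial_span.add by (simp add: distrib_left)
  next
    case (scale f c)
    then show ?case using monomial_span.scale[OF scale(2), of c] by (simp add: mult.left_commute)
  qed
next
  case (add f g')
  then show ?case using monomial_span.add by (simp add: distrib_right)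
next
  case (scale f c)
  then show ?case using monomial_span.scale[OF scale(2), of c] by (simp add: mult.assoc)
qed

lemma monomial_span_continuous: "f \<in> monomial_span \<Longrightarrow> continuous_on S f"
  by (induction rule: monomial_span.induct) (auto intro!: continuous_intros)

lemma monomial_span_const: "(\<lambda>x. c) \<in> monomial_span"
  using monomial_span.scale[OF monomial_span.monomial[of "\<lambda>i. 0"], of c] by simp

lemma monomial_span_coord: "(\<lambda>x. x $ k) \<in> monomial_span"
proof -
  have "(\<Prod>i\<in>UNIV. x $ i ^ (if i = k then 1 else 0)) = x $ k" for x :: R3
  proof -
    have "(\<Prod>i\<in>UNIV. x $ i ^ (if i = k then 1 else 0)) = (\<Prod>i\<in>UNIV. if i = k then x $ i else 1)"
      by (intro prod.cong) auto
    then show ?thesis by simp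
  qed
  then show ?thesis using monomial_span.monomial[of "\<lambda>i. if i = k then 1 else 0"] by simp
qed

lemma monomial_span_approximates:
  assumes "compact S" "continuous_on S h" "e > 0"
  obtains p where "p \<in> monomial_span" "\<And>x. x \<in> S \<Longrightarrow> \<bar>h x - p x\<bar> < e"
proof -
  have "\<exists>g. g \<in> monomial_span \<and> (\<forall>x\<in>S. \<bar>h x - g x\<bar> < e)"
  proof (rule Stone_Weierstrass_HOL[OF assms(1)])
    show "(\<lambda>x. c) \<in> monomial_span" for c by (rule monomial_span_const)
    show "f \<in> monomial_span \<Longrightarrow> continuous_on S f" for f by (rule monomial_span_continuous)
    show "f \<in> monomial_span \<and> g \<in> monomial_span \<Longrightarrow> (\<lambda>x. f x + g x) \<in> monomial_span" for f g
      by (auto intro: monomial_span.add)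
    show "f \<in> monomial_span \<and> g \<in> monomial_span \<Longrightarrow> (\<lambda>x. f x * g x) \<in> monomial_span" for f g
      by (auto intro: monomial_span_mult)
    show "\<exists>f. f \<in> monomial_span \<and> f x \<noteq> f y" if xy: "x \<in> S \<and> y \<in> S \<and> x \<noteq> y" for x y
    proof -
      obtain k where "x $ k \<noteq> y $ k" using xy vec_eq_iff[of x y] by blast
      then show ?thesis using monomial_span_coord[of k] by blast
    qed
  qed (use assms in auto)
  then show thesis using that by blast
qed

lemma orthogonal_radial_span:
  assumes u: "weak_robin_solution \<gamma> \<mu> u" and \<gamma>: "0 < \<gamma>" "\<gamma> < 1"
    and \<psi>: "continuous_on {0<..} \<psi>" "\<And>r. r \<ge> R \<Longrightarrow> \<psi> r = 0" and p: "p \<in> monomial_span"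
  shows "(\<lambda>x. \<psi> (norm x) * of_real (p x)) \<in> L2 Omega \<and> (LINT x|lebesgue_on Omega. u x * (\<psi> (norm x) * of_real (p x))) = 0"
  using p
proof induction
  case (monomial a)
  have "complex_of_real (\<Prod>i\<in>UNIV. x $ i ^ a i) = monomial a x" for x :: R3 by (simp add: monomial_def)
  moreover have "(\<lambda>x. \<psi> (norm x) * monomial a x) \<in> L2 Omega" by (rule radial_monomial_L2[OF \<psi>])
  moreover have "(LINT x|lebesgue_on Omega. u x * (\<psi> (norm x) * monomial a x)) = 0"
    by (rule radial_monomial_orthogonal[OF u \<gamma> \<psi>])
  ultimately show ?case by (simp only: simp_thms)
next
  case (add f g)
  have uL: "u \<in> L2 Omega" using u by (simp add: weak_robin_solution_def)
  have e: "\<psi> (norm x) * of_real (f x + g x) = \<psi> (norm x) * of_real (f x) + \<psi> (norm x) * of_real (g x)" for x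
    by (simp add: distrib_left)
  have "(LINT x|lebesgue_on Omega. u x * (\<psi> (norm x) * of_real (f x) + \<psi> (norm x) * of_real (g x))) = 0"
    using add.IH L2_mult_integrable[OF uL] by (simp add: distrib_left)
  then show ?case unfolding e using add.IH L2_add by blast
next
  case (scale f c)
  have e: "\<psi> (norm x) * of_real (c * f x) = of_real c * (\<psi> (norm x) * of_real (f x))" for x
    by simp
  have e2: "u x * (of_real c * (\<psi> (norm x) * of_real (f x))) = of_real c * (u x * (\<psi> (norm x) * of_real (f x)))" for x
    by simp
  show ?case unfolding e e2 using scale.IH L2_cmult by simp
qed

text \<open>A polynomial \<open>p\<close> approximates \<open>h\<close> uniformly on a ball that contains the support; a radial
  cutoff, which does not change \<open>h\<close>, removes \<open>p\<close> outside.\<close>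

lemma orthogonal_continuous:
  assumes u: "weak_robin_solution \<gamma> \<mu> u" and \<gamma>: "0 < \<gamma>" "\<gamma> < 1"
    and h: "continuous_on UNIV h" "\<And>x. norm x \<ge> R \<Longrightarrow> h x = 0"
  shows "(LINT x|lebesgue_on Omega. u x * of_real (h x)) = 0"
proof -
  let ?M = "lebesgue_on Omega"
  define S where "S = max R 0 + 1"
  have S: "S > 0" "S > R" by (auto simp: S_def)
  define \<psi> where "\<psi> r = complex_of_real (max 0 (min 1 (S - r)))" for r
  have \<psi>c: "continuous_on {0<..} \<psi>" unfolding \<psi>_def by (intro continuous_intros)
  have \<psi>0: "\<psi> r = 0" if "r \<ge> S" for r using that by (simp add: \<psi>_def)
  have \<psi>1: "\<psi> (norm x) * of_real (h x) = of_real (h x)" for x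
    using h(2)[of x] by (cases "norm x \<ge> R") (auto simp: \<psi>_def S_def)
  have \<psi>b: "cmod (\<psi> r) \<le> 1" for r by (simp add: \<psi>_def)
  have uL: "u \<in> L2 Omega" using u by (simp add: weak_robin_solution_def)
  have hL: "(\<lambda>x. complex_of_real (h x)) \<in> L2 Omega"
    by (rule compact_support_L2[where R = R]) (use h in \<open>auto intro!: continuous_intros continuous_on_subset[OF h(1)]\<close>)
  define V where "V = 4 / 3 * S ^ 3 * pi"
  have V: "V > 0" using S by (simp add: V_def)
  have "cmod (LINT x|?M. u x * of_real (h x)) \<le> 0"
  proof (rule field_le_epsilon)
    fix \<delta> :: real assume \<delta>: "\<delta> > 0"
    define B where "B = 1 + (L2_norm Omega u)\<^sup>2"
    have B: "B > 0" unfolding B_def by (rule add_pos_nonneg) auto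
    define \<epsilon> where "\<epsilon> = \<delta> / B"
    have \<epsilon>: "\<epsilon> > 0" using \<delta> B by (simp add: \<epsilon>_def)
    define e where "e = \<epsilon> / sqrt V"
    have e: "e > 0" using \<epsilon> V by (simp add: e_def)
    obtain p where p: "p \<in> monomial_span" "\<And>x. x \<in> cball 0 S \<Longrightarrow> \<bar>h x - p x\<bar> < e"
      using monomial_span_approximates[of "cball 0 S" h e] e continuous_on_subset[OF h(1)] by (metis compact_cball subset_UNIV)
    have pL: "(\<lambda>x. \<psi> (norm x) * of_real (p x)) \<in> L2 Omega" and p0: "(LINT x|?M. u x * (\<psi> (norm x) * of_real (p x))) = 0"
      using orthogonal_radial_span[OF u \<gamma> \<psi>c \<psi>0 p(1)] by auto
    define v where "v x = of_real (h x) - \<psi> (norm x) * of_real (p x)" for x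
    have vL: "v \<in> L2 Omega" unfolding v_def by (intro L2_diff hL pL)
    have veq: "v x = \<psi> (norm x) * of_real (h x - p x)" for x
      unfolding v_def by (subst \<psi>1[symmetric]) (simp add: algebra_simps)
    have "(L2_norm Omega v)\<^sup>2 \<le> e\<^sup>2 * (4 / 3 * S ^ 3 * pi)"
    proof (rule L2_norm_ball_bound[OF vL])
      show v0: "v x = 0" if "norm x \<ge> S" for x using \<psi>0[OF that] by (simp add: veq)
      show "cmod (v x) \<le> e" for x
      proof (cases "norm x \<le> S")
        case True
        have "cmod (v x) = cmod (\<psi> (norm x)) * \<bar>h x - p x\<bar>" unfolding veq norm_mult by (simp only: norm_of_real)
        also have "\<dots> \<le> 1 * e" using p(2)[of x] True by (intro mult_mono \<psi>b) auto
        finally show ?thesis by simp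
      next
        case False
        then show ?thesis using v0[of x] e by simp
      qed
    qed (use S e in auto)
    also have "e\<^sup>2 * (4 / 3 * S ^ 3 * pi) = \<epsilon>\<^sup>2" unfolding V_def[symmetric] using V by (simp add: e_def power_divide)
    finally have "L2_norm Omega v \<le> \<epsilon>" using \<epsilon> by (simp add: power2_le_iff_abs_le)
    then have "cmod (LINT x|?M. v x * u x) \<le> \<epsilon> * B" unfolding B_def by (intro integral_mult_small vL uL \<epsilon>)
    moreover have "(LINT x|?M. v x * u x) = (LINT x|?M. u x * of_real (h x))"
    proof -
      have "(LINT x|?M. v x * u x) = (LINT x|?M. u x * of_real (h x) - u x * (\<psi> (norm x) * of_real (p x)))"
        by (simp add: v_def algebra_simps)
      also have "\<dots> = (LINT x|?M. u x * of_real (h x)) - (LINT x|?M. u x * (\<psi> (norm x) * of_real (p x)))"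
        by (intro Bochner_Integration.integral_diff L2_mult_integrable uL hL pL)
      finally show ?thesis by (simp only: p0 diff_zero)
    qed
    moreover have "\<epsilon> * B = \<delta>" using B by (simp add: \<epsilon>_def)
    ultimately show "cmod (LINT x|?M. u x * of_real (h x)) \<le> 0 + \<delta>" by simp
  qed
  then show ?thesis by simp
qed

lemma weak_robin_solution_zero:
  assumes u: "weak_robin_solution \<gamma> \<mu> u" and \<gamma>: "0 < \<gamma>" "\<gamma> < 1"
  shows "AE x in lebesgue_on Omega. u x = 0"
proof (rule L2_zero_if_orthogonal_to_Cc_infty)
  show uL: "u \<in> L2 Omega" using u by (simp add: weak_robin_solution_def)
  fix \<phi> assume \<phi>: "\<phi> \<in> Cc_infty Omega"
  obtain R where R: "\<And>x. norm x \<ge> R \<Longrightarrow> \<phi> x = 0" using Cc_infty_bounded_support[OF \<phi>] by blast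
  have c: "continuous_on A \<phi>" for A by (rule smooth_continuous[OF Cc_infty_smooth[OF \<phi>]])
  have h: "continuous_on A (\<lambda>x. Re (\<phi> x))" "continuous_on A (\<lambda>x. Im (\<phi> x))" for A
    by (intro continuous_intros c)+
  have L: "(\<lambda>x. complex_of_real (Re (\<phi> x))) \<in> L2 Omega" "(\<lambda>x. complex_of_real (Im (\<phi> x))) \<in> L2 Omega"
    by (rule compact_support_L2[where R = R]; use R in \<open>auto intro!: continuous_intros c\<close>)+
  have "(LINT x|lebesgue_on Omega. u x * \<phi> x) = (LINT x|lebesgue_on Omega. u x * of_real (Re (\<phi> x)) + \<i> * (u x * of_real (Im (\<phi> x))))"
    by (rule Bochner_Integration.integral_cong[OF refl]) (simp add: complex_eq_iff algebra_simps)
  also have "\<dots> = (LINT x|lebesgue_on Omega. u x * of_real (Re (\<phi> x))) + \<i> * (LINT x|lebesgue_on Omega. u x * of_real (Im (\<phi> x)))"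
    using L2_mult_integrable[OF uL L(1)] L2_mult_integrable[OF uL L(2)] by simp
  also have "\<dots> = 0"
    using orthogonal_continuous[OF u \<gamma> h(1), of R] orthogonal_continuous[OF u \<gamma> h(2), of R] R by simp
  finally show "(LINT x|lebesgue_on Omega. u x * \<phi> x) = 0" .
qed

theorem propositionA4:
  fixes \<gamma> :: real
  assumes "0 < \<gamma>" and "\<gamma> < 1"
  shows "point_spectrum \<gamma> = {}"
proof (rule ccontr)
  assume "point_spectrum \<gamma> \<noteq> {}"
  then obtain \<mu> f where f: "f \<in> G_domain \<gamma>" "\<not> state_eq f zero_state" "state_eq (G f) (state_scale \<mu> f)"
    by (auto simp: point_spectrum_def)
  have fL: "fst f \<in> L2 Omega"
    using f(1) by (auto simp: G_domain_def maximal_domain_def energy_space_def H1_def)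
  have "weak_robin_solution \<gamma> \<mu> (fst f)"
    unfolding weak_robin_solution_def
  proof (intro conjI fL allI impI)
    fix \<phi> p q R
    assume 1: "C1_on (- {0}) \<phi> p" and 2: "\<forall>i. C1_on (- {0}) (p i) (q i)"
      and 3: "\<forall>x i j. R \<le> norm x \<longrightarrow> \<phi> x = 0 \<and> p i x = 0 \<and> q i j x = 0"
      and 4: "\<forall>x. norm x = 1 \<longrightarrow> (\<Sum>i\<in>UNIV. of_real (x $ i) * p i x) = of_real \<gamma> * \<mu> * \<phi> x"
    show "(LINT x|lebesgue_on Omega. fst f x * ((\<Sum>i\<in>UNIV. q i i x) - \<mu>\<^sup>2 * \<phi> x)) = 0"
      by (rule eigenstate_orthogonal[OF f(1,3) 1, of q R]) (use 2 3 4 in auto)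
  qed
  then have z: "AE x in lebesgue_on Omega. fst f x = 0"
    by (rule weak_robin_solution_zero[OF _ assms])
  moreover have "AE x in lebesgue_on Omega. snd f x = \<mu> * fst f x"
    using f(3) by (auto simp: state_eq_def G_def state_scale_def elim: eventually_mono)
  ultimately have "AE x in lebesgue_on Omega. fst f x = 0 \<and> snd f x = 0" by eventually_elim simp
  then have "state_eq f zero_state" by (simp add: state_eq_def zero_state_def)
  with f(2) show False by simp
qed

end
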